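(* Let $R\subset S$ be an inclusion of $\sigma$-rings such that $S$ is an integral domain and $\sigma$ is injective on $S$. Assume that $S$ is finitely $\sigma$-generated over $R$. Then there exist an integer $l\geq 1$ and a non-zero element $r\in R$ such that for all $d\geq 1$ and all $\sigma^d$-prime ideals $\mathfrak{q}$ of $R$ with $r\sigma(r)\cdots\sigma^{d-1}(r)\notin\mathfrak{q}$ there exists a $\sigma^{ld}$-prime ideal $\mathfrak{q}'$ of $S$ with $\mathfrak{q}'\cap R=\mathfrak{q}$. In particular, for every $\sigma$-prime ideal $\mathfrak{q}$ of $R$ with $r\notin\mathfrak{q}$ there exists a $\sigma^l$-prime ideal $\mathfrak{q}'$ of $S$ with $\mathfrak{q}'\cap R=\mathfrak{q}$.
   Context: All rings are commutative with identity. A $\sigma$-ring is a ring $R$ together with a ring endomorphism $\sigma:R\to R$ (not assumed injective). An inclusion $R\subset S$ of $\sigma$-rings means that $R$ is a subring of $S$ and the endomorphism of $S$ restricts to that of $R$. $S$ is finitely $\sigma$-generated over $R$ if there is a finite tuple $a$ of elements of $S$ with $S=R\{a\}:=R[a,\sigma(a),\sigma^2(a),\ldots]$. For $d\geq 1$, a $\sigma^d$-prime ideal of a $\sigma$-ring $R$ is a prime ideal $\mathfrak{q}$ of $R$ with $\sigma^{-d}(\mathfrak{q})=\mathfrak{q}$, where $\sigma^{-d}(\mathfrak{q})=\{a\in R\mid \sigma^d(a)\in\mathfrak{q}\}$; a $\sigma$-prime ideal is the case $d=1$. *)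

theory Defs
  imports "HOL-Algebra.Algebra"
begin

definition sigma_ring :: "('a, 'm) ring_scheme \<Rightarrow> ('a \<Rightarrow> 'a) \<Rightarrow> bool" where
  "sigma_ring R \<sigma> \<longleftrightarrow> cring R \<and> \<sigma> \<in> ring_hom R R"

text \<open>An inclusion of a \<open>\<sigma>\<close>-ring into a \<open>\<sigma>\<close>-ring \<open>S\<close> is given by its image, a subset \<open>R\<close> of
  the carrier of \<open>S\<close>. The \<open>\<sigma>\<close>-ring \<open>R\<close> itself is \<open>S\<lparr>carrier := R\<rparr>\<close> with the same \<open>\<sigma>\<close>.\<close>

definition sigma_subring :: "'a set \<Rightarrow> ('a, 'm) ring_scheme \<Rightarrow> ('a \<Rightarrow> 'a) \<Rightarrow> bool" where
  "sigma_subring R S \<sigma> \<longleftrightarrow> sigma_ring S \<sigma> \<and> subring R S \<and> \<sigma> ` R \<subseteq> R"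

text \<open>The subring \<open>R[A, \<sigma>(A), \<sigma>\<^sup>2(A), \<dots>]\<close> of \<open>S\<close>.\<close>

definition sigma_adjoin ::
    "('a, 'm) ring_scheme \<Rightarrow> ('a \<Rightarrow> 'a) \<Rightarrow> 'a set \<Rightarrow> 'a set \<Rightarrow> 'a set" where
  "sigma_adjoin S \<sigma> R A = generate_ring S (R \<union> (\<Union>n. (\<sigma> ^^ n) ` A))"

definition finitely_sigma_generated ::
    "'a set \<Rightarrow> ('a, 'm) ring_scheme \<Rightarrow> ('a \<Rightarrow> 'a) \<Rightarrow> bool" where
  "finitely_sigma_generated R S \<sigma> \<longleftrightarrow>
     (\<exists>A. finite A \<and> A \<subseteq> carrier S \<and> carrier S = sigma_adjoin S \<sigma> R A)"

definition sigma_pow_primeideal ::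
    "nat \<Rightarrow> 'a set \<Rightarrow> ('a, 'm) ring_scheme \<Rightarrow> ('a \<Rightarrow> 'a) \<Rightarrow> bool" where
  "sigma_pow_primeideal d \<qq> R \<sigma> \<longleftrightarrow>
     primeideal \<qq> R \<and> {a \<in> carrier R. (\<sigma> ^^ d) a \<in> \<qq>} = \<qq>"

abbreviation sigma_primeideal :: "'a set \<Rightarrow> ('a, 'm) ring_scheme \<Rightarrow> ('a \<Rightarrow> 'a) \<Rightarrow> bool" where
  "sigma_primeideal \<equiv> sigma_pow_primeideal 1"

lemma sigma_subring_imp_sigma_ring:
  assumes "sigma_subring R S \<sigma>"
  shows "sigma_ring (S\<lparr>carrier := R\<rparr>) \<sigma>"
proof -
  have S: "cring S" and hom: "\<sigma> \<in> ring_hom S S" and R: "subring R S" and inv: "\<sigma> ` R \<subseteq> R"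
    using assms by (auto simp: sigma_subring_def sigma_ring_def)
  interpret S: cring S by fact
  have sub: "R \<subseteq> carrier S"
    using R by (rule subringE(1))
  have "subcring R S"
    using S.subcringI'[OF R] .
  then have "cring (S\<lparr>carrier := R\<rparr>)"
    using S.subcring_iff[OF sub] by simp
  moreover have "\<sigma> \<in> ring_hom (S\<lparr>carrier := R\<rparr>) (S\<lparr>carrier := R\<rparr>)"
    using hom inv sub unfolding ring_hom_def by (auto simp: subset_iff)
  ultimately show ?thesis
    by (simp add: sigma_ring_def)
qed

end

theory Submission
  imports Defs
begin

text \<open>
  Since the conclusion, strengthened so that the prime \<open>\<qq>'\<close> also avoids all \<open>\<sigma>\<^sup>i(s)\<close> for a given
  \<open>s \<noteq> 0\<close>, is transitive in towers, one may assume that \<open>S = R{a}\<close>. Pulling primes back along a power of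
  \<open>\<sigma>\<close> allows one to replace \<open>a\<close> by \<open>\<sigma>\<^sup>N(a)\<close>. If the \<open>\<sigma>\<^sup>i(a)\<close> are independent over \<open>R\<close>, extend primes
  coefficientwise. Otherwise, for a suitable \<open>N\<close>, every window of \<open>m\<close> successive conjugates of \<open>a\<close> is
  a transcendence basis, and from some \<open>n\<^sub>0\<close> on the minimal relation of \<open>\<sigma>\<^sup>n\<^sup>+\<^sup>1(a)\<close> over
  \<open>S\<^sub>n = R[a, \<dots>, \<sigma>\<^sup>n(a)]\<close> is the image under \<open>\<sigma>\<close> of the previous one, so that \<open>S\<^sub>n\<^sub>+\<^sub>1\<close> is generically a fibre product
  of two copies of \<open>S\<^sub>n\<close> over \<open>S\<^sub>n\<^sub>-\<^sub>1\<close>. Hence a sequence of primes \<open>y\<^sub>i\<close> of \<open>S\<^sub>n\<close>, \<open>n = n\<^sub>0 + 1\<close>, lying over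
  \<open>\<sigma>\<^sup>-\<^sup>i(\<qq>)\<close> and such that \<open>\<sigma>\<^sup>-\<^sup>1(y\<^sub>i)\<close> and \<open>y\<^sub>i\<^sub>+\<^sub>1\<close> agree one level below, can be extended
  compatibly to all levels. Primes in which \<open>a, \<dots>, \<sigma>\<^sup>m\<^sup>-\<^sup>1(a)\<close> stay independent form such sequences, and only
  boundedly many of them lie over a given prime of \<open>R\<close>; the pigeonhole principle yields a periodic
  sequence whose period divides \<open>ld\<close> for a fixed \<open>l\<close>.
\<close>

section \<open>Polynomials over subrings and algebraicity modulo a prime\<close>

text \<open>No fraction fields, residue fields or localizations are formed: all rings are subsets of
  one carrier, and a denominator becomes a power of a fixed element outside the prime in question.
  The obstacle is that primes can only be pulled back along \<open>\<sigma>\<close>. In the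
  algebraic case each prime of the sequence comes from the one before by choosing an extension to
  the next level and pulling it back, and nothing forces the sequence to close up. What closes it is
  a fibre bound independent of \<open>q\<close> and \<open>d\<close>: the number
  \<open>card I\<close> of generators of the ring at level \<open>n0\<close> over
  \<open>W 0 m\<close>, after inverting one element \<open>c\<close>. The primes used are determined
  on \<open>W 0 m\<close> by their contraction to the base ring, so entries at multiples of
  \<open>d\<close> lie in one fibre. Two of the first \<open>card I + 1\<close> of them coincide,
  the period found is at most \<open>card I\<close> times \<open>d\<close>, and
  \<open>l = fact (card I)\<close> does not depend on which period it is. The element
  \<open>r\<close> only has to keep finitely many elements out of the primes used and to guarantee a
  first prime; the product condition enters in the form that no \<open>\<sigma>\<close>-iterate of
  \<open>r\<close> lies in \<open>q\<close>.\<close>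

context UP_domain
begin

abbreviation cf :: "(nat \<Rightarrow> 'a) \<Rightarrow> nat \<Rightarrow> 'a" where
  "cf \<equiv> up_ring.coeff P"

abbreviation mon :: "'a \<Rightarrow> nat \<Rightarrow> nat \<Rightarrow> 'a" where
  "mon \<equiv> up_ring.monom P"

abbreviation padd :: "(nat \<Rightarrow> 'a) \<Rightarrow> (nat \<Rightarrow> 'a) \<Rightarrow> nat \<Rightarrow> 'a" (infixl "+\<^sub>P" 65) where
  "f +\<^sub>P g \<equiv> f \<oplus>\<^bsub>P\<^esub> g"

abbreviation pminus :: "(nat \<Rightarrow> 'a) \<Rightarrow> (nat \<Rightarrow> 'a) \<Rightarrow> nat \<Rightarrow> 'a" (infixl "-\<^sub>P" 65) where
  "f -\<^sub>P g \<equiv> f \<ominus>\<^bsub>P\<^esub> g"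

abbreviation pmult :: "(nat \<Rightarrow> 'a) \<Rightarrow> (nat \<Rightarrow> 'a) \<Rightarrow> nat \<Rightarrow> 'a" (infixl "*\<^sub>P" 70) where
  "f *\<^sub>P g \<equiv> f \<otimes>\<^bsub>P\<^esub> g"

definition cpoly :: "'a set \<Rightarrow> (nat \<Rightarrow> 'a) set" where
  "cpoly B = {f \<in> carrier P. \<forall>n. cf f n \<in> B}"

definition ev :: "'a \<Rightarrow> (nat \<Rightarrow> 'a) \<Rightarrow> 'a" where
  "ev t f = UnivPoly.eval R R id t f"

definition adj :: "'a set \<Rightarrow> 'a \<Rightarrow> 'a set" where
  "adj B t = ev t ` cpoly B"

text \<open>Primality is relative to a subset of the one carrier, so that no record update is needed
  while the rings vary; \<open>prime_in_iff\<close> translates back.\<close>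

definition prime_in :: "'a set \<Rightarrow> 'a set \<Rightarrow> bool" where
  "prime_in Y C \<longleftrightarrow> Y \<subseteq> C \<and> \<zero> \<in> Y \<and> \<one> \<notin> Y \<and> (\<forall>a\<in>Y. \<forall>b\<in>Y. a \<oplus> b \<in> Y) \<and>
     (\<forall>a\<in>C. \<forall>b\<in>Y. a \<otimes> b \<in> Y) \<and> (\<forall>a\<in>C. \<forall>b\<in>C. a \<otimes> b \<in> Y \<longrightarrow> a \<in> Y \<or> b \<in> Y)"

text \<open>For a prime \<open>Y\<close> of a ring containing \<open>B\<close> and \<open>t\<close>: the class of \<open>t\<close> in the residue field of \<open>Y\<close> is
  algebraic over the classes of \<open>B\<close>. With \<open>Y = {0}\<close> this is algebraicity over \<open>B\<close>.\<close>

definition alg :: "'a set \<Rightarrow> 'a set \<Rightarrow> 'a \<Rightarrow> bool" where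
  "alg Y B t \<longleftrightarrow> (\<exists>f\<in>cpoly B. f \<notin> cpoly Y \<and> ev t f \<in> Y)"

lemma ev_hom: "t \<in> carrier R \<Longrightarrow> ring_hom_cring P R (ev t)"
proof -
  assume t: "t \<in> carrier R"
  interpret I: UP_pre_univ_prop R R id P
    by unfold_locales (auto simp: P_def)
  show ?thesis
    using I.ring_homD[OF I.eval_ring_hom[OF t]] unfolding ev_def[abs_def] by (simp add: eta_contract_eq)
qed

lemma cpolyD:
  assumes "f \<in> cpoly B"
  shows "f \<in> carrier P" "cf f n \<in> B"
  using assms by (auto simp: cpoly_def)

lemma cpoly_mono: "B \<subseteq> C \<Longrightarrow> cpoly B \<subseteq> cpoly C"
  by (auto simp: cpoly_def)

lemma poly_fun:
  assumes "\<And>n. F n \<in> carrier R" "\<And>n. n > k \<Longrightarrow> F n = \<zero>"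
  shows "F \<in> carrier P" "cf F n = F n"
proof -
  have "bound \<zero> k F" using assms(2) by auto
  then have F: "F \<in> up R" using assms(1) by blast
  show "F \<in> carrier P" using F unfolding P_def UP_def by simp
  show "cf F n = F n" using F unfolding P_def UP_def by simp
qed

lemma poly_bound:
  assumes "f \<in> carrier P"
  shows "\<exists>k. \<forall>n>k. cf f n = \<zero>"
  using deg_aboveD[OF _ assms] by blast

lemma ev_closed:
  assumes "t \<in> carrier R" "f \<in> carrier P"
  shows "ev t f \<in> carrier R"
proof -
  interpret E: ring_hom_cring P R "ev t" using ev_hom[OF assms(1)] .
  show ?thesis using E.hom_closed assms(2) .
qed

lemma ev_sum:
  assumes "f \<in> carrier P"
  shows "ev t f = (\<Oplus>i\<in>{..deg R f}. cf f i \<otimes> t [^] i)"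
  using assms unfolding ev_def UnivPoly.eval_def P_def by simp

lemma finsum_mem:
  assumes "finite A" "\<And>i. i \<in> A \<Longrightarrow> f i \<in> V" "V \<subseteq> carrier R" "\<zero> \<in> V" "\<And>a b. a \<in> V \<Longrightarrow> b \<in> V \<Longrightarrow> a \<oplus> b \<in> V"
  shows "(\<Oplus>i\<in>A. f i) \<in> V"
  using assms(1,2)
proof (induction A)
  case empty then show ?case using assms by simp
next
  case (insert x F)
  have "f \<in> F \<rightarrow> carrier R" "f x \<in> carrier R" using insert.prems assms(3) by auto
  then show ?case using insert assms(5) by simp
qed

text \<open>Only closure under addition and under multiplication by \<open>t\<close> is needed, so
  the same argument serves subrings containing \<open>t\<close> and ideals.\<close>

lemma ev_mem:
  assumes "f \<in> cpoly V" "t \<in> carrier R" "V \<subseteq> carrier R" "\<zero> \<in> V" "\<And>a b. a \<in> V \<Longrightarrow> b \<in> V \<Longrightarrow> a \<oplus> b \<in> V"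
    "\<And>a. a \<in> V \<Longrightarrow> a \<otimes> t \<in> V"
  shows "ev t f \<in> V"
proof -
  have f: "f \<in> carrier P" using assms cpolyD by blast
  have *: "a \<otimes> t [^] (i::nat) \<in> V" if "a \<in> V" for a i
  proof (induction i)
    case 0 then show ?case using that assms(3) by auto
  next
    case (Suc i)
    have "a \<otimes> t [^] Suc i = (a \<otimes> t [^] i) \<otimes> t" using that assms(2,3) by (auto simp: R.m_assoc)
    then show ?case using assms(6)[OF Suc] by simp
  qed
  show ?thesis unfolding ev_sum[OF f]
    by (rule finsum_mem) (use assms * cpolyD in auto)
qed

lemma ev_subring:
  assumes "subring C R" "f \<in> cpoly C" "t \<in> C"
  shows "ev t f \<in> C"
  using subringE[OF assms(1)] assms by (intro ev_mem) auto

lemma prime_inD: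
  assumes "prime_in Y C"
  shows "Y \<subseteq> C" "\<zero> \<in> Y" "\<one> \<notin> Y" "a \<in> Y \<Longrightarrow> b \<in> Y \<Longrightarrow> a \<oplus> b \<in> Y"
    "a \<in> C \<Longrightarrow> b \<in> Y \<Longrightarrow> a \<otimes> b \<in> Y" "a \<in> C \<Longrightarrow> b \<in> C \<Longrightarrow> a \<otimes> b \<in> Y \<Longrightarrow> a \<in> Y \<or> b \<in> Y"
  using assms unfolding prime_in_def by auto

lemma prime_in_neg:
  assumes "prime_in Y C" "subring C R" "a \<in> Y"
  shows "\<ominus> a \<in> Y"
proof -
  have "a \<in> carrier R" using assms prime_inD(1) subringE(1) by blast
  then have "\<ominus> a = (\<ominus> \<one>) \<otimes> a" by algebra
  then show ?thesis using prime_inD(5)[OF assms(1), of "\<ominus> \<one>" a] subringE(3,5)[OF assms(2)] assms(3) by simp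
qed

lemma prime_in_minus:
  assumes "prime_in Y C" "subring C R" "a \<in> Y" "b \<in> Y"
  shows "a \<ominus> b \<in> Y"
  using prime_inD(4)[OF assms(1,3) prime_in_neg[OF assms(1,2,4)]] by (simp add: a_minus_def)

lemma prime_in_cancel:
  assumes "prime_in Y C" "subring C R" "a \<ominus> b \<in> Y" "a \<in> C" "b \<in> C"
  shows "a \<in> Y \<longleftrightarrow> b \<in> Y"
proof -
  have c: "a \<in> carrier R" "b \<in> carrier R" using assms subringE(1) by blast+
  have "b = a \<ominus> (a \<ominus> b)" "a = (a \<ominus> b) \<oplus> b" using c by algebra+
  then show ?thesis using prime_in_minus[OF assms(1,2) _ assms(3)] prime_inD(4)[OF assms(1) assms(3)] by metis
qed

lemma prime_in_pow:
  assumes "prime_in Y C" "subring C R" "c \<in> C" "c \<notin> Y"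
  shows "c [^] (n::nat) \<in> C" "c [^] (n::nat) \<notin> Y"
proof -
  note s = subringE[OF assms(2)]
  have c: "c \<in> carrier R" using assms s by blast
  have "c [^] n \<in> C \<and> c [^] n \<notin> Y"
  proof (induction n)
    case 0 then show ?case using s prime_inD(3)[OF assms(1)] by simp
  next
    case (Suc n) then show ?case using assms(3,4) s prime_inD(6)[OF assms(1), of "c [^] n" c] by auto
  qed
  then show "c [^] (n::nat) \<in> C" "c [^] (n::nat) \<notin> Y" by auto
qed

lemma ev_prime:
  assumes "prime_in Y C" "subring C R" "f \<in> cpoly Y" "t \<in> C"
  shows "ev t f \<in> Y"
proof (rule ev_mem[OF assms(3)])
  show "t \<in> carrier R" "Y \<subseteq> carrier R" using assms subringE(1) prime_inD(1) by blast+
  show "\<zero> \<in> Y" using prime_inD(2) assms by blast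
  show "a \<oplus> b \<in> Y" if "a \<in> Y" "b \<in> Y" for a b using that prime_inD(4) assms by blast
  show "a \<otimes> t \<in> Y" if "a \<in> Y" for a
  proof -
    have "a \<in> carrier R" "t \<in> carrier R" using that assms subringE(1) prime_inD(1) by blast+
    then have "a \<otimes> t = t \<otimes> a" by (rule R.m_comm)
    then show ?thesis using prime_inD(5)[OF assms(1,4) that] by simp
  qed
qed

lemma cpoly_add:
  assumes "f \<in> cpoly V" "g \<in> cpoly V" "\<And>a b. a \<in> V \<Longrightarrow> b \<in> V \<Longrightarrow> a \<oplus> b \<in> V"
  shows "f +\<^sub>P g \<in> cpoly V"
  using assms by (auto simp: cpoly_def)

lemma cpoly_subring:
  assumes B: "subring B R"
  shows "subring (cpoly B) P"
proof (rule P.subringI)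
  note s = subringE[OF B]
  show "cpoly B \<subseteq> carrier P" by (auto simp: cpoly_def)
  show "\<one>\<^bsub>P\<^esub> \<in> cpoly B" using s by (auto simp: cpoly_def)
  show "\<And>h. h \<in> cpoly B \<Longrightarrow> \<ominus>\<^bsub>P\<^esub> h \<in> cpoly B" using s by (auto simp: cpoly_def)
  show "f *\<^sub>P g \<in> cpoly B" if "f \<in> cpoly B" "g \<in> cpoly B" for f g
  proof -
    have "cf (f *\<^sub>P g) n \<in> B" for n
      unfolding coeff_mult[OF cpolyD(1)[OF that(1)] cpolyD(1)[OF that(2)]]
      by (rule finsum_mem) (use s that in \<open>auto simp: cpoly_def\<close>)
    then show ?thesis using that by (auto simp: cpoly_def)
  qed
  show "f +\<^sub>P g \<in> cpoly B" if "f \<in> cpoly B" "g \<in> cpoly B" for f g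
    using that s by (auto simp: cpoly_def)
qed

lemma cpoly_monom:
  assumes "b \<in> B" "\<zero> \<in> B" "B \<subseteq> carrier R"
  shows "mon b n \<in> cpoly B"
proof -
  have "b \<in> carrier R" using assms by blast
  then show ?thesis using assms by (auto simp: cpoly_def)
qed

lemma ev_monom:
  assumes "b \<in> carrier R" "t \<in> carrier R"
  shows "ev t (mon b n) = b \<otimes> t [^] n"
proof -
  interpret I: UP_pre_univ_prop R R id P by unfold_locales (auto simp: P_def)
  show ?thesis using I.eval_monom[OF assms] unfolding ev_def by simp
qed

lemma adj_subring:
  assumes "subring B R" "t \<in> carrier R"
  shows "subring (adj B t) R"
proof -
  interpret E: ring_hom_cring P R "ev t" using ev_hom[OF assms(2)] .
  show ?thesis unfolding adj_def by (rule E.ring.img_is_subring[OF cpoly_subring[OF assms(1)]])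
qed

lemma subring_carrier: "subring B R \<Longrightarrow> b \<in> B \<Longrightarrow> b \<in> carrier R"
  using subringE(1) by blast

lemma adj_incl:
  assumes "subring B R" "t \<in> carrier R"
  shows "B \<subseteq> adj B t" "t \<in> adj B t"
proof -
  note s = subringE[OF assms(1)]
  show "B \<subseteq> adj B t"
  proof
    fix b assume b: "b \<in> B"
    then have "ev t (mon b 0) = b" using ev_monom[of b t 0] assms(2) s by auto
    moreover have "mon b 0 \<in> cpoly B" using cpoly_monom b s by blast
    ultimately show "b \<in> adj B t" unfolding adj_def by (metis imageI)
  qed
  have "ev t (mon \<one> 1) = t" using ev_monom[of \<one> t 1] assms(2) by simp
  moreover have "mon \<one> 1 \<in> cpoly B" using cpoly_monom[OF s(3) s(2) s(1)] .
  ultimately show "t \<in> adj B t" unfolding adj_def by (metis imageI)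
qed

lemma adj_least:
  assumes "subring C R" "B \<subseteq> C" "t \<in> C"
  shows "adj B t \<subseteq> C"
  unfolding adj_def using ev_subring[OF assms(1) _ assms(3)] cpoly_mono[OF assms(2)] by blast

lemma adj_mono: "B \<subseteq> C \<Longrightarrow> adj B t \<subseteq> adj C t"
  unfolding adj_def using cpoly_mono by blast

lemma cpoly_mult_ideal:
  assumes "prime_in Y C" "subring C R" "f \<in> cpoly C" "g \<in> cpoly Y"
  shows "f *\<^sub>P g \<in> cpoly Y"
proof -
  note s = subringE[OF assms(2)]
  have Y: "Y \<subseteq> carrier R" using prime_inD(1)[OF assms(1)] s by blast
  have "cf (f *\<^sub>P g) n \<in> Y" for n
    unfolding coeff_mult[OF cpolyD(1)[OF assms(3)] cpolyD(1)[OF assms(4)]]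
    by (rule finsum_mem) (use Y prime_inD[OF assms(1)] cpolyD(2)[OF assms(3)] cpolyD(2)[OF assms(4)] in auto)
  then show ?thesis using cpolyD(1)[OF assms(3)] cpolyD(1)[OF assms(4)] by (simp add: cpoly_def)
qed

text \<open>The indices \<open>a\<close> and \<open>b\<close> are the degrees after reduction modulo
  \<open>Y\<close>. In the coefficient of index \<open>a + b\<close> every summand but one has a
  factor in \<open>Y\<close>, and that one is a product of two elements outside
  \<open>Y\<close>.\<close>

lemma last_coefficient_mult:
  assumes Y: "prime_in Y C" and C: "subring C R" and f: "f \<in> cpoly C" and g: "g \<in> cpoly C"
    and fa: "cf f a \<notin> Y" "\<And>n. n > a \<Longrightarrow> cf f n \<in> Y" and gb: "cf g b \<notin> Y" "\<And>n. n > b \<Longrightarrow> cf g n \<in> Y"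
  shows "cf (f *\<^sub>P g) (a + b) \<notin> Y"
proof
  note s = subringE[OF C]
  note y = prime_inD[OF Y]
  have fc: "cf f n \<in> C" "cf f n \<in> carrier R" for n using cpolyD(2)[OF f] s(1) by auto
  have gc: "cf g n \<in> C" "cf g n \<in> carrier R" for n using cpolyD(2)[OF g] s(1) by auto
  let ?h = "\<lambda>i. cf f i \<otimes> cf g (a + b - i)"
  have h: "?h \<in> A \<rightarrow> carrier R" for A using fc gc by auto
  have *: "(\<Oplus>i\<in>{..a+b} - {a}. ?h i) \<in> Y"
  proof (rule finsum_mem)
    fix i assume i: "i \<in> {..a+b} - {a}"
    show "?h i \<in> Y"
    proof (cases "i < a")
      case True
      then have "cf g (a + b - i) \<in> Y" using gb(2) by auto
      then show ?thesis using y(5) fc by auto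
    next
      case False
      then have "cf f i \<in> Y" using i fa(2) by auto
      then have "cf g (a + b - i) \<otimes> cf f i \<in> Y" using y(5) gc by auto
      then show ?thesis using R.m_comm fc gc by metis
    qed
  qed (use y s in auto)
  have "{..a+b} = insert a ({..a+b} - {a})" by auto
  then have "cf (f *\<^sub>P g) (a + b) = (\<Oplus>i\<in>insert a ({..a+b} - {a}). ?h i)"
    unfolding coeff_mult[OF cpolyD(1)[OF f] cpolyD(1)[OF g]] by simp
  also have "\<dots> = ?h a \<oplus> (\<Oplus>i\<in>{..a+b} - {a}. ?h i)"
    by (rule R.finsum_insert) (use h fc gc in auto)
  finally have eq: "cf (f *\<^sub>P g) (a + b) = ?h a \<oplus> (\<Oplus>i\<in>{..a+b} - {a}. ?h i)" .
  assume "cf (f *\<^sub>P g) (a + b) \<in> Y"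
  moreover have "?h a = cf (f *\<^sub>P g) (a + b) \<ominus> (\<Oplus>i\<in>{..a+b} - {a}. ?h i)"
  proof -
    have "(\<Oplus>i\<in>{..a+b} - {a}. ?h i) \<in> carrier R" "?h a \<in> carrier R"
      using h R.finsum_closed fc gc by auto
    then show ?thesis unfolding eq by (simp add: a_minus_def R.a_assoc R.r_neg)
  qed
  ultimately have "?h a \<in> Y" using prime_in_minus[OF Y C] * by auto
  then show False using y(6)[OF fc(1) gc(1)] fa gb by auto
qed

lemma last_coefficient_exists:
  assumes "f \<in> carrier P" "\<zero> \<in> Y" "f \<notin> cpoly Y"
  shows "\<exists>a. cf f a \<notin> Y \<and> (\<forall>n>a. cf f n \<in> Y)"
proof -
  obtain k where k: "\<forall>n>k. cf f n = \<zero>" using poly_bound[OF assms(1)] by blast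
  let ?S = "{n. cf f n \<notin> Y}"
  have "?S \<subseteq> {..k}" using k assms(2) by (metis (mono_tags, lifting) atMost_iff mem_Collect_eq not_le subsetI)
  then have fin: "finite ?S" using finite_subset by blast
  have ne: "?S \<noteq> {}" using assms unfolding cpoly_def by auto
  have "Max ?S \<in> ?S" using Max_in[OF fin ne] .
  moreover have "cf f n \<in> Y" if "n > Max ?S" for n using that Max_ge[OF fin, of n] by force
  ultimately show ?thesis by blast
qed

lemma cpoly_prime:
  assumes Y: "prime_in Y C" and C: "subring C R" and f: "f \<in> cpoly C" and g: "g \<in> cpoly C"
    and fg: "f *\<^sub>P g \<in> cpoly Y"
  shows "f \<in> cpoly Y \<or> g \<in> cpoly Y"
proof (rule ccontr)
  assume "\<not> ?thesis"
  then obtain a b where "cf f a \<notin> Y \<and> (\<forall>n>a. cf f n \<in> Y)" "cf g b \<notin> Y \<and> (\<forall>n>b. cf g n \<in> Y)"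
    using last_coefficient_exists[OF _ prime_inD(2)[OF Y]] cpolyD(1)[OF f] cpolyD(1)[OF g] by blast
  then show False using last_coefficient_mult[OF Y C f g] cpolyD(2)[OF fg] by blast
qed

section \<open>Pseudo-division and relations of minimal degree\<close>

lemma coeff_mon_mult:
  assumes "c \<in> carrier R" "p \<in> carrier P"
  shows "cf (mon c 0 *\<^sub>P p) n = c \<otimes> cf p n"
  using coeff_monom_mult[OF assms, of 0 n] by simp

text \<open>The leading coefficient of the divisor is not invertible, so the dividend is multiplied
  by it at each step. The induction is on the excess \<open>N\<close> of the degree bound of
  \<open>f\<close> over \<open>e\<close>.\<close>

lemma pseudo_division:
  assumes B: "subring B R" and g: "g \<in> cpoly B" and e: "\<And>n. n > e \<Longrightarrow> cf g n = \<zero>" and f: "f \<in> cpoly B"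
  shows "\<exists>(k::nat) h r. h \<in> cpoly B \<and> r \<in> cpoly B \<and> (\<forall>n\<ge>e. cf r n = \<zero>) \<and>
     mon (cf g e [^] k) 0 *\<^sub>P f = g *\<^sub>P h +\<^sub>P r"
proof -
  note s = subringE[OF B]
  note sp = subringE[OF cpoly_subring[OF B]]
  let ?c = "cf g e"
  have c: "?c \<in> B" "?c \<in> carrier R" using cpolyD(2)[OF g] s(1) by auto
  have cp: "?c [^] k \<in> B" for k :: nat by (induction k) (use s c in auto)
  have "\<exists>(k::nat) h r. h \<in> cpoly B \<and> r \<in> cpoly B \<and> (\<forall>n\<ge>e. cf r n = \<zero>) \<and>
     mon (?c [^] k) 0 *\<^sub>P f = g *\<^sub>P h +\<^sub>P r"
    if "f \<in> cpoly B" "\<forall>n\<ge>N+e. cf f n = \<zero>" for N f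
    using that
  proof (induction N arbitrary: f)
    case 0
    have "mon (?c [^] (0::nat)) 0 *\<^sub>P f = g *\<^sub>P \<zero>\<^bsub>P\<^esub> +\<^sub>P f"
      using 0 cpolyD(1) g by simp
    then show ?case using 0 sp by (metis add_0)
  next
    case (Suc N)
    have fc: "f \<in> carrier P" "g \<in> carrier P" using Suc cpolyD(1) g by auto
    let ?a = "cf f (N+e)"
    have a: "?a \<in> B" "?a \<in> carrier R" using cpolyD(2)[OF Suc.prems(1)] s(1) by auto
    have m: "mon ?c 0 \<in> cpoly B" "mon ?a N \<in> cpoly B" using cpoly_monom c a s by auto
    \<comment> \<open>The coefficients of index \<open>N + e\<close> of the two terms are
      \<open>?c \<otimes> ?a\<close> and \<open>?a \<otimes> ?c\<close>, so they cancel.\<close>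
    let ?f = "mon ?c 0 *\<^sub>P f -\<^sub>P (mon ?a N *\<^sub>P g)"
    have f': "?f \<in> cpoly B" unfolding a_minus_def using sp m Suc.prems(1) g by auto
    have "cf ?f n = \<zero>" if "n \<ge> N + e" for n
    proof -
      obtain j where j: "n = j + N" "j \<ge> e"
      proof
        show "n = (n - N) + N" "n - N \<ge> e" using \<open>n \<ge> N + e\<close> by arith+
      qed
      have "cf ?f n = ?c \<otimes> cf f n \<ominus> ?a \<otimes> cf g j"
        unfolding coeff_minus[OF P.m_closed[OF m(1)[THEN cpolyD(1)] fc(1)] P.m_closed[OF m(2)[THEN cpolyD(1)] fc(2)]]
          coeff_mon_mult[OF c(2) fc(1)] unfolding j(1) coeff_monom_mult[OF a(2) fc(2), of N j] ..
      also have "\<dots> = \<zero>"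
      proof (cases "j = e")
        case True
        then show ?thesis using j a c by (simp add: add.commute) algebra
      next
        case False
        then have "cf g j = \<zero>" "cf f n = \<zero>" using e j Suc.prems(2) by auto
        then show ?thesis using a c by simp
      qed
      finally show ?thesis .
    qed
    then obtain k h r where kh: "h \<in> cpoly B" "r \<in> cpoly B" "\<forall>n\<ge>e. cf r n = \<zero>"
     "mon (?c [^] (k::nat)) 0 *\<^sub>P ?f = g *\<^sub>P h +\<^sub>P r"
      using Suc.IH[OF f'] by blast
    let ?h = "h +\<^sub>P (mon (?c [^] k) 0 *\<^sub>P mon ?a N)"
    have mk: "mon (?c [^] k) 0 \<in> cpoly B" using cpoly_monom cp s by auto
    have hB: "?h \<in> cpoly B" using sp m mk kh by auto
    have "mon (?c [^] Suc k) 0 = mon (?c [^] k) 0 *\<^sub>P mon ?c 0"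
      using monom_mult[of "?c [^] k" "?c" 0 0] c cp by simp
    moreover have "mon (?c [^] k) 0 *\<^sub>P mon ?c 0 *\<^sub>P f =
       mon (?c [^] k) 0 *\<^sub>P ?f +\<^sub>P mon (?c [^] k) 0 *\<^sub>P (mon ?a N *\<^sub>P g)"
      using m[THEN cpolyD(1)] mk[THEN cpolyD(1)] fc by algebra
    moreover have "\<dots> = g *\<^sub>P ?h +\<^sub>P r"
      unfolding kh(4) using m[THEN cpolyD(1)] mk[THEN cpolyD(1)] fc kh(1,2)[THEN cpolyD(1)] by algebra
    ultimately have "mon (?c [^] Suc k) 0 *\<^sub>P f = g *\<^sub>P ?h +\<^sub>P r" by simp
    then show ?case using hB kh by blast
  qed
  moreover obtain k where "\<forall>n>k. cf f n = \<zero>" using poly_bound[OF cpolyD(1)[OF f]] by blast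
  then have "\<forall>n\<ge>Suc k + e. cf f n = \<zero>" by auto
  ultimately show ?thesis using f by blast
qed

lemma ev_simps:
  assumes "t \<in> carrier R" "f \<in> carrier P" "g \<in> carrier P"
  shows "ev t (f +\<^sub>P g) = ev t f \<oplus> ev t g" "ev t (f *\<^sub>P g) = ev t f \<otimes> ev t g"
    "ev t (f -\<^sub>P g) = ev t f \<ominus> ev t g" "ev t (\<ominus>\<^bsub>P\<^esub> f) = \<ominus> ev t f"
proof -
  interpret E: ring_hom_cring P R "ev t" using ev_hom[OF assms(1)] .
  show "ev t (f +\<^sub>P g) = ev t f \<oplus> ev t g" "ev t (f *\<^sub>P g) = ev t f \<otimes> ev t g"
    "ev t (\<ominus>\<^bsub>P\<^esub> f) = \<ominus> ev t f" using assms by auto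
  show "ev t (f -\<^sub>P g) = ev t f \<ominus> ev t g" using assms by (simp add: a_minus_def)
qed

lemma ev_const: "t \<in> carrier R \<Longrightarrow> c \<in> carrier R \<Longrightarrow> ev t (mon c 0) = c"
  using ev_monom[of c t 0] by simp

lemma ev_pseudo_division:
  assumes "subring B R" "g \<in> cpoly B" "\<And>n. n > e \<Longrightarrow> cf g n = \<zero>" "f \<in> cpoly B" "t \<in> carrier R"
  shows "\<exists>(k::nat) h r. h \<in> cpoly B \<and> r \<in> cpoly B \<and> (\<forall>n\<ge>e. cf r n = \<zero>) \<and>
     cf g e [^] k \<otimes> ev t f = ev t g \<otimes> ev t h \<oplus> ev t r"
proof -
  obtain k h r where kh: "h \<in> cpoly B" "r \<in> cpoly B" "\<forall>n\<ge>e. cf r n = \<zero>"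
     "mon (cf g e [^] (k::nat)) 0 *\<^sub>P f = g *\<^sub>P h +\<^sub>P r"
    using pseudo_division[OF assms(1-4)] by blast
  have c: "cf g e [^] k \<in> carrier R" using cpolyD(1)[OF assms(2)] by simp
  have "ev t (mon (cf g e [^] k) 0 *\<^sub>P f) = ev t (g *\<^sub>P h +\<^sub>P r)" using kh(4) by simp
  then have "cf g e [^] k \<otimes> ev t f = ev t g \<otimes> ev t h \<oplus> ev t r"
    using ev_simps[OF assms(5)] kh(1,2) assms(2,4) cpolyD(1) c ev_const[OF assms(5)] by simp
  then show ?thesis using kh by blast
qed

lemma min_poly:
  assumes Y: "prime_in Y C" and C: "subring C R" and B: "subring B R" "B \<subseteq> C" "t \<in> C" and al: "alg Y B t"
  shows "\<exists>g e. g \<in> cpoly B \<and> (\<forall>n>e. cf g n = \<zero>) \<and> cf g e \<notin> Y \<and> ev t g \<in> Y \<and> 1 \<le> e \<and>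
     (\<forall>f\<in>cpoly B. (\<forall>n\<ge>e. cf f n = \<zero>) \<and> ev t f \<in> Y \<longrightarrow> f \<in> cpoly Y)"
proof -
  let ?Q = "\<lambda>e. \<exists>g\<in>cpoly B. (\<forall>n>e. cf g n = \<zero>) \<and> cf g e \<notin> Y \<and> ev t g \<in> Y"
  note s = subringE[OF B(1)]
  note sp = subringE[OF cpoly_subring[OF B(1)]]
  have tc: "t \<in> carrier R" using B C subringE(1) by blast
  \<comment> \<open>The bound \<open>e < k\<close> is what minimality is tested against: a
    nontrivial relation with degree bound \<open>k\<close> yields an index strictly below
    \<open>k\<close>.\<close>
  have trunc: "\<exists>e. ?Q e \<and> (\<forall>k. (\<forall>n\<ge>k. cf f n = \<zero>) \<longrightarrow> e < k)" if f: "f \<in> cpoly B" "f \<notin> cpoly Y" "ev t f \<in> Y" for f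
  proof -
    have fP: "f \<in> carrier P" using f cpolyD by blast
    obtain a where a: "cf f a \<notin> Y" "\<forall>n>a. cf f n \<in> Y"
      using last_coefficient_exists[OF fP prime_inD(2)[OF Y] f(2)] by blast
    define g where "g = (\<lambda>n. if n \<le> a then cf f n else \<zero>)"
    have gP: "g \<in> carrier P" "\<And>n. cf g n = g n"
      using poly_fun[of g a] fP unfolding g_def by auto
    have gB: "g \<in> cpoly B" unfolding cpoly_def using gP cpolyD(2)[OF f(1)] s(2) by (auto simp: g_def)
    have "f -\<^sub>P g \<in> cpoly Y"
    proof -
      have "cf (f -\<^sub>P g) n \<in> Y" for n
      proof (cases "n \<le> a")
        case True
        then show ?thesis using coeff_minus[OF fP gP(1)] gP(2) fP prime_inD(2)[OF Y] by (simp add: g_def a_minus_def R.r_neg)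
      next
        case False
        then show ?thesis using coeff_minus[OF fP gP(1)] gP(2) fP a by (simp add: g_def a_minus_def)
      qed
      then show ?thesis using fP gP by (simp add: cpoly_def)
    qed
    then have "ev t (f -\<^sub>P g) \<in> Y" using ev_prime[OF Y C _ B(3)] by blast
    then have "ev t f \<ominus> ev t g \<in> Y" using ev_simps(3)[OF tc fP gP(1)] by simp
    then have "ev t g \<in> Y" using prime_in_cancel[OF Y C] ev_subring[OF C] f(1,3) gB cpoly_mono[OF B(2)] B(3) by blast
    moreover have "\<forall>n>a. cf g n = \<zero>" "cf g a \<notin> Y" using gP a by (auto simp: g_def)
    ultimately have "?Q a" using gB by blast
    moreover have "a < k" if "\<forall>n\<ge>k. cf f n = \<zero>" for k
      using that a(1) prime_inD(2)[OF Y] by (metis not_le)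
    ultimately show ?thesis by blast
  qed
  define e where "e = (LEAST e. ?Q e)"
  have ex: "\<exists>e. ?Q e" using al trunc unfolding alg_def by blast
  then have Qe: "?Q e" unfolding e_def using LeastI_ex[of ?Q] by blast
  then obtain g where g: "g \<in> cpoly B" "\<forall>n>e. cf g n = \<zero>" "cf g e \<notin> Y" "ev t g \<in> Y" by blast
  have least: "e \<le> e'" if "?Q e'" for e' unfolding e_def using that by (rule Least_le)
  have "1 \<le> e"
  proof (rule ccontr)
    assume "\<not> 1 \<le> e"
    then have e0: "e = 0" by simp
    have gP: "g \<in> carrier P" using g(1) cpolyD by blast
    have "g = mon (cf g 0) 0"
    proof (rule up_eqI)
      show "cf g n = cf (mon (cf g 0) 0) n" for n using g(2) e0 gP by (cases n) auto
    qed (use gP in auto)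
    then have "ev t g = cf g 0" using ev_const[OF tc, of "cf g 0"] gP by simp
    then show False using g e0 by simp
  qed
  moreover have "\<forall>f\<in>cpoly B. (\<forall>n\<ge>e. cf f n = \<zero>) \<and> ev t f \<in> Y \<longrightarrow> f \<in> cpoly Y"
  proof (intro ballI impI)
    fix f assume f: "f \<in> cpoly B" "(\<forall>n\<ge>e. cf f n = \<zero>) \<and> ev t f \<in> Y"
    show "f \<in> cpoly Y"
    proof (rule ccontr)
      assume "f \<notin> cpoly Y"
      from trunc[OF f(1) this] f(2) least show False by fastforce
    qed
  qed
  ultimately show ?thesis using g by blast
qed

lemma poly_shift:
  assumes f: "f \<in> carrier P"
  shows "\<exists>h\<in>carrier P. (\<forall>n. cf h n = cf f (Suc n)) \<and> f = mon (cf f 0) 0 +\<^sub>P mon \<one> 1 *\<^sub>P h"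
proof -
  obtain k where k: "\<forall>n>k. cf f n = \<zero>" using poly_bound[OF f] by blast
  define h where "h = (\<lambda>n. cf f (Suc n))"
  have h: "h \<in> carrier P" "\<And>n. cf h n = cf f (Suc n)"
    using poly_fun[of h k] k f unfolding h_def by auto
  have "f = mon (cf f 0) 0 +\<^sub>P mon \<one> 1 *\<^sub>P h"
  proof (rule up_eqI)
    fix n
    show "cf f n = cf (mon (cf f 0) 0 +\<^sub>P mon \<one> 1 *\<^sub>P h) n"
    proof (cases n)
      case 0
      then show ?thesis using f h by (simp add: coeff_mult)
    next
      case (Suc m)
      then show ?thesis using coeff_monom_mult[OF R.one_closed h(1), of 1 m] f h by simp
    qed
  qed (use f h in auto)
  then show ?thesis using h by blast
qed

lemma ev_shift:
  assumes "f \<in> cpoly B" "t \<in> carrier R"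
  shows "\<exists>h\<in>cpoly B. (\<forall>n. cf h n = cf f (Suc n)) \<and> ev t f = cf f 0 \<oplus> t \<otimes> ev t h"
proof -
  have f: "f \<in> carrier P" using assms cpolyD by blast
  obtain h where h: "h \<in> carrier P" "\<forall>n. cf h n = cf f (Suc n)" "f = mon (cf f 0) 0 +\<^sub>P mon \<one> 1 *\<^sub>P h"
    using poly_shift[OF f] by blast
  have "ev t f = ev t (mon (cf f 0) 0) \<oplus> ev t (mon \<one> 1) \<otimes> ev t h"
    by (subst h(3)) (use ev_simps[OF assms(2)] f h(1) in simp)
  also have "\<dots> = cf f 0 \<oplus> t \<otimes> ev t h"
    using ev_const[OF assms(2)] ev_monom[of \<one> t 1] f assms(2) by simp
  finally show ?thesis using h assms(1) unfolding cpoly_def by auto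
qed

section \<open>Generically finite extensions\<close>

lemma ev_sum_bound:
  assumes r: "r \<in> carrier P" and D: "\<And>n. n \<ge> D \<Longrightarrow> cf r n = \<zero>" and t: "t \<in> carrier R"
  shows "ev t r = (\<Oplus>i\<in>{..<D}. cf r i \<otimes> t [^] i)"
  unfolding ev_sum[OF r]
proof (rule R.add.finprod_mono_neutral_cong)
  show "cf r i \<otimes> t [^] i = \<zero>" if "i \<in> {..<D} - {..deg R r}" for i
    using that deg_aboveD[OF _ r, of i] t by simp
  show "cf r i \<otimes> t [^] i = \<zero>" if "i \<in> {..deg R r} - {..<D}" for i
    using that D[of i] t by simp
qed (use r t in auto)

section \<open>Linear algebra modulo a prime\<close>

lemma finsum_swap:
  assumes "finite A" "finite B" "\<And>a b. a \<in> A \<Longrightarrow> b \<in> B \<Longrightarrow> f a b \<in> carrier R"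
  shows "(\<Oplus>a\<in>A. \<Oplus>b\<in>B. f a b) = (\<Oplus>b\<in>B. \<Oplus>a\<in>A. f a b)"
  using assms(1,3)
proof (induction A)
  case empty
  then show ?case by simp
next
  case (insert x F)
  have c: "f x \<in> B \<rightarrow> carrier R" "(\<lambda>b. \<Oplus>a\<in>F. f a b) \<in> B \<rightarrow> carrier R" "(\<lambda>a. \<Oplus>b\<in>B. f a b) \<in> F \<rightarrow> carrier R"
    "(\<Oplus>b\<in>B. f x b) \<in> carrier R"
    using insert.prems by (auto intro!: R.finsum_closed)
  have "(\<Oplus>a\<in>insert x F. \<Oplus>b\<in>B. f a b) = (\<Oplus>b\<in>B. f x b) \<oplus> (\<Oplus>b\<in>B. \<Oplus>a\<in>F. f a b)"
    using R.finsum_insert[OF insert.hyps c(3,4)] insert by simp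
  also have "\<dots> = (\<Oplus>b\<in>B. f x b \<oplus> (\<Oplus>a\<in>F. f a b))" using R.finsum_addf[OF c(1,2)] by simp
  also have "\<dots> = (\<Oplus>b\<in>B. \<Oplus>a\<in>insert x F. f a b)"
  proof (rule R.finsum_cong'[OF refl])
    show "f x b \<oplus> (\<Oplus>a\<in>F. f a b) = (\<Oplus>a\<in>insert x F. f a b)" if "b \<in> B" for b
      using R.finsum_insert[OF insert.hyps, of "\<lambda>a. f a b"] insert.prems that by auto
    show "(\<lambda>b. \<Oplus>a\<in>insert x F. f a b) \<in> B \<rightarrow> carrier R" using insert.prems by (auto intro!: R.finsum_closed)
  qed
  finally show ?case .
qed

text \<open>The identity behind one elimination step: \<open>a\<close> is the pivot,
  \<open>b\<close> the entry of the pivot row in the current column, and \<open>h k\<close>,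
  \<open>g k\<close> are the entries of row \<open>k\<close> in the pivot column and in the current
  column.\<close>

lemma finsum_elim:
  assumes "finite K" "a \<in> carrier R" "b \<in> carrier R"
    "\<And>k. k \<in> K \<Longrightarrow> l k \<in> carrier R" "\<And>k. k \<in> K \<Longrightarrow> g k \<in> carrier R" "\<And>k. k \<in> K \<Longrightarrow> h k \<in> carrier R"
  shows "(\<ominus> (\<Oplus>k\<in>K. l k \<otimes> h k)) \<otimes> b \<oplus> (\<Oplus>k\<in>K. (a \<otimes> l k) \<otimes> g k) = (\<Oplus>k\<in>K. l k \<otimes> (a \<otimes> g k \<ominus> h k \<otimes> b))"
  using assms(1,4-)
proof (induction K)
  case empty
  then show ?case using assms by simp
next
  case (insert x F)
  let ?A = "\<Oplus>k\<in>F. l k \<otimes> h k" let ?B = "\<Oplus>k\<in>F. (a \<otimes> l k) \<otimes> g k" let ?C = "\<Oplus>k\<in>F. l k \<otimes> (a \<otimes> g k \<ominus> h k \<otimes> b)"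
  have c: "(\<lambda>k. l k \<otimes> h k) \<in> F \<rightarrow> carrier R" "(\<lambda>k. (a \<otimes> l k) \<otimes> g k) \<in> F \<rightarrow> carrier R" "(\<lambda>k. l k \<otimes> (a \<otimes> g k \<ominus> h k \<otimes> b)) \<in> F \<rightarrow> carrier R"
    "l x \<in> carrier R" "g x \<in> carrier R" "h x \<in> carrier R"
    using insert.prems assms(2,3) by auto
  have c2: "?A \<in> carrier R" "?B \<in> carrier R" "?C \<in> carrier R" using c R.finsum_closed by auto
  have i: "(\<Oplus>k\<in>insert x F. l k \<otimes> h k) = l x \<otimes> h x \<oplus> ?A" "(\<Oplus>k\<in>insert x F. (a \<otimes> l k) \<otimes> g k) = (a \<otimes> l x) \<otimes> g x \<oplus> ?B"
    "(\<Oplus>k\<in>insert x F. l k \<otimes> (a \<otimes> g k \<ominus> h k \<otimes> b)) = l x \<otimes> (a \<otimes> g x \<ominus> h x \<otimes> b) \<oplus> ?C"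
    using R.finsum_insert[OF insert.hyps c(1)] R.finsum_insert[OF insert.hyps c(2)] R.finsum_insert[OF insert.hyps c(3)] c assms(2,3) by auto
  have IH: "(\<ominus> ?A) \<otimes> b \<oplus> ?B = ?C" using insert by auto
  have gen: "(\<ominus> (L \<otimes> H \<oplus> A)) \<otimes> b \<oplus> ((a \<otimes> L) \<otimes> G \<oplus> B) = L \<otimes> (a \<otimes> G \<ominus> H \<otimes> b) \<oplus> ((\<ominus> A) \<otimes> b \<oplus> B)"
    if "L \<in> carrier R" "H \<in> carrier R" "A \<in> carrier R" "G \<in> carrier R" "B \<in> carrier R" for L H A G B
    using that assms(2,3) by algebra
  show ?case unfolding i gen[OF c(4,6) c2(1) c(5) c2(2)] IH ..
qed

text \<open>Fraction-free Gaussian elimination.\<close>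

lemma linear_dependence:
  assumes Y: "prime_in Y E" and E: "subring E R" and B: "subring B R" "B \<subseteq> E"
    and I: "finite I" and K: "finite K" "card I < card K" and f: "\<And>k i. k \<in> K \<Longrightarrow> i \<in> I \<Longrightarrow> f k i \<in> B"
  shows "\<exists>l. (\<forall>k\<in>K. l k \<in> B) \<and> (\<exists>k\<in>K. l k \<notin> Y) \<and> (\<forall>i\<in>I. (\<Oplus>k\<in>K. l k \<otimes> f k i) \<in> Y)"
  using I K f
proof (induction I arbitrary: K f)
  case empty
  then have "K \<noteq> {}" by auto
  then show ?case using prime_inD(3)[OF Y] subringE(3)[OF B(1)] by (intro exI[of _ "\<lambda>_. \<one>"]) auto
next
  case (insert i I)
  note s = subringE[OF B(1)]
  note y = prime_inD[OF Y]
  have Yc: "Y \<subseteq> carrier R" using y(1) subringE(1)[OF E] by blast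
  show ?case
  proof (cases "\<forall>k\<in>K. f k i \<in> Y")
    \<comment> \<open>Column \<open>i\<close> vanishes modulo \<open>Y\<close> and imposes no
      condition.\<close>
    case True
    have "card I < card K" using insert by auto
    moreover have "\<And>k i. k \<in> K \<Longrightarrow> i \<in> I \<Longrightarrow> f k i \<in> B" using insert.prems by simp
    ultimately obtain l where l: "\<forall>k\<in>K. l k \<in> B" "\<exists>k\<in>K. l k \<notin> Y" "\<forall>i\<in>I. (\<Oplus>k\<in>K. l k \<otimes> f k i) \<in> Y"
      using insert.IH[OF insert.prems(1), of f] by blast
    have "(\<Oplus>k\<in>K. l k \<otimes> f k i) \<in> Y"
    proof (rule finsum_mem[OF insert.prems(1) _ Yc y(2) y(4)])
      show "l k \<otimes> f k i \<in> Y" if "k \<in> K" for k using y(5) l(1) B(2) True that by blast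
    qed auto
    then show ?thesis using l by (intro exI[of _ l]) auto
  next
    case False
    then obtain k0 where k0: "k0 \<in> K" "f k0 i \<notin> Y" by blast
    let ?K = "K - {k0}"
    have K': "finite ?K" "card I < card ?K" using insert k0 by auto
    have fB: "f k j \<in> B" if "k \<in> K" "j \<in> insert i I" for k j using insert.prems that by blast
    have fc: "f k j \<in> carrier R" if "k \<in> K" "j \<in> insert i I" for k j using fB that s(1) by blast
    \<comment> \<open>Cross-multiplication with the pivot \<open>f k0 i\<close> clears column
      \<open>i\<close> without division.\<close>
    let ?f = "\<lambda>k j. f k0 i \<otimes> f k j \<ominus> f k i \<otimes> f k0 j"
    have "?f k j \<in> B" if "k \<in> ?K" "j \<in> I" for k j
      using fB that k0 s by (auto simp: a_minus_def)
    then obtain l where l: "\<forall>k\<in>?K. l k \<in> B" "\<exists>k\<in>?K. l k \<notin> Y" "\<forall>j\<in>I. (\<Oplus>k\<in>?K. l k \<otimes> ?f k j) \<in> Y"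
      using insert.IH[OF K', of ?f] by blast
    have lc: "l k \<in> carrier R" if "k \<in> ?K" for k using l that s(1) by blast
    \<comment> \<open>Back substitution: the coefficient of the pivot row makes column
      \<open>i\<close> cancel; the other coefficients are scaled by the pivot, which lies outside
      \<open>Y\<close>, so a nontrivial one stays nontrivial.\<close>
    define m where "m = (\<lambda>k. if k = k0 then \<ominus> (\<Oplus>k\<in>?K. l k \<otimes> f k i) else f k0 i \<otimes> l k)"
    have sB: "(\<Oplus>k\<in>?K. l k \<otimes> f k i) \<in> B"
      by (rule finsum_mem) (use K' l fB s in auto)
    have mB: "m k \<in> B" if "k \<in> K" for k
      using that sB s l fB k0 unfolding m_def by auto
    have "\<exists>k\<in>K. m k \<notin> Y"
    proof -
      obtain k where k: "k \<in> ?K" "l k \<notin> Y" using l by blast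
      have "l k \<in> E" "f k0 i \<in> E" using k(1) l(1) fB[OF k0(1), of i] B(2) by blast+
      then have "f k0 i \<otimes> l k \<notin> Y" using y(6) k0(2) k(2) by blast
      then have "m k \<notin> Y" using k(1) unfolding m_def by simp
      then show ?thesis using k(1) by blast
    qed
    moreover have "(\<Oplus>k\<in>K. m k \<otimes> f k j) \<in> Y" if j: "j \<in> insert i I" for j
    proof -
      have ins: "K = insert k0 ?K" using k0 by auto
      have mc: "m k \<otimes> f k j \<in> carrier R" if "k \<in> K" for k using mB fc that j s(1) by blast
      have "(\<Oplus>k\<in>K. m k \<otimes> f k j) = m k0 \<otimes> f k0 j \<oplus> (\<Oplus>k\<in>?K. m k \<otimes> f k j)"
        by (subst ins, rule R.finsum_insert) (use K' mc k0 in auto)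
      also have "(\<Oplus>k\<in>?K. m k \<otimes> f k j) = (\<Oplus>k\<in>?K. (f k0 i \<otimes> l k) \<otimes> f k j)"
        by (rule R.finsum_cong'[OF refl]) (use fc lc k0 j in \<open>auto simp: m_def\<close>)
      also have "m k0 \<otimes> f k0 j \<oplus> (\<Oplus>k\<in>?K. (f k0 i \<otimes> l k) \<otimes> f k j) = (\<Oplus>k\<in>?K. l k \<otimes> (f k0 i \<otimes> f k j \<ominus> f k i \<otimes> f k0 j))"
        unfolding m_def using finsum_elim[OF K'(1), of "f k0 i" "f k0 j" l "\<lambda>k. f k j" "\<lambda>k. f k i"] fc lc k0 j by auto
      finally have eq: "(\<Oplus>k\<in>K. m k \<otimes> f k j) = (\<Oplus>k\<in>?K. l k \<otimes> ?f k j)" .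
      show ?thesis
      proof (cases "j = i")
        case True
        have z: "l k \<otimes> (f k0 i \<otimes> f k i \<ominus> f k i \<otimes> f k0 i) \<in> Y" if "k \<in> ?K" for k
        proof -
          have "f k0 i \<in> carrier R" "f k i \<in> carrier R" using fc k0 that by auto
          then have "f k0 i \<otimes> f k i \<ominus> f k i \<otimes> f k0 i = \<zero>" by (simp add: R.m_comm a_minus_def R.r_neg)
          then show ?thesis using lc[OF that] y(2) by simp
        qed
        show ?thesis unfolding eq unfolding True by (rule finsum_mem[OF K'(1) z Yc y(2) y(4)])
      next
        case False
        then show ?thesis unfolding eq using l j by auto
      qed
    qed
    ultimately show ?thesis using mB by (intro exI[of _ m]) auto
  qed
qed

text \<open>Modulo \<open>Y\<close> and after inverting \<open>c\<close>, the \<open>B\<close>-module \<open>C\<close> is generated by a family indexed by \<open>I\<close>.\<close>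

definition finmod :: "'a set \<Rightarrow> 'a set \<Rightarrow> 'a set \<Rightarrow> 'a \<Rightarrow> nat set \<Rightarrow> bool" where
  "finmod Y B C c I \<longleftrightarrow> finite I \<and> c \<in> B \<and> c \<notin> Y \<and>
    (\<exists>G. (\<forall>i\<in>I. G i \<in> C) \<and> (\<forall>u\<in>C. \<exists>(N::nat) f. (\<forall>i\<in>I. f i \<in> B) \<and> c [^] N \<otimes> u \<ominus> (\<Oplus>i\<in>I. f i \<otimes> G i) \<in> Y))"

text \<open>The \<open>B\<close>-submodule spanned by the family, enlarged by \<open>Y\<close>. The
  power of the inverted element is kept outside, so that \<open>comb\<close> is closed under
  addition and under multiplication by \<open>B\<close>.\<close>

definition comb :: "'a set \<Rightarrow> 'a set \<Rightarrow> nat set \<Rightarrow> (nat \<Rightarrow> 'a) \<Rightarrow> 'a set" where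
  "comb Y B I G = {u. \<exists>f. (\<forall>i\<in>I. f i \<in> B) \<and> u \<ominus> (\<Oplus>i\<in>I. f i \<otimes> G i) \<in> Y}"

lemma diff_distl:
  assumes "b \<in> carrier R" "u \<in> carrier R" "x \<in> carrier R"
  shows "b \<otimes> u \<ominus> b \<otimes> x = b \<otimes> (u \<ominus> x)"
  using assms by algebra

lemma diff_add_add:
  assumes "u \<in> carrier R" "v \<in> carrier R" "x \<in> carrier R" "y \<in> carrier R"
  shows "(u \<oplus> v) \<ominus> (x \<oplus> y) = (u \<ominus> x) \<oplus> (v \<ominus> y)"
  using assms by algebra

lemma comb_mult:
  assumes Y: "prime_in Y E" and E: "subring E R" and B: "subring B R" "B \<subseteq> E" and I: "finite I"
    and G: "\<And>i. i \<in> I \<Longrightarrow> G i \<in> E" and u: "u \<in> E" "u \<in> comb Y B I G" and b: "b \<in> B"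
  shows "b \<otimes> u \<in> comb Y B I G"
proof -
  note s = subringE[OF B(1)] note e = subringE[OF E]
  obtain f where f: "\<forall>i\<in>I. f i \<in> B" "u \<ominus> (\<Oplus>i\<in>I. f i \<otimes> G i) \<in> Y" using u unfolding comb_def by blast
  have c: "b \<in> carrier R" "u \<in> carrier R" "\<And>i. i \<in> I \<Longrightarrow> f i \<in> carrier R" "\<And>i. i \<in> I \<Longrightarrow> G i \<in> carrier R"
    using b u f G s(1) e(1) by blast+
  have "(\<Oplus>i\<in>I. (b \<otimes> f i) \<otimes> G i) = (\<Oplus>i\<in>I. b \<otimes> (f i \<otimes> G i))"
    by (rule R.finsum_cong'[OF refl]) (use c in \<open>auto simp: R.m_assoc\<close>)
  also have "\<dots> = b \<otimes> (\<Oplus>i\<in>I. f i \<otimes> G i)"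
    using R.finsum_rdistr[OF I c(1), of "\<lambda>i. f i \<otimes> G i"] c by auto
  finally have eq: "(\<Oplus>i\<in>I. (b \<otimes> f i) \<otimes> G i) = b \<otimes> (\<Oplus>i\<in>I. f i \<otimes> G i)" .
  have "(\<Oplus>i\<in>I. f i \<otimes> G i) \<in> carrier R" using c by (auto intro!: R.finsum_closed)
  then have "b \<otimes> u \<ominus> (\<Oplus>i\<in>I. (b \<otimes> f i) \<otimes> G i) = b \<otimes> (u \<ominus> (\<Oplus>i\<in>I. f i \<otimes> G i))"
    unfolding eq using diff_distl[OF c(1,2)] by simp
  then have "b \<otimes> u \<ominus> (\<Oplus>i\<in>I. (b \<otimes> f i) \<otimes> G i) \<in> Y"
    using prime_inD(5)[OF Y] f(2) b B(2) by auto
  then show ?thesis unfolding comb_def using b f(1) s by (intro CollectI exI[of _ "\<lambda>i. b \<otimes> f i"]) auto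
qed

lemma comb_add:
  assumes Y: "prime_in Y E" and E: "subring E R" and B: "subring B R" "B \<subseteq> E" and I: "finite I"
    and G: "\<And>i. i \<in> I \<Longrightarrow> G i \<in> E" and u: "u \<in> E" "u \<in> comb Y B I G" and v: "v \<in> E" "v \<in> comb Y B I G"
  shows "u \<oplus> v \<in> comb Y B I G"
proof -
  note s = subringE[OF B(1)] note e = subringE[OF E]
  obtain f where f: "\<forall>i\<in>I. f i \<in> B" "u \<ominus> (\<Oplus>i\<in>I. f i \<otimes> G i) \<in> Y" using u unfolding comb_def by blast
  obtain g where g: "\<forall>i\<in>I. g i \<in> B" "v \<ominus> (\<Oplus>i\<in>I. g i \<otimes> G i) \<in> Y" using v unfolding comb_def by blast
  have c: "v \<in> carrier R" "u \<in> carrier R" "\<And>i. i \<in> I \<Longrightarrow> f i \<in> carrier R" "\<And>i. i \<in> I \<Longrightarrow> G i \<in> carrier R" "\<And>i. i \<in> I \<Longrightarrow> g i \<in> carrier R"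
    using u v f g G s(1) e(1) by blast+
  have "(\<Oplus>i\<in>I. (f i \<oplus> g i) \<otimes> G i) = (\<Oplus>i\<in>I. f i \<otimes> G i \<oplus> g i \<otimes> G i)"
    by (rule R.finsum_cong'[OF refl]) (use c in \<open>auto simp: R.l_distr\<close>)
  also have "\<dots> = (\<Oplus>i\<in>I. f i \<otimes> G i) \<oplus> (\<Oplus>i\<in>I. g i \<otimes> G i)"
    by (rule R.finsum_addf) (use c in auto)
  finally have eq: "(\<Oplus>i\<in>I. (f i \<oplus> g i) \<otimes> G i) = (\<Oplus>i\<in>I. f i \<otimes> G i) \<oplus> (\<Oplus>i\<in>I. g i \<otimes> G i)" .
  have "(\<Oplus>i\<in>I. f i \<otimes> G i) \<in> carrier R" "(\<Oplus>i\<in>I. g i \<otimes> G i) \<in> carrier R" using c by (auto intro!: R.finsum_closed)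
  then have "u \<oplus> v \<ominus> (\<Oplus>i\<in>I. (f i \<oplus> g i) \<otimes> G i) = (u \<ominus> (\<Oplus>i\<in>I. f i \<otimes> G i)) \<oplus> (v \<ominus> (\<Oplus>i\<in>I. g i \<otimes> G i))"
    unfolding eq using diff_add_add[OF c(2,1)] by simp
  then have "u \<oplus> v \<ominus> (\<Oplus>i\<in>I. (f i \<oplus> g i) \<otimes> G i) \<in> Y"
    using prime_inD(4)[OF Y f(2) g(2)] by simp
  then show ?thesis unfolding comb_def using g f(1) s by (intro CollectI exI[of _ "\<lambda>i. f i \<oplus> g i"]) auto
qed

lemma comb_zero:
  assumes Y: "prime_in Y E" and E: "subring E R" and B: "subring B R" and I: "finite I"
    and G: "\<And>i. i \<in> I \<Longrightarrow> G i \<in> carrier R" and u: "u \<in> Y"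
  shows "u \<in> comb Y B I G"
proof -
  have "(\<Oplus>i\<in>I. \<zero> \<otimes> G i) = \<zero>" using G by (intro R.add.finprod_one_eqI) auto
  moreover have "u \<in> carrier R" using prime_inD(1)[OF Y] u subringE(1)[OF E] by blast
  ultimately have "u \<ominus> (\<Oplus>i\<in>I. \<zero> \<otimes> G i) \<in> Y" using u by (simp add: a_minus_def)
  then show ?thesis unfolding comb_def using subringE(2)[OF B] by (intro CollectI exI[of _ "\<lambda>_. \<zero>"]) auto
qed

lemma comb_gen:
  assumes Y: "prime_in Y E" and E: "subring E R" and B: "subring B R" and I: "finite I"
    and G: "\<And>i. i \<in> I \<Longrightarrow> G i \<in> carrier R" and j: "j \<in> I"
  shows "G j \<in> comb Y B I G"
proof -
  let ?f = "\<lambda>i. if i = j then \<one> else \<zero>"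
  have "(\<Oplus>i\<in>I. ?f i \<otimes> G i) = (\<Oplus>i\<in>I. if j = i then G i else \<zero>)"
    by (rule R.finsum_cong'[OF refl]) (use G in auto)
  also have "\<dots> = G j" by (rule R.finsum_singleton) (use j I G in auto)
  finally have "G j \<ominus> (\<Oplus>i\<in>I. ?f i \<otimes> G i) = \<zero>" using G[OF j] by (simp add: a_minus_def R.r_neg)
  then show ?thesis unfolding comb_def using prime_inD(2)[OF Y] subringE(2,3)[OF B] by (intro CollectI exI[of _ ?f]) auto
qed

lemma comb_sum:
  assumes Y: "prime_in Y E" and E: "subring E R" and B: "subring B R" "B \<subseteq> E" and I: "finite I"
    and G: "\<And>i. i \<in> I \<Longrightarrow> G i \<in> E" and J: "finite J"
    and u: "\<And>j. j \<in> J \<Longrightarrow> u j \<in> E" "\<And>j. j \<in> J \<Longrightarrow> u j \<in> comb Y B I G"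
  shows "(\<Oplus>j\<in>J. u j) \<in> comb Y B I G"
proof -
  let ?V = "comb Y B I G \<inter> E"
  have "(\<Oplus>j\<in>J. u j) \<in> ?V"
  proof (rule finsum_mem[OF J])
    show "?V \<subseteq> carrier R" using subringE(1)[OF E] by blast
    have "\<And>i. i \<in> I \<Longrightarrow> G i \<in> carrier R" using G subringE(1)[OF E] by blast
    then have "\<zero> \<in> comb Y B I G" by (rule comb_zero[OF Y E B(1) I _ prime_inD(2)[OF Y]])
    then show "\<zero> \<in> ?V" using subringE(2)[OF E] by simp
    show "a \<oplus> b \<in> ?V" if "a \<in> ?V" "b \<in> ?V" for a b
    proof
      show "a \<oplus> b \<in> comb Y B I G" by (rule comb_add[OF Y E B I G]) (use that in auto)
      show "a \<oplus> b \<in> E" using that subringE(7)[OF E] by simp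
    qed
  qed (use u in auto)
  then show ?thesis by simp
qed

lemma comb_cong:
  assumes Y: "prime_in Y E" and E: "subring E R" and B: "subring B R" "B \<subseteq> E" and I: "finite I"
    and G: "\<And>i. i \<in> I \<Longrightarrow> G i \<in> E" and u: "u \<in> E" "v \<in> E" "v \<in> comb Y B I G" "u \<ominus> v \<in> Y"
  shows "u \<in> comb Y B I G"
proof -
  have "\<And>i. i \<in> I \<Longrightarrow> G i \<in> carrier R" using G subringE(1)[OF E] by blast
  then have "u \<ominus> v \<in> comb Y B I G" by (rule comb_zero[OF Y E B(1) I _ u(4)])
  moreover have "u \<ominus> v \<in> E" using prime_inD(1)[OF Y] u(4) by blast
  ultimately have "(u \<ominus> v) \<oplus> v \<in> comb Y B I G" using u(2,3) by (intro comb_add[OF Y E B I G]) auto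
  moreover have "u \<in> carrier R" "v \<in> carrier R" using u subringE(1)[OF E] by blast+
  then have "(u \<ominus> v) \<oplus> v = u" by algebra
  ultimately show ?thesis by simp
qed

lemma finmodI:
  assumes "finite I" "c \<in> B" "c \<notin> Y" "\<And>i. i \<in> I \<Longrightarrow> G i \<in> C" "\<And>u. u \<in> C \<Longrightarrow> \<exists>N::nat. c [^] N \<otimes> u \<in> comb Y B I G"
  shows "finmod Y B C c I"
  using assms unfolding finmod_def comb_def by blast

lemma finmodE:
  assumes "finmod Y B C c I"
  obtains G where "finite I" "c \<in> B" "c \<notin> Y" "\<And>i. i \<in> I \<Longrightarrow> G i \<in> C" "\<And>u. u \<in> C \<Longrightarrow> \<exists>N::nat. c [^] N \<otimes> u \<in> comb Y B I G"
  using assms unfolding finmod_def comb_def by blast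

lemma subring_pow: "subring B R \<Longrightarrow> c \<in> B \<Longrightarrow> c [^] (n::nat) \<in> B"
  by (induction n) (auto dest: subringE(3,6))

text \<open>The sum of the individual exponents serves all elements at once, because
  \<open>comb\<close> absorbs further powers of \<open>c\<close>.\<close>

lemma finmod_uniform:
  assumes Y: "prime_in Y E" and E: "subring E R" and B: "subring B R" "B \<subseteq> E" and I: "finite I"
    and G: "\<And>i. i \<in> I \<Longrightarrow> G i \<in> E" and c: "c \<in> B"
    and K: "finite K" and u: "\<And>k. k \<in> K \<Longrightarrow> u k \<in> E" "\<And>k. k \<in> K \<Longrightarrow> \<exists>N::nat. c [^] N \<otimes> u k \<in> comb Y B I G"
  shows "\<exists>N::nat. \<forall>k\<in>K. c [^] N \<otimes> u k \<in> comb Y B I G"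
proof -
  from u(2) obtain N where N: "\<And>k. k \<in> K \<Longrightarrow> c [^] (N k::nat) \<otimes> u k \<in> comb Y B I G" by metis
  have "c [^] (\<Sum>k\<in>K. N k) \<otimes> u k \<in> comb Y B I G" if k: "k \<in> K" for k
  proof -
    let ?M = "(\<Sum>k\<in>K - {k}. N k)"
    have cc: "c \<in> carrier R" "u k \<in> carrier R" using c u(1)[OF k] B E subringE(1) by blast+
    have "(\<Sum>k\<in>K. N k) = ?M + N k" using K k by (simp add: sum.remove)
    then have "c [^] (\<Sum>k\<in>K. N k) \<otimes> u k = c [^] ?M \<otimes> (c [^] N k \<otimes> u k)"
      using cc by (simp add: R.nat_pow_mult[symmetric] R.m_assoc)
    moreover have "c [^] N k \<otimes> u k \<in> E" using u(1)[OF k] subring_pow[OF B(1) c] B(2) subringE(6)[OF E] by blast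
    ultimately show ?thesis using comb_mult[OF Y E B I G _ N[OF k] subring_pow[OF B(1) c]] by simp
  qed
  then show ?thesis by blast
qed

text \<open>Three primes are kept apart: generation holds modulo \<open>Z\<close>, elimination is
  done modulo \<open>X0\<close>, and the relation is read modulo any \<open>Y\<close>. Its
  coordinates lie in \<open>X0 \<inter> B\<close>, hence in \<open>Y\<close>, and the power of
  \<open>c\<close> is cancelled since \<open>c \<notin> Y\<close>. One relation valid at many primes
  is what \<open>card_bound\<close> needs.\<close>

lemma finmod_depend_all:
  assumes Z: "prime_in Z E" and Xp: "prime_in X0 E" and E: "subring E R" and B: "subring B R" and C: "B \<subseteq> C" "C \<subseteq> E"
    and fm: "finmod Z B C c I" and K: "finite K" "card I < card K" and u: "\<And>k. k \<in> K \<Longrightarrow> u k \<in> C"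
  shows "\<exists>l. (\<forall>k\<in>K. l k \<in> B) \<and> (\<exists>k\<in>K. l k \<notin> X0) \<and>
    (\<forall>Y. prime_in Y E \<and> Z \<subseteq> Y \<and> X0 \<inter> B \<subseteq> Y \<and> c \<notin> Y \<longrightarrow> (\<Oplus>k\<in>K. l k \<otimes> u k) \<in> Y)"
proof -
  note s = subringE[OF B] note e = subringE[OF E]
  have BE: "B \<subseteq> E" using C by blast
  obtain G where G: "finite I" "c \<in> B" "c \<notin> Z" "\<And>i. i \<in> I \<Longrightarrow> G i \<in> C" "\<And>u. u \<in> C \<Longrightarrow> \<exists>N::nat. c [^] N \<otimes> u \<in> comb Z B I G"
    using finmodE[OF fm] by metis
  have GE: "G i \<in> E" "G i \<in> carrier R" if "i \<in> I" for i using G(4)[OF that] C e(1) by blast+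
  have uE: "u k \<in> E" "u k \<in> carrier R" if "k \<in> K" for k using u[OF that] C e(1) by blast+
  have "\<exists>N::nat. \<forall>k\<in>K. c [^] N \<otimes> u k \<in> comb Z B I G"
    by (rule finmod_uniform[OF Z E B BE G(1) GE(1) G(2) K(1) uE(1) G(5)[OF u]])
  then obtain N :: nat where N: "\<forall>k\<in>K. c [^] N \<otimes> u k \<in> comb Z B I G" by blast
  then obtain f where f: "\<And>k i. k \<in> K \<Longrightarrow> i \<in> I \<Longrightarrow> f k i \<in> B" "\<And>k. k \<in> K \<Longrightarrow> c [^] N \<otimes> u k \<ominus> (\<Oplus>i\<in>I. f k i \<otimes> G i) \<in> Z"
    unfolding comb_def by (simp add: bchoice_iff) metis
  have "\<exists>l. (\<forall>k\<in>K. l k \<in> B) \<and> (\<exists>k\<in>K. l k \<notin> X0) \<and> (\<forall>i\<in>I. (\<Oplus>k\<in>K. l k \<otimes> f k i) \<in> X0)"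
    by (rule linear_dependence[OF Xp E B BE G(1) K f(1)])
  then obtain l where l: "\<forall>k\<in>K. l k \<in> B" "\<exists>k\<in>K. l k \<notin> X0" "\<forall>i\<in>I. (\<Oplus>k\<in>K. l k \<otimes> f k i) \<in> X0"
    by blast
  have lc: "l k \<in> carrier R" if "k \<in> K" for k using l(1) that s(1) by blast
  have fc: "f k i \<in> carrier R" if "k \<in> K" "i \<in> I" for k i using f(1)[OF that] s(1) by blast
  define T where "T = (\<lambda>k. \<Oplus>i\<in>I. f k i \<otimes> G i)"
  have Tc: "T k \<in> carrier R" if "k \<in> K" for k unfolding T_def using fc[OF that] GE by (auto intro!: R.finsum_closed)
  have cN: "c [^] N \<in> B" "c [^] N \<in> carrier R" using subring_pow[OF B G(2)] s(1) by blast+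
  have "(\<Oplus>k\<in>K. l k \<otimes> u k) \<in> Y" if Y: "prime_in Y E" and ZY: "Z \<subseteq> Y" and XY: "X0 \<inter> B \<subseteq> Y" and cY: "c \<notin> Y" for Y
  proof -
    note y = prime_inD[OF Y]
    have Yc: "Y \<subseteq> carrier R" using y(1) e(1) by blast
    have "(\<Oplus>k\<in>K. l k \<otimes> T k) = (\<Oplus>k\<in>K. \<Oplus>i\<in>I. l k \<otimes> (f k i \<otimes> G i))"
    proof (rule R.finsum_cong'[OF refl])
      show "l k \<otimes> T k = (\<Oplus>i\<in>I. l k \<otimes> (f k i \<otimes> G i))" if "k \<in> K" for k
        unfolding T_def using R.finsum_rdistr[OF G(1) lc[OF that], of "\<lambda>i. f k i \<otimes> G i"] fc[OF that] GE by auto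
    qed (use lc fc GE in \<open>auto intro!: R.finsum_closed\<close>)
    also have "\<dots> = (\<Oplus>i\<in>I. \<Oplus>k\<in>K. l k \<otimes> (f k i \<otimes> G i))"
      by (rule finsum_swap[OF K(1) G(1)]) (use lc fc GE in auto)
    also have "\<dots> = (\<Oplus>i\<in>I. (\<Oplus>k\<in>K. l k \<otimes> f k i) \<otimes> G i)"
    proof (rule R.finsum_cong'[OF refl])
      fix i assume i: "i \<in> I"
      have "(\<Oplus>k\<in>K. l k \<otimes> (f k i \<otimes> G i)) = (\<Oplus>k\<in>K. (l k \<otimes> f k i) \<otimes> G i)"
        by (rule R.finsum_cong'[OF refl]) (use lc fc GE i in \<open>auto simp: R.m_assoc\<close>)
      also have "\<dots> = (\<Oplus>k\<in>K. l k \<otimes> f k i) \<otimes> G i"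
        using R.finsum_ldistr[OF K(1) GE(2)[OF i], of "\<lambda>k. l k \<otimes> f k i"] lc fc i by auto
      finally show "(\<Oplus>k\<in>K. l k \<otimes> (f k i \<otimes> G i)) = (\<Oplus>k\<in>K. l k \<otimes> f k i) \<otimes> G i" .
    qed (use lc fc GE in \<open>auto intro!: R.finsum_closed R.m_closed\<close>)
    also have "\<dots> \<in> Y"
    proof (rule finsum_mem[OF G(1) _ Yc y(2) y(4)])
      fix i assume i: "i \<in> I"
      have "(\<Oplus>k\<in>K. l k \<otimes> f k i) \<in> B"
        by (rule finsum_mem[OF K(1) _ s(1,2,7)]) (use l(1) f(1) i s(6) in auto)
      then have a: "(\<Oplus>k\<in>K. l k \<otimes> f k i) \<in> Y" using l(3) i XY by blast
      then have "G i \<otimes> (\<Oplus>k\<in>K. l k \<otimes> f k i) \<in> Y" using y(5) GE i by blast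
      moreover have "(\<Oplus>k\<in>K. l k \<otimes> f k i) \<in> carrier R" using a Yc by blast
      ultimately show "(\<Oplus>k\<in>K. l k \<otimes> f k i) \<otimes> G i \<in> Y" using R.m_comm GE(2)[OF i] by metis
    qed auto
    finally have T: "(\<Oplus>k\<in>K. l k \<otimes> T k) \<in> Y" .
    let ?d = "\<lambda>k. l k \<otimes> (c [^] N \<otimes> u k \<ominus> T k)"
    have dY: "(\<Oplus>k\<in>K. ?d k) \<in> Y"
    proof (rule finsum_mem[OF K(1) _ Yc y(2) y(4)])
      show "?d k \<in> Y" if "k \<in> K" for k using y(5) f(2)[OF that] l(1) BE that ZY unfolding T_def by blast
    qed auto
    have "c [^] N \<otimes> (\<Oplus>k\<in>K. l k \<otimes> u k) = (\<Oplus>k\<in>K. c [^] N \<otimes> (l k \<otimes> u k))"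
      using R.finsum_rdistr[OF K(1) cN(2), of "\<lambda>k. l k \<otimes> u k"] lc uE by auto
    also have "\<dots> = (\<Oplus>k\<in>K. ?d k \<oplus> l k \<otimes> T k)"
    proof (rule R.finsum_cong'[OF refl])
      have "C \<otimes> (L \<otimes> U) = L \<otimes> (C \<otimes> U \<ominus> T) \<oplus> L \<otimes> T" if "C \<in> carrier R" "L \<in> carrier R" "U \<in> carrier R" "T \<in> carrier R" for C L U T
        using that by algebra
      then show "c [^] N \<otimes> (l k \<otimes> u k) = ?d k \<oplus> l k \<otimes> T k" if "k \<in> K" for k
        using cN lc uE Tc that by blast
    qed (use lc uE Tc cN in auto)
    also have "\<dots> = (\<Oplus>k\<in>K. ?d k) \<oplus> (\<Oplus>k\<in>K. l k \<otimes> T k)"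
      by (rule R.finsum_addf) (use lc uE Tc cN in auto)
    also have "\<dots> \<in> Y" using y(4) dY T by blast
    finally have fin: "c [^] N \<otimes> (\<Oplus>k\<in>K. l k \<otimes> u k) \<in> Y" .
    have "(\<Oplus>k\<in>K. l k \<otimes> u k) \<in> E"
      by (rule finsum_mem[OF K(1) _ e(1) e(2) e(7)]) (use l(1) BE uE e in auto)
    moreover have "c [^] N \<in> E" "c [^] N \<notin> Y" using prime_in_pow[OF Y E _ cY] G(2) BE by blast+
    ultimately show ?thesis using y(6) fin by blast
  qed
  then show ?thesis using l by blast
qed

lemma finmod_depend:
  assumes Y: "prime_in Y E" and E: "subring E R" and B: "subring B R" and C: "B \<subseteq> C" "C \<subseteq> E"
    and fm: "finmod Y B C c I" and K: "finite K" "card I < card K" and u: "\<And>k. k \<in> K \<Longrightarrow> u k \<in> C"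
  shows "\<exists>l. (\<forall>k\<in>K. l k \<in> B) \<and> (\<exists>k\<in>K. l k \<notin> Y) \<and> (\<Oplus>k\<in>K. l k \<otimes> u k) \<in> Y"
proof -
  have "\<exists>l. (\<forall>k\<in>K. l k \<in> B) \<and> (\<exists>k\<in>K. l k \<notin> Y) \<and>
    (\<forall>Y'. prime_in Y' E \<and> Y \<subseteq> Y' \<and> Y \<inter> B \<subseteq> Y' \<and> c \<notin> Y' \<longrightarrow> (\<Oplus>k\<in>K. l k \<otimes> u k) \<in> Y')"
    by (rule finmod_depend_all[OF Y Y E B C fm K u])
  moreover have "c \<notin> Y" using fm unfolding finmod_def by blast
  ultimately show ?thesis using Y by blast
qed

text \<open>The powers of \<open>t\<close> with exponents from 0 to \<open>card I\<close> outnumber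
  the generators, and a dependence among them is a polynomial relation.\<close>

lemma finmod_alg:
  assumes Y: "prime_in Y E" and E: "subring E R" and B: "subring B R" and C: "B \<subseteq> C" "C \<subseteq> E" "subring C R"
    and fm: "finmod Y B C c I" and t: "t \<in> C"
  shows "alg Y B t"
proof -
  let ?n = "Suc (card I)"
  note s = subringE[OF B]
  have tc: "t \<in> carrier R" using t C(3) subring_carrier by blast
  obtain l where l: "\<forall>k\<in>{..<?n}. l k \<in> B" "\<exists>k\<in>{..<?n}. l k \<notin> Y" "(\<Oplus>k\<in>{..<?n}. l k \<otimes> t [^] k) \<in> Y"
    using finmod_depend[OF Y E B C(1,2) fm, of "{..<?n}" "\<lambda>k. t [^] k"] subring_pow[OF C(3) t] by auto
  define f where "f = (\<lambda>k. if k < ?n then l k else \<zero>)"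
  have fB: "f n \<in> B" for n using l(1) s(2) unfolding f_def by simp
  have fc: "f n \<in> carrier R" for n using fB s(1) by blast
  have f: "f \<in> carrier P" "\<And>n. cf f n = f n"
    by (rule poly_fun[of f ?n, OF fc], simp add: f_def)+
  have "f \<in> cpoly B" using f fB unfolding cpoly_def by simp
  moreover have "f \<notin> cpoly Y"
  proof
    assume fY: "f \<in> cpoly Y"
    obtain k where "k < ?n" "l k \<notin> Y" using l(2) by blast
    then show False using cpolyD(2)[OF fY, of k] f(2)[of k] unfolding f_def by simp
  qed
  moreover have "ev t f = (\<Oplus>k\<in>{..<?n}. cf f k \<otimes> t [^] k)"
    by (rule ev_sum_bound[OF f(1) _ tc]) (simp add: f(2), simp add: f_def)
  moreover have "\<dots> = (\<Oplus>k\<in>{..<?n}. l k \<otimes> t [^] k)"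
    by (rule R.finsum_cong'[OF refl]) (use l(1) s(1) tc f in \<open>auto simp: f_def\<close>)
  ultimately show ?thesis using l(3) unfolding alg_def by force
qed

text \<open>A substitute for inverting \<open>t\<close>. A relation for \<open>t\<close> is divided
  by \<open>t\<close> as long as its constant term lies in \<open>Y\<close>; once it does not, the
  relation says that \<open>t\<close> divides, modulo \<open>Y\<close>, minus that constant
  term.\<close>

lemma alg_inverse:
  assumes Y: "prime_in Y E" and E: "subring E R" and B: "subring B R" "B \<subseteq> E" and t: "t \<in> E" "t \<notin> Y" and al: "alg Y B t"
  shows "\<exists>w\<in>adj B t. \<exists>b\<in>B. b \<notin> Y \<and> t \<otimes> w \<ominus> b \<in> Y"
proof -
  note s = subringE[OF B(1)] note e = subringE[OF E] note y = prime_inD[OF Y]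
  have tc: "t \<in> carrier R" using t e by blast
  have "\<exists>w\<in>adj B t. \<exists>b\<in>B. b \<notin> Y \<and> t \<otimes> w \<ominus> b \<in> Y"
    if "f \<in> cpoly B" "f \<notin> cpoly Y" "ev t f \<in> Y" "\<forall>n\<ge>N. cf f n = \<zero>" for f N
    using that
  proof (induction N arbitrary: f)
    case 0
    then have "f \<in> cpoly Y" unfolding cpoly_def using y(2) by auto
    then show ?case using 0 by blast
  next
    case (Suc N)
    obtain h where h: "h \<in> cpoly B" "\<forall>n. cf h n = cf f (Suc n)" "ev t f = cf f 0 \<oplus> t \<otimes> ev t h"
      using ev_shift[OF Suc.prems(1) tc] by blast
    have f0: "cf f 0 \<in> B" "cf f 0 \<in> E" "cf f 0 \<in> carrier R" using cpolyD(2)[OF Suc.prems(1)] B e by blast+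
    have hE: "ev t h \<in> E" "ev t h \<in> carrier R" using ev_subring[OF E _ t(1)] h(1) cpoly_mono[OF B(2)] e(1) by blast+
    show ?case
    proof (cases "cf f 0 \<in> Y")
      case True
      have "t \<otimes> ev t h = ev t f \<ominus> cf f 0" unfolding h(3)
      proof -
        have "T \<otimes> H = F \<oplus> T \<otimes> H \<ominus> F" if "T \<in> carrier R" "H \<in> carrier R" "F \<in> carrier R" for T H F using that by algebra
        then show "t \<otimes> ev t h = cf f 0 \<oplus> t \<otimes> ev t h \<ominus> cf f 0" using f0 hE tc by blast
      qed
      then have "t \<otimes> ev t h \<in> Y" using prime_in_minus[OF Y E Suc.prems(3) True] by simp
      then have "ev t h \<in> Y" using y(6)[OF t(1) hE(1)] t(2) by blast
      moreover have "h \<notin> cpoly Y"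
      proof
        assume hY: "h \<in> cpoly Y"
        have "cf f n \<in> Y" for n
          using True cpolyD(2)[OF hY, of "n - 1"] h(2)[rule_format, of "n - 1"] by (cases n) auto
        then show False using Suc.prems(1,2) unfolding cpoly_def by auto
      qed
      moreover have "\<forall>n\<ge>N. cf h n = \<zero>" using h(2) Suc.prems(4) by auto
      ultimately show ?thesis using Suc.IH[OF h(1)] by blast
    next
      case False
      have "cf f 0 \<oplus> t \<otimes> ev t h \<in> Y" using Suc.prems(3) h(3) by simp
      moreover have "T \<otimes> H \<ominus> (\<ominus> F) = F \<oplus> T \<otimes> H" if "T \<in> carrier R" "H \<in> carrier R" "F \<in> carrier R" for T H F using that by algebra
      ultimately have "t \<otimes> ev t h \<ominus> (\<ominus> cf f 0) \<in> Y" using f0 hE tc by metis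
      moreover have "\<ominus> cf f 0 \<notin> Y"
      proof
        assume "\<ominus> cf f 0 \<in> Y"
        then have "\<ominus> (\<ominus> cf f 0) \<in> Y" using prime_in_neg[OF Y E] by blast
        then show False using False f0 by simp
      qed
      moreover have "\<ominus> cf f 0 \<in> B" using s f0 by blast
      moreover have "ev t h \<in> adj B t" unfolding adj_def using h by blast
      ultimately show ?thesis by blast
    qed
  qed
  moreover obtain f where f: "f \<in> cpoly B" "f \<notin> cpoly Y" "ev t f \<in> Y" using al unfolding alg_def by blast
  moreover obtain k where "\<forall>n>k. cf f n = \<zero>" using poly_bound[OF cpolyD(1)[OF f(1)]] by blast
  then have "\<forall>n\<ge>Suc k. cf f n = \<zero>" by auto
  ultimately show ?thesis by blast
qed

text \<open>Pseudo-division by \<open>f\<close> leaves remainders of degree below \<open>D\<close>,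
  so the powers of \<open>t\<close> below \<open>D\<close> generate once the leading coefficient is
  inverted.\<close>

lemma finmod_simple:
  assumes Y: "prime_in Y E" and E: "subring E R" and B: "subring B R" "B \<subseteq> E" and t: "t \<in> E"
    and f: "f \<in> cpoly B" "\<And>n. n > D \<Longrightarrow> cf f n = \<zero>" "cf f D \<notin> Y" "ev t f \<in> Y"
  shows "finmod Y B (adj B t) (cf f D) {..<D}"
proof (rule finmodI[where G = "\<lambda>i. t [^] i"])
  note s = subringE[OF B(1)] note e = subringE[OF E] note y = prime_inD[OF Y]
  have tc: "t \<in> carrier R" using t e by blast
  show "finite {..<D}" "cf f D \<in> B" "cf f D \<notin> Y" using f cpolyD(2) by auto
  show "t [^] i \<in> adj B t" for i :: nat
    using subring_pow[OF adj_subring[OF B(1) tc] adj_incl(2)[OF B(1) tc]] .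
  fix u assume "u \<in> adj B t"
  then obtain g where g: "g \<in> cpoly B" "u = ev t g" unfolding adj_def by blast
  obtain k h r where kh: "h \<in> cpoly B" "r \<in> cpoly B" "\<forall>n\<ge>D. cf r n = \<zero>"
     "cf f D [^] (k::nat) \<otimes> ev t g = ev t f \<otimes> ev t h \<oplus> ev t r"
    using ev_pseudo_division[OF B(1) f(1,2) g(1) tc] by blast
  have r: "ev t r = (\<Oplus>i\<in>{..<D}. cf r i \<otimes> t [^] i)"
    by (rule ev_sum_bound[OF cpolyD(1)[OF kh(2)] _ tc]) (use kh(3) in auto)
  have hE: "ev t h \<in> E" using ev_subring[OF E _ t] kh(1) cpoly_mono[OF B(2)] by blast
  have "ev t h \<otimes> ev t f \<in> Y" using y(5)[OF hE f(4)] .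
  moreover have c: "ev t h \<in> carrier R" "ev t f \<in> carrier R" "ev t r \<in> carrier R" using ev_closed[OF tc] kh f cpolyD(1) by blast+
  ultimately have "ev t f \<otimes> ev t h \<in> Y" using R.m_comm by metis
  moreover have "ev t f \<otimes> ev t h \<oplus> ev t r \<ominus> ev t r = ev t f \<otimes> ev t h"
    using c by (simp add: a_minus_def R.a_assoc R.r_neg)
  ultimately have "cf f D [^] k \<otimes> u \<ominus> (\<Oplus>i\<in>{..<D}. cf r i \<otimes> t [^] i) \<in> Y"
    unfolding g(2) kh(4) r[symmetric] by simp
  then show "\<exists>N::nat. cf f D [^] N \<otimes> u \<in> comb Y B {..<D} (\<lambda>i. t [^] i)"
    unfolding comb_def using cpolyD(2)[OF kh(2)] by blast
qed

lemma comb_scale: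
  assumes Y: "prime_in Y E" and E: "subring E R" and B: "subring B R" "B \<subseteq> E" and I: "finite I" "finite K"
    and G: "\<And>i. i \<in> I \<Longrightarrow> G i \<in> E" "\<And>i. i \<in> K \<Longrightarrow> G' i \<in> E" and h: "h \<in> E" and u: "u \<in> E" "u \<in> comb Y B I G"
    and Gh: "\<And>i. i \<in> I \<Longrightarrow> G i \<otimes> h \<in> comb Y B K G'"
  shows "u \<otimes> h \<in> comb Y B K G'"
proof -
  note s = subringE[OF B(1)] note e = subringE[OF E] note y = prime_inD[OF Y]
  obtain f where f: "\<forall>i\<in>I. f i \<in> B" "u \<ominus> (\<Oplus>i\<in>I. f i \<otimes> G i) \<in> Y" using u unfolding comb_def by blast
  have c: "h \<in> carrier R" "u \<in> carrier R" "\<And>i. i \<in> I \<Longrightarrow> f i \<in> carrier R" "\<And>i. i \<in> I \<Longrightarrow> G i \<in> carrier R"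
    using h u f G s(1) e(1) by blast+
  let ?S = "\<Oplus>i\<in>I. f i \<otimes> G i"
  have S: "?S \<in> E" by (rule finsum_mem[OF I(1) _ e(1,2,7)]) (use f(1) B(2) G e in auto)
  then have Sc: "?S \<in> carrier R" using e by blast
  have "?S \<otimes> h = (\<Oplus>i\<in>I. (f i \<otimes> G i) \<otimes> h)"
    using R.finsum_ldistr[OF I(1) c(1), of "\<lambda>i. f i \<otimes> G i"] c by auto
  also have "\<dots> = (\<Oplus>i\<in>I. f i \<otimes> (G i \<otimes> h))"
    by (rule R.finsum_cong'[OF refl]) (use c in \<open>auto simp: R.m_assoc\<close>)
  also have "\<dots> \<in> comb Y B K G'"
  proof (rule comb_sum[OF Y E B I(2) G(2) I(1)])
    fix i assume i: "i \<in> I"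
    have g: "G i \<otimes> h \<in> E" using e(6)[OF G(1)[OF i] h] .
    show "f i \<otimes> (G i \<otimes> h) \<in> E" using e(6) g f(1) i B(2) by blast
    show "f i \<otimes> (G i \<otimes> h) \<in> comb Y B K G'" using comb_mult[OF Y E B I(2) G(2) g Gh[OF i]] f(1) i by blast
  qed
  finally have Sh: "?S \<otimes> h \<in> comb Y B K G'" .
  have d: "u \<otimes> h \<ominus> ?S \<otimes> h \<in> Y"
  proof -
    have "h \<otimes> (u \<ominus> ?S) \<in> Y" using y(5)[OF h f(2)] .
    moreover have "h \<otimes> (u \<ominus> S) = u \<otimes> h \<ominus> S \<otimes> h" if "S \<in> carrier R" for S using c(1,2) that by algebra
    ultimately show ?thesis using Sc by metis
  qed
  show ?thesis by (rule comb_cong[OF Y E B I(2) G(2) e(6)[OF u(1) h] e(6)[OF S h] Sh d])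
qed

lemma pow_cong:
  assumes Y: "prime_in Y E" and E: "subring E R" and ab: "a \<in> E" "b \<in> E" "a \<ominus> b \<in> Y"
  shows "a [^] (n::nat) \<ominus> b [^] n \<in> Y"
proof (induction n)
  case 0
  then show ?case using prime_inD(2)[OF Y] by (simp add: a_minus_def R.r_neg)
next
  case (Suc n)
  have c: "a \<in> carrier R" "b \<in> carrier R" using ab E subring_carrier by blast+
  have "A \<otimes> a \<ominus> B \<otimes> b = a \<otimes> (A \<ominus> B) \<oplus> B \<otimes> (a \<ominus> b)" if "A \<in> carrier R" "B \<in> carrier R" for A B using c that by algebra
  then have "a [^] Suc n \<ominus> b [^] Suc n = a \<otimes> (a [^] n \<ominus> b [^] n) \<oplus> b [^] n \<otimes> (a \<ominus> b)" using c by simp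
  then show ?case using prime_inD(4,5)[OF Y] Suc ab subring_pow[OF E] by simp
qed

text \<open>The products of the two families generate. The element \<open>d\<close> inverted in the
  upper step lies in \<open>C\<close> but perhaps not in \<open>B\<close>; being algebraic over
  \<open>B\<close>, it divides modulo \<open>Y\<close> some \<open>b\<close> of \<open>B\<close>
  outside \<open>Y\<close>, and \<open>c \<otimes> b\<close> is inverted instead.\<close>

lemma finmod_trans:
  assumes Y: "prime_in Y E" and E: "subring E R" and B: "subring B R" and C: "subring C R" "B \<subseteq> C" and D: "subring D R" "C \<subseteq> D" "D \<subseteq> E"
    and f1: "finmod Y B C c I" and f2: "finmod Y C D d J"
  shows "\<exists>c' K. finmod Y B D c' K"
proof -
  note s = subringE[OF B(1)] note e = subringE[OF E] note y = prime_inD[OF Y] note sC = subringE[OF C(1)] note sD = subringE[OF D(1)]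
  have BE: "B \<subseteq> E" "C \<subseteq> E" using C D by blast+
  obtain G where G: "finite I" "c \<in> B" "c \<notin> Y" "\<And>i. i \<in> I \<Longrightarrow> G i \<in> C" "\<And>u. u \<in> C \<Longrightarrow> \<exists>N::nat. c [^] N \<otimes> u \<in> comb Y B I G"
    using finmodE[OF f1] by metis
  obtain H where H: "finite J" "d \<in> C" "d \<notin> Y" "\<And>i. i \<in> J \<Longrightarrow> H i \<in> D" "\<And>u. u \<in> D \<Longrightarrow> \<exists>N::nat. d [^] N \<otimes> u \<in> comb Y C J H"
    using finmodE[OF f2] by metis
  have dE: "d \<in> E" using H C D by blast
  have "alg Y B d" using finmod_alg[OF Y E B C(2) BE(2) C(1) f1 H(2)] .
  then obtain w b where w: "w \<in> adj B d" and b: "b \<in> B" "b \<notin> Y" "d \<otimes> w \<ominus> b \<in> Y"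
    using alg_inverse[OF Y E B BE(1) dE H(3)] by blast
  have wC: "w \<in> C" using adj_least[OF C(1) C(2) H(2)] w by blast
  \<comment> \<open>Index sets of \<open>finmod\<close> consist of natural numbers, so pairs of
    indices are encoded.\<close>
  let ?K = "prod_encode ` (I \<times> J)"
  define G' where "G' = (\<lambda>k. G (fst (prod_decode k)) \<otimes> H (snd (prod_decode k)))"
  have GE: "G i \<in> E" if "i \<in> I" for i using G(4) BE that by blast
  have HE: "H i \<in> E" if "i \<in> J" for i using H(4) D that by blast
  have K: "finite ?K" using G H by auto
  have G'D: "G' k \<in> D" if "k \<in> ?K" for k
  proof -
    obtain i j where ij: "i \<in> I" "j \<in> J" "k = prod_encode (i, j)" using \<open>k \<in> ?K\<close> by auto
    have "G i \<in> D" using G(4)[OF ij(1)] D(2) by blast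
    then show ?thesis using sD(6) H(4)[OF ij(2)] ij(3) unfolding G'_def by simp
  qed
  have G'E: "G' k \<in> E" if "k \<in> ?K" for k using G'D[OF that] D(3) by blast
  have "finmod Y B D (c \<otimes> b) ?K"
  proof (rule finmodI[where G = G'])
    show "finite ?K" using K .
    show "c \<otimes> b \<in> B" using s G b by blast
    show "c \<otimes> b \<notin> Y" using y(6) G(2,3) b BE by blast
    show "\<And>i. i \<in> ?K \<Longrightarrow> G' i \<in> D" using G'D .
    fix u assume u: "u \<in> D"
    have uE: "u \<in> E" using u D by blast
    obtain N :: nat where N: "d [^] N \<otimes> u \<in> comb Y C J H" using H(5)[OF u] by blast
    have wN: "w [^] N \<in> C" using subring_pow[OF C(1) wC] .
    have dN: "d [^] N \<in> C" using subring_pow[OF C(1) H(2)] .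
    have dNu: "d [^] N \<otimes> u \<in> E" using e(6) uE dN BE by blast
    \<comment> \<open>Since \<open>d \<otimes> w\<close> is congruent to \<open>b\<close>, the
      factor \<open>w [^] N\<close> turns \<open>d [^] N\<close> into \<open>b [^] N\<close> modulo
      \<open>Y\<close>.\<close>
    have 1: "w [^] N \<otimes> (d [^] N \<otimes> u) \<in> comb Y C J H"
      using comb_mult[OF Y E C(1) BE(2) H(1) HE dNu N wN] .
    then obtain f where f: "\<forall>j\<in>J. f j \<in> C" "w [^] N \<otimes> (d [^] N \<otimes> u) \<ominus> (\<Oplus>j\<in>J. f j \<otimes> H j) \<in> Y"
      unfolding comb_def by blast
    have fE: "f j \<in> E" if "j \<in> J" for j using f that BE by blast
    have "\<exists>M::nat. \<forall>j\<in>J. c [^] M \<otimes> f j \<in> comb Y B I G"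
      by (rule finmod_uniform[OF Y E B BE(1) G(1) GE G(2) H(1) fE]) (use f(1) G(5) in auto)
    then obtain M :: nat where M: "\<forall>j\<in>J. c [^] M \<otimes> f j \<in> comb Y B I G" by blast
    have cM: "c [^] k \<in> B" "c [^] k \<in> E" for k :: nat using subring_pow[OF B G(2)] BE by blast+
    have bM: "b [^] k \<in> B" "b [^] k \<in> E" for k :: nat using subring_pow[OF B b(1)] BE by blast+
    have 2: "(c [^] M \<otimes> f j) \<otimes> H j \<in> comb Y B ?K G'" if j: "j \<in> J" for j
    proof (rule comb_scale[OF Y E B BE(1) G(1) K GE G'E HE[OF j]])
      show "c [^] M \<otimes> f j \<in> E" using e(6) cM fE j by blast
      show "c [^] M \<otimes> f j \<in> comb Y B I G" using M j by blast
      fix i assume i: "i \<in> I"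
      have m: "prod_encode (i, j) \<in> ?K" using i j by blast
      have "G' (prod_encode (i,j)) \<in> comb Y B ?K G'"
        by (rule comb_gen[OF Y E B K _ m]) (use G'E e(1) in blast)
      then show "G i \<otimes> H j \<in> comb Y B ?K G'" unfolding G'_def by simp
    qed
    let ?S = "\<Oplus>j\<in>J. f j \<otimes> H j"
    have SE: "?S \<in> E" by (rule finsum_mem[OF H(1) _ e(1,2,7)]) (use fE HE e in auto)
    have fc: "f j \<in> carrier R" "H j \<in> carrier R" if "j \<in> J" for j using fE HE that e(1) by blast+
    have cc: "c [^] k \<in> carrier R" "b [^] k \<in> carrier R" "w [^] k \<in> carrier R" "d [^] k \<in> carrier R" "u \<in> carrier R" "?S \<in> carrier R"
      "c \<in> carrier R" "b \<in> carrier R" "d \<in> carrier R" "w \<in> carrier R" for k :: nat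
      using cM bM e(1) SE uE G(2) b(1) BE dE wC subring_carrier[OF C(1)] by (blast intro: R.nat_pow_closed)+
    have "c [^] M \<otimes> ?S = (\<Oplus>j\<in>J. c [^] M \<otimes> (f j \<otimes> H j))"
      using R.finsum_rdistr[OF H(1) cc(1), of "\<lambda>j. f j \<otimes> H j"] fc by auto
    also have "\<dots> = (\<Oplus>j\<in>J. (c [^] M \<otimes> f j) \<otimes> H j)"
      by (rule R.finsum_cong'[OF refl]) (use fc cc in \<open>auto simp: R.m_assoc\<close>)
    also have "\<dots> \<in> comb Y B ?K G'"
      by (rule comb_sum[OF Y E B BE(1) K G'E H(1) _ 2]) (use cM fE HE e in auto)
    finally have 3: "c [^] M \<otimes> ?S \<in> comb Y B ?K G'" .
    have 4: "(d \<otimes> w) [^] N \<ominus> b [^] N \<in> Y" using pow_cong[OF Y E _ _ b(3)] e(6) dE wC b BE by blast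
    have E4: "(d \<otimes> w) [^] N = d [^] N \<otimes> w [^] N" using R.nat_pow_distrib[of d w N] cc by auto
    have 5: "b [^] N \<otimes> u \<ominus> ?S \<in> Y"
    proof -
      have "(W \<otimes> (D \<otimes> u) \<ominus> S) \<ominus> u \<otimes> (D \<otimes> W \<ominus> B) = B \<otimes> u \<ominus> S"
        if "W \<in> carrier R" "D \<in> carrier R" "S \<in> carrier R" "B \<in> carrier R" for W D S B using that cc(5) by algebra
      then have "b [^] N \<otimes> u \<ominus> ?S = (w [^] N \<otimes> (d [^] N \<otimes> u) \<ominus> ?S) \<ominus> u \<otimes> (d [^] N \<otimes> w [^] N \<ominus> b [^] N)"
        using cc by simp
      also have "\<dots> \<in> Y" by (rule prime_in_minus[OF Y E f(2) y(5)[OF uE 4[unfolded E4]]])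
      finally show ?thesis .
    qed
    have bu: "b [^] N \<otimes> u \<in> E" using e(6) bM uE by blast
    have cbu: "c [^] M \<otimes> (b [^] N \<otimes> u) \<in> E" using e(6) cM bu by blast
    have 6: "c [^] M \<otimes> (b [^] N \<otimes> u) \<in> comb Y B ?K G'"
    proof (rule comb_cong[OF Y E B BE(1) K G'E cbu _ 3])
      show "c [^] M \<otimes> ?S \<in> E" using e(6) cM SE by blast
      have "c [^] M \<otimes> (b [^] N \<otimes> u \<ominus> ?S) \<in> Y" using y(5)[OF cM(2) 5] .
      then show "c [^] M \<otimes> (b [^] N \<otimes> u) \<ominus> c [^] M \<otimes> ?S \<in> Y"
        using diff_distl[of "c [^] M" "b [^] N \<otimes> u" ?S] cc by simp
    qed
    \<comment> \<open>The additional factor raises the exponents of \<open>c\<close> and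
      \<open>b\<close> to the common value \<open>M + N\<close>.\<close>
    have "(c [^] N \<otimes> b [^] M) \<otimes> (c [^] M \<otimes> (b [^] N \<otimes> u)) \<in> comb Y B ?K G'"
      by (rule comb_mult[OF Y E B BE(1) K G'E cbu 6]) (use s cM bM in auto)
    moreover have "(c [^] N \<otimes> b [^] M) \<otimes> (c [^] M \<otimes> (b [^] N \<otimes> u)) = (c \<otimes> b) [^] (M+N) \<otimes> u"
    proof -
      have "(CN \<otimes> BM) \<otimes> (CM \<otimes> (BN \<otimes> u)) = ((CM \<otimes> CN) \<otimes> (BM \<otimes> BN)) \<otimes> u"
        if "CN \<in> carrier R" "BM \<in> carrier R" "CM \<in> carrier R" "BN \<in> carrier R" for CN BM CM BN
        using that cc(5) by algebra
      then have "(c [^] N \<otimes> b [^] M) \<otimes> (c [^] M \<otimes> (b [^] N \<otimes> u)) = ((c [^] M \<otimes> c [^] N) \<otimes> (b [^] M \<otimes> b [^] N)) \<otimes> u"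
        using cc by blast
      also have "\<dots> = (c \<otimes> b) [^] (M+N) \<otimes> u"
        using R.nat_pow_distrib[of c b "M+N"] cc R.nat_pow_mult by auto
      finally show ?thesis .
    qed
    ultimately show "\<exists>k::nat. (c \<otimes> b) [^] k \<otimes> u \<in> comb Y B ?K G'" by metis
  qed
  then show ?thesis by blast
qed

section \<open>Algebraicity modulo a prime: change of ring, transitivity, exchange\<close>

lemma prime_in_restrict:
  assumes "prime_in Q C" "subring D R" "D \<subseteq> C"
  shows "prime_in (Q \<inter> D) D"
proof -
  note q = prime_inD[OF assms(1)] and s = subringE[OF assms(2)]
  have D: "a \<in> C" if "a \<in> D" for a using that assms(3) by blast
  show ?thesis unfolding prime_in_def
  proof (intro conjI ballI impI)
    show "\<zero> \<in> Q \<inter> D" "\<one> \<notin> Q \<inter> D" using q(2,3) s(2) by auto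
    show "a \<oplus> b \<in> Q \<inter> D" if "a \<in> Q \<inter> D" "b \<in> Q \<inter> D" for a b using q(4) s(7) that by simp
    show "a \<otimes> b \<in> Q \<inter> D" if "a \<in> D" "b \<in> Q \<inter> D" for a b using q(5) s(6) D that by simp
    show "a \<in> Q \<inter> D \<or> b \<in> Q \<inter> D" if "a \<in> D" "b \<in> D" "a \<otimes> b \<in> Q \<inter> D" for a b
      using q(6)[OF D[OF that(1)] D[OF that(2)]] that by simp
  qed simp
qed

lemma zero_prime:
  assumes "subring C R"
  shows "prime_in {\<zero>} C"
  using subringE[OF assms] R.integral_iff unfolding prime_in_def by (auto simp: subset_iff)

lemma alg_mono: "alg Y B t \<Longrightarrow> B \<subseteq> B' \<Longrightarrow> alg Y B' t"
  unfolding alg_def using cpoly_mono by blast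

lemma alg_cong:
  assumes "subring D R" "B \<subseteq> D" "t \<in> D"
  shows "alg (Y \<inter> D) B t \<longleftrightarrow> alg Y B t"
proof -
  have "(f \<in> cpoly (Y \<inter> D) \<longleftrightarrow> f \<in> cpoly Y) \<and> (ev t f \<in> Y \<inter> D \<longleftrightarrow> ev t f \<in> Y)" if "f \<in> cpoly B" for f
    using that ev_subring[OF assms(1) _ assms(3)] cpoly_mono[OF assms(2)] assms(2) unfolding cpoly_def by blast
  then show ?thesis unfolding alg_def by blast
qed

text \<open>Equality is stronger than congruence. Thus one family and one \<open>c\<close>, found
  modulo zero, serve all primes avoiding \<open>c\<close>.\<close>

lemma finmod_mono:
  assumes "finmod {\<zero>} B C c I" "\<zero> \<in> Y" "c \<notin> Y"
  shows "finmod Y B C c I"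
proof -
  obtain G where G: "finite I" "c \<in> B" "c \<notin> {\<zero>}" "\<And>i. i \<in> I \<Longrightarrow> G i \<in> C" "\<And>u. u \<in> C \<Longrightarrow> \<exists>N::nat. c [^] N \<otimes> u \<in> comb {\<zero>} B I G"
    using finmodE[OF assms(1)] by metis
  have "comb {\<zero>} B I G \<subseteq> comb Y B I G" unfolding comb_def using assms(2) by auto
  then show ?thesis by (intro finmodI[OF G(1,2) assms(3) G(4)]) (use G(5) in blast)+
qed

lemma alg_finmod:
  assumes Y: "prime_in Y E" and E: "subring E R" and B: "subring B R" "B \<subseteq> E" and t: "t \<in> E" "alg Y B t"
  shows "\<exists>c I. finmod Y B (adj B t) c I"
  using min_poly[OF Y E B t] finmod_simple[OF Y E B t(1)] by blast

text \<open>Each of the two extensions is finitely generated after inverting an element, hence so is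
  the composite, and this makes its elements algebraic.\<close>

lemma alg_trans:
  assumes Y: "prime_in Y E" and E: "subring E R" and B: "subring B R" "B \<subseteq> E" and s: "s \<in> E" "alg Y B s"
    and t: "t \<in> E" "alg Y (adj B s) t"
  shows "alg Y B t"
proof -
  have sc: "s \<in> carrier R" "t \<in> carrier R" using s t E subring_carrier by blast+
  note A = adj_subring[OF B(1) sc(1)]
  have AE: "adj B s \<subseteq> E" by (rule adj_least[OF E B(2) s(1)])
  note A2 = adj_subring[OF A sc(2)]
  have A2E: "adj (adj B s) t \<subseteq> E" by (rule adj_least[OF E AE t(1)])
  obtain c I where f1: "finmod Y B (adj B s) c I" using alg_finmod[OF Y E B s] by blast
  obtain d J where f2: "finmod Y (adj B s) (adj (adj B s) t) d J" using alg_finmod[OF Y E A AE t] by blast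
  obtain c' K where "finmod Y B (adj (adj B s) t) c' K"
    using finmod_trans[OF Y E B(1) A adj_incl(1)[OF B(1) sc(1)] A2 adj_incl(1)[OF A sc(2)] A2E f1 f2] by blast
  then show ?thesis
    using finmod_alg[OF Y E B(1) _ A2E A2] adj_incl[OF A sc(2)] adj_incl(1)[OF B(1) sc(1)] by blast
qed

text \<open>A relation of \<open>t\<close> over \<open>B[s]\<close> is a polynomial in two
  variables; collecting powers of \<open>s\<close> makes it a relation of \<open>s\<close> over
  \<open>B[t]\<close>. If that were trivial modulo \<open>Y\<close>, transcendence of
  \<open>t\<close> over \<open>B\<close> would put every coefficient into \<open>Y\<close>, and the
  given relation would be trivial as well.\<close>

lemma alg_exchange:
  assumes Y: "prime_in Y E" and E: "subring E R" and B: "subring B R" "B \<subseteq> E" and s: "s \<in> E"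
    and t: "t \<in> E" "alg Y (adj B s) t" "\<not> alg Y B t"
  shows "alg Y (adj B t) s"
proof -
  note sB = subringE[OF B(1)]
  have sc: "s \<in> carrier R" "t \<in> carrier R" using s t E subring_carrier by blast+
  obtain f where f: "f \<in> cpoly (adj B s)" "f \<notin> cpoly Y" "ev t f \<in> Y" using t(2) unfolding alg_def by blast
  have fP: "f \<in> carrier P" using f cpolyD by blast
  obtain n where n: "\<forall>k>n. cf f k = \<zero>" using poly_bound[OF fP] by blast
  have "\<forall>k. \<exists>m\<in>cpoly B. ev s m = cf f k" using cpolyD(2)[OF f(1)] unfolding adj_def by (metis imageE)
  then obtain m0 where m0: "\<And>k. m0 k \<in> cpoly B" "\<And>k. ev s (m0 k) = cf f k" by metis
  have "\<exists>N. \<forall>k\<le>n. \<forall>j\<ge>N. cf (m0 k) j = \<zero>"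
  proof -
    have "\<forall>k. \<exists>N. \<forall>j>N. cf (m0 k) j = \<zero>" using poly_bound cpolyD(1)[OF m0(1)] by blast
    then obtain b where b: "\<And>k j. j > b k \<Longrightarrow> cf (m0 k) j = \<zero>" by metis
    have "cf (m0 k) j = \<zero>" if "k \<le> n" "j \<ge> Suc (Max (b ` {..n}))" for k j
    proof -
      have "b k \<le> Max (b ` {..n})" using that by (intro Max_ge) auto
      then have "j > b k" using that by linarith
      then show ?thesis by (rule b)
    qed
    then show ?thesis by blast
  qed
  then obtain N where N: "\<And>k j. k \<le> n \<Longrightarrow> j \<ge> N \<Longrightarrow> cf (m0 k) j = \<zero>" by blast
  \<comment> \<open>For \<open>k > n\<close> the polynomial \<open>m0 k\<close> is only known to
    vanish at \<open>s\<close>; replacing it by zero makes the array of coefficients finite.\<close>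
  define c where "c = (\<lambda>k j. if k \<le> n then cf (m0 k) j else \<zero>)"
  have cB: "c k j \<in> B" "c k j \<in> carrier R" for k j using cpolyD(2)[OF m0(1)] sB(1,2) unfolding c_def by auto
  have cz: "c k j = \<zero>" if "k > n \<or> j \<ge> N" for k j using that N unfolding c_def by auto
  define q where "q = (\<lambda>j k. c k j)"
  have q: "q j \<in> cpoly B" "cf (q j) k = c k j" for j k
  proof -
    have p: "q j \<in> carrier P" "\<And>k. cf (q j) k = q j k"
      by (rule poly_fun[of "q j" n], simp add: q_def cB, simp add: q_def cz)+
    then show "q j \<in> cpoly B" "cf (q j) k = c k j" unfolding cpoly_def using cB by (auto simp: q_def)
  qed
  define g where "g = (\<lambda>j. ev t (q j))"
  have gA: "g j \<in> adj B t" for j unfolding g_def adj_def using q by blast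
  have gc: "g j \<in> carrier R" for j using gA adj_subring[OF B(1) sc(2)] subring_carrier by blast
  have gsum: "g j = (\<Oplus>k\<in>{..<Suc n}. c k j \<otimes> t [^] k)" for j
  proof -
    have "ev t (q j) = (\<Oplus>k\<in>{..<Suc n}. cf (q j) k \<otimes> t [^] k)"
      by (rule ev_sum_bound[OF cpolyD(1)[OF q(1)] _ sc(2)]) (simp add: q(2) cz)
    then show ?thesis unfolding g_def q(2) .
  qed
  have gz: "g j = \<zero>" if "j \<ge> N" for j
    unfolding gsum by (rule R.add.finprod_one_eqI) (use that cz sc in auto)
  have g: "g \<in> carrier P" "cf g j = g j" for j
    by (rule poly_fun[of g N, OF gc], simp add: gz)+
  have fsum: "cf f k = (\<Oplus>j\<in>{..<N}. c k j \<otimes> s [^] j)" for k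
  proof (cases "k \<le> n")
    case True
    have "ev s (m0 k) = (\<Oplus>j\<in>{..<N}. cf (m0 k) j \<otimes> s [^] j)"
      by (rule ev_sum_bound[OF cpolyD(1)[OF m0(1)] _ sc(1)]) (use N True in auto)
    then show ?thesis using m0(2) True unfolding c_def by simp
  next
    case False
    have "(\<Oplus>j\<in>{..<N}. c k j \<otimes> s [^] j) = \<zero>"
      by (rule R.add.finprod_one_eqI) (use False cz sc in auto)
    then show ?thesis using n False by simp
  qed
  have "ev s g = (\<Oplus>j\<in>{..<N}. g j \<otimes> s [^] j)"
    using ev_sum_bound[OF g(1) _ sc(1), of N] gz g(2) by simp
  also have "\<dots> = (\<Oplus>j\<in>{..<N}. \<Oplus>k\<in>{..<Suc n}. (c k j \<otimes> t [^] k) \<otimes> s [^] j)"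
  proof (rule R.finsum_cong'[OF refl])
    show "g j \<otimes> s [^] j = (\<Oplus>k\<in>{..<Suc n}. (c k j \<otimes> t [^] k) \<otimes> s [^] j)" for j
      unfolding gsum by (rule R.finsum_ldistr) (use cB sc in auto)
  qed (use cB sc in \<open>auto intro!: R.finsum_closed\<close>)
  also have "\<dots> = (\<Oplus>k\<in>{..<Suc n}. \<Oplus>j\<in>{..<N}. (c k j \<otimes> t [^] k) \<otimes> s [^] j)"
    by (rule finsum_swap) (use cB sc in auto)
  also have "\<dots> = (\<Oplus>k\<in>{..<Suc n}. cf f k \<otimes> t [^] k)"
  proof (rule R.finsum_cong'[OF refl])
    fix k
    have "(c k j \<otimes> t [^] k) \<otimes> s [^] j = (c k j \<otimes> s [^] j) \<otimes> t [^] k" for j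
    proof -
      have "a \<otimes> b \<otimes> d = a \<otimes> d \<otimes> b" if "a \<in> carrier R" "b \<in> carrier R" "d \<in> carrier R" for a b d
        using that by algebra
      then show ?thesis using cB sc by auto
    qed
    then have "(\<Oplus>j\<in>{..<N}. (c k j \<otimes> t [^] k) \<otimes> s [^] j) = (\<Oplus>j\<in>{..<N}. (c k j \<otimes> s [^] j) \<otimes> t [^] k)" by simp
    also have "\<dots> = (\<Oplus>j\<in>{..<N}. c k j \<otimes> s [^] j) \<otimes> t [^] k"
      by (rule R.finsum_ldistr[symmetric]) (use cB sc in auto)
    finally show "(\<Oplus>j\<in>{..<N}. (c k j \<otimes> t [^] k) \<otimes> s [^] j) = cf f k \<otimes> t [^] k" unfolding fsum .
  qed (use fP sc in auto)
  also have "\<dots> = ev t f"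
    by (rule ev_sum_bound[symmetric, OF fP _ sc(2)]) (use n in auto)
  finally have "ev s g \<in> Y" using f(3) by simp
  moreover have "g \<in> cpoly (adj B t)" unfolding cpoly_def using g gA by simp
  moreover have "g \<notin> cpoly Y"
  proof
    assume gY: "g \<in> cpoly Y"
    have qY: "q j \<in> cpoly Y" for j
    proof (rule ccontr)
      assume "q j \<notin> cpoly Y"
      moreover have "ev t (q j) \<in> Y" using cpolyD(2)[OF gY, of j] g(2) unfolding g_def by simp
      ultimately show False using t(3) q(1) unfolding alg_def by blast
    qed
    have "cf f k \<in> Y" for k
    proof (cases "k \<le> n")
      case True
      have "m0 k \<in> cpoly Y" unfolding cpoly_def using cpolyD(1)[OF m0(1)] cpolyD(2)[OF qY, of _ k] q(2) True by (simp add: c_def)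
      then show ?thesis using ev_prime[OF Y E _ s] m0(2) by metis
    next
      case False then show ?thesis using n prime_inD(2)[OF Y] by simp
    qed
    then show False using f(2) fP unfolding cpoly_def by simp
  qed
  ultimately show ?thesis unfolding alg_def by blast
qed

text \<open>An element of \<open>x'\<close> outside \<open>x\<close> divides, modulo
  \<open>x\<close>, some \<open>b\<close> of \<open>B\<close> outside \<open>x\<close>. Then
  \<open>b\<close> lies in \<open>x'\<close> and in \<open>B\<close>, hence in \<open>x\<close> by
  \<open>eq\<close>, a contradiction.\<close>

lemma incomparable:
  assumes x: "prime_in x C" "prime_in x' C" "x \<subseteq> x'" and C: "subring C R" and B: "subring B R" "B \<subseteq> C"
    and eq: "x' \<inter> B \<subseteq> x" and al: "\<And>t. t \<in> C \<Longrightarrow> alg x B t"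
  shows "x = x'"
proof (rule ccontr)
  assume "x \<noteq> x'"
  then obtain t where t: "t \<in> x'" "t \<notin> x" using x by blast
  have tC: "t \<in> C" using t prime_inD(1)[OF x(2)] by blast
  obtain w b where w: "w \<in> adj B t" "b \<in> B" "b \<notin> x" "t \<otimes> w \<ominus> b \<in> x"
    using alg_inverse[OF x(1) C B tC t(2) al[OF tC]] by blast
  have wC: "w \<in> C" using adj_least[OF C B(2) tC] w by blast
  have "w \<otimes> t \<in> x'" using prime_inD(5)[OF x(2) wC t(1)] .
  then have tw: "t \<otimes> w \<in> x'" using R.m_comm tC wC C subring_carrier by metis
  moreover have "t \<otimes> w \<in> C" using tw prime_inD(1)[OF x(2)] by blast
  ultimately have "b \<in> x'" using prime_in_cancel[OF x(2) C, of "t \<otimes> w" b] w x(3) B(2) by blast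
  then show False using w eq by blast
qed

text \<open>Primes in one fibre are incomparable, so each \<open>x\<close> has an element
  \<open>e x\<close> outside \<open>x\<close> and inside all the others. If there were more than
  \<open>card I\<close> primes, these elements would satisfy a relation over \<open>B\<close> valid
  modulo all of them and nontrivial on the base. Read modulo a suitable \<open>x\<close>, only one
  term survives, and it forces its coefficient into \<open>x \<inter> B = u\<close>.\<close>

lemma card_bound:
  assumes C: "subring C R" and B: "subring B R" "B \<subseteq> C" and fm: "finmod {\<zero>} B C c I"
    and XX: "finite XX" "\<And>x. x \<in> XX \<Longrightarrow> prime_in x C" "\<And>x. x \<in> XX \<Longrightarrow> x \<inter> B = u" and cu: "c \<notin> u"
  shows "card XX \<le> card I"
proof (rule ccontr)
  assume "\<not> card XX \<le> card I"
  then have card: "card I < card XX" by simp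
  then obtain x1 where x1: "x1 \<in> XX" by fastforce
  have cB: "c \<in> B" using fm unfolding finmod_def by blast
  have cx: "c \<notin> x" if "x \<in> XX" for x using XX(3)[OF that] cB cu by blast
  have fmx: "finmod x B C c I" if "x \<in> XX" for x
    by (rule finmod_mono[OF fm prime_inD(2)[OF XX(2)[OF that]] cx[OF that]])
  have inc: "x = x'" if "x \<in> XX" "x' \<in> XX" "x \<subseteq> x'" for x x'
  proof (rule incomparable[OF XX(2)[OF that(1)] XX(2)[OF that(2)] that(3) C B])
    show "x' \<inter> B \<subseteq> x" using XX(3) that by blast
    show "alg x B t" if "t \<in> C" for t
      using finmod_alg[OF XX(2)[OF \<open>x \<in> XX\<close>] C B(1) B(2) subset_refl C fmx[OF \<open>x \<in> XX\<close>] that] .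
  qed
  \<comment> \<open>The element is a product with one factor from each of the other primes, each
    factor chosen outside \<open>x\<close>.\<close>
  have ex: "\<exists>e\<in>C. e \<notin> x \<and> (\<forall>x'\<in>F. e \<in> x')" if "finite F" "F \<subseteq> XX - {x}" and xX: "x \<in> XX" for F x
    using that(1,2)
  proof (induction F)
    case empty
    then show ?case using prime_inD(3)[OF XX(2)[OF xX]] subringE(3)[OF C] by blast
  next
    case (insert y F)
    then obtain e where e: "e \<in> C" "e \<notin> x" "\<forall>x'\<in>F. e \<in> x'" by blast
    have "y \<in> XX" "y \<noteq> x" using insert by auto
    then obtain d where d: "d \<in> y" "d \<notin> x" using inc xX by blast
    have dC: "d \<in> C" using d prime_inD(1)[OF XX(2)[OF \<open>y \<in> XX\<close>]] by blast
    have "d \<otimes> e \<in> C" using subringE(6)[OF C] dC e by blast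
    moreover have "d \<otimes> e \<notin> x" using prime_inD(6)[OF XX(2)[OF xX] dC e(1)] d e by blast
    moreover have "d \<otimes> e \<in> x'" if "x' \<in> F" for x'
      using prime_inD(5)[OF XX(2) dC, of x' e] e that insert.prems by blast
    moreover have "d \<otimes> e \<in> y"
      using prime_inD(5)[OF XX(2)[OF \<open>y \<in> XX\<close>] e(1) d(1)] R.m_comm subring_carrier[OF C] dC e(1) by metis
    ultimately show ?case by blast
  qed
  have "\<forall>x\<in>XX. \<exists>e. e \<in> C \<and> e \<notin> x \<and> (\<forall>x'\<in>XX - {x}. e \<in> x')" using ex[of "XX - {x}" x for x] XX(1) by blast
  then obtain e where e: "\<And>x. x \<in> XX \<Longrightarrow> e x \<in> C" "\<And>x. x \<in> XX \<Longrightarrow> e x \<notin> x" "\<And>x x'. x \<in> XX \<Longrightarrow> x' \<in> XX \<Longrightarrow> x' \<noteq> x \<Longrightarrow> e x \<in> x'"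
    by (metis DiffI singletonD)
  have "\<exists>l. (\<forall>k\<in>XX. l k \<in> B) \<and> (\<exists>k\<in>XX. l k \<notin> x1) \<and>
      (\<forall>Y. prime_in Y C \<and> {\<zero>} \<subseteq> Y \<and> x1 \<inter> B \<subseteq> Y \<and> c \<notin> Y \<longrightarrow> (\<Oplus>k\<in>XX. l k \<otimes> e k) \<in> Y)"
    by (rule finmod_depend_all[OF zero_prime[OF C] XX(2)[OF x1] C B subset_refl fm XX(1) card e(1)])
  then obtain l where l: "\<forall>k\<in>XX. l k \<in> B" "\<exists>k\<in>XX. l k \<notin> x1"
      "\<And>Y. prime_in Y C \<and> {\<zero>} \<subseteq> Y \<and> x1 \<inter> B \<subseteq> Y \<and> c \<notin> Y \<Longrightarrow> (\<Oplus>k\<in>XX. l k \<otimes> e k) \<in> Y" by blast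
  then obtain x where x: "x \<in> XX" "l x \<notin> x1" by blast
  note px = prime_inD[OF XX(2)[OF x(1)]]
  have xc: "x \<subseteq> carrier R" using px(1) subringE(1)[OF C] by blast
  have "x1 \<inter> B \<subseteq> x" using XX(3)[OF x1] XX(3)[OF x(1)] by blast
  then have s: "(\<Oplus>k\<in>XX. l k \<otimes> e k) \<in> x" using l(3) XX(2)[OF x(1)] px(2) cx[OF x(1)] by blast
  have lc: "l k \<otimes> e k \<in> carrier R" if "k \<in> XX" for k
    using l(1) e(1) that subring_carrier[OF B(1)] subring_carrier[OF C] by blast
  have s': "(\<Oplus>k\<in>XX - {x}. l k \<otimes> e k) \<in> x"
  proof (rule finsum_mem[OF _ _ xc px(2) px(4)])
    show "l k \<otimes> e k \<in> x" if "k \<in> XX - {x}" for k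
      using px(5)[OF _ e(3)] l(1) that x(1) B(2) by blast
  qed (use XX(1) in auto)
  have ins: "XX = insert x (XX - {x})" using x(1) by blast
  have "(\<Oplus>k\<in>XX. l k \<otimes> e k) = l x \<otimes> e x \<oplus> (\<Oplus>k\<in>XX - {x}. l k \<otimes> e k)"
    by (subst ins, rule R.finsum_insert) (use XX(1) lc x(1) in auto)
  then have "l x \<otimes> e x = (\<Oplus>k\<in>XX. l k \<otimes> e k) \<ominus> (\<Oplus>k\<in>XX - {x}. l k \<otimes> e k)"
    using lc[OF x(1)] s' xc by (auto simp: a_minus_def R.a_assoc R.r_neg)
  then have "l x \<otimes> e x \<in> x" using prime_in_minus[OF XX(2)[OF x(1)] C s s'] by simp
  then have "l x \<in> x" using px(6) l(1) x(1) B(2) e(1,2) by blast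
  then show False using x l(1) XX(3)[OF x1] XX(3)[OF x(1)] by blast
qed

section \<open>Extending and amalgamating primes\<close>

definition ideal_in :: "'a set \<Rightarrow> 'a set \<Rightarrow> bool" where
  "ideal_in J C \<longleftrightarrow> J \<subseteq> C \<and> \<zero> \<in> J \<and> (\<forall>a\<in>J. \<forall>b\<in>J. a \<oplus> b \<in> J) \<and> (\<forall>a\<in>C. \<forall>b\<in>J. a \<otimes> b \<in> J)"

text \<open>Krull's argument: an ideal maximal among those that contain \<open>J\<close> and are
  disjoint from the multiplicative set \<open>M\<close> is prime.\<close>

lemma prime_avoiding_exists:
  assumes C: "subring C R" and J: "ideal_in J C" and M: "\<one> \<in> M" "\<And>a b. a \<in> M \<Longrightarrow> b \<in> M \<Longrightarrow> a \<otimes> b \<in> M" "J \<inter> M = {}"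
  shows "\<exists>Q. prime_in Q C \<and> J \<subseteq> Q \<and> Q \<inter> M = {}"
proof -
  note s = subringE[OF C]
  define F where "F = {Q. ideal_in Q C \<and> J \<subseteq> Q \<and> Q \<inter> M = {}}"
  have "\<exists>Q\<in>F. \<forall>Q'\<in>F. Q \<subseteq> Q' \<longrightarrow> Q' = Q"
  proof (rule subset_Zorn_nonempty)
    show "F \<noteq> {}" using J M(3) unfolding F_def by blast
    fix K assume K: "K \<noteq> {}" "subset.chain F K"
    have KF: "k \<in> F" if "k \<in> K" for k using K(2) that unfolding subset.chain_def by blast
    have tot: "k \<subseteq> k' \<or> k' \<subseteq> k" if "k \<in> K" "k' \<in> K" for k k' using subset.chain_total[OF K(2) that] by blast
    have "ideal_in (\<Union>K) C" unfolding ideal_in_def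
    proof (intro conjI ballI)
      show "\<Union>K \<subseteq> C" "\<zero> \<in> \<Union>K" using KF K(1) unfolding F_def ideal_in_def by blast+
      fix b assume "b \<in> \<Union>K"
      then obtain k where k: "k \<in> K" "b \<in> k" by blast
      show "a \<otimes> b \<in> \<Union>K" if "a \<in> C" for a using KF[OF k(1)] k that unfolding F_def ideal_in_def by blast
      show "b \<oplus> a \<in> \<Union>K" if a: "a \<in> \<Union>K" for a
      proof -
        obtain k' where k': "k' \<in> K" "a \<in> k'" using a by blast
        then obtain m where "m \<in> K" "a \<in> m" "b \<in> m" using tot[OF k(1) k'(1)] k by blast
        moreover have "ideal_in m C" using KF[OF \<open>m \<in> K\<close>] unfolding F_def by blast
        ultimately have "b \<oplus> a \<in> m" unfolding ideal_in_def by blast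
        then show ?thesis using \<open>m \<in> K\<close> by blast
      qed
    qed
    then show "\<Union>K \<in> F" using KF K(1) unfolding F_def by blast
  qed
  then obtain Q where QF: "Q \<in> F" and mx: "\<And>Q'. Q' \<in> F \<Longrightarrow> Q \<subseteq> Q' \<Longrightarrow> Q' = Q" by metis
  from QF have Q: "ideal_in Q C" "J \<subseteq> Q" "Q \<inter> M = {}" unfolding F_def by simp_all
  have q: "Q \<subseteq> C" "\<zero> \<in> Q" "\<And>a b. a \<in> Q \<Longrightarrow> b \<in> Q \<Longrightarrow> a \<oplus> b \<in> Q" "\<And>a b. a \<in> C \<Longrightarrow> b \<in> Q \<Longrightarrow> a \<otimes> b \<in> Q"
    using Q(1) unfolding ideal_in_def by blast+
  have car: "x \<in> carrier R" if "x \<in> C" for x using that s(1) by blast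
  \<comment> \<open>Maximality in usable form: the ideal generated by \<open>Q\<close> and an
    element outside \<open>Q\<close> meets \<open>M\<close>. For two elements with product in
    \<open>Q\<close>, multiplying the two elements of \<open>M\<close> so found gives an element of
    \<open>Q \<inter> M\<close>.\<close>
  have meet: "\<exists>p\<in>Q. \<exists>c\<in>C. p \<oplus> a \<otimes> c \<in> M" if a: "a \<in> C" "a \<notin> Q" for a
  proof (rule ccontr)
    assume no: "\<not> ?thesis"
    let ?Q = "{p \<oplus> a \<otimes> c | p c. p \<in> Q \<and> c \<in> C}"
    have "ideal_in ?Q C" unfolding ideal_in_def
    proof (intro conjI ballI)
      show "?Q \<subseteq> C" using q(1) a s(6,7) by blast
      have "\<zero> = \<zero> \<oplus> a \<otimes> \<zero>" using car a by simp
      then show "\<zero> \<in> ?Q" using q(2) s(2) by blast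
      fix y assume "y \<in> ?Q"
      then obtain p c where y: "y = p \<oplus> a \<otimes> c" "p \<in> Q" "c \<in> C" by blast
      have pc: "p \<in> carrier R" "c \<in> carrier R" "a \<in> carrier R" using y q(1) car a by blast+
      show "x \<otimes> y \<in> ?Q" if x: "x \<in> C" for x
      proof -
        have "x \<otimes> y = x \<otimes> p \<oplus> a \<otimes> (x \<otimes> c)" unfolding y(1) using pc car[OF x] by algebra
        then show ?thesis using q(4)[OF x y(2)] s(6)[OF x y(3)] by blast
      qed
      show "y \<oplus> z \<in> ?Q" if "z \<in> ?Q" for z
      proof -
        obtain p' c' where z: "z = p' \<oplus> a \<otimes> c'" "p' \<in> Q" "c' \<in> C" using \<open>z \<in> ?Q\<close> by blast
        have pc': "p' \<in> carrier R" "c' \<in> carrier R" using z q(1) car by blast+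
        have "y \<oplus> z = (p \<oplus> p') \<oplus> a \<otimes> (c \<oplus> c')" unfolding y(1) z(1) using pc pc' by algebra
        then show ?thesis using q(3)[OF y(2) z(2)] s(7)[OF y(3) z(3)] by blast
      qed
    qed
    moreover have sub: "Q \<subseteq> ?Q"
    proof
      fix p assume p: "p \<in> Q"
      then have "p = p \<oplus> a \<otimes> \<zero>" using car a q(1) by auto
      then show "p \<in> ?Q" using p s(2) by blast
    qed
    moreover have "?Q \<inter> M = {}" using no by blast
    ultimately have "?Q = Q" using mx[of ?Q] Q(2) unfolding F_def by blast
    moreover have "a = \<zero> \<oplus> a \<otimes> \<one>" using car a by simp
    then have "a \<in> ?Q" using q(2) s(3) by blast
    ultimately show False using a by blast
  qed
  have "prime_in Q C" unfolding prime_in_def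
  proof (intro conjI ballI impI)
    show "Q \<subseteq> C" "\<zero> \<in> Q" using q by auto
    show "\<one> \<notin> Q" using M(1) Q(3) by blast
    show "\<And>a b. a \<in> Q \<Longrightarrow> b \<in> Q \<Longrightarrow> a \<oplus> b \<in> Q" "\<And>a b. a \<in> C \<Longrightarrow> b \<in> Q \<Longrightarrow> a \<otimes> b \<in> Q" using q by auto
    fix a b assume ab: "a \<in> C" "b \<in> C" "a \<otimes> b \<in> Q"
    show "a \<in> Q \<or> b \<in> Q"
    proof (rule ccontr)
      assume "\<not> ?thesis"
      then obtain p c p' c' where m: "p \<in> Q" "c \<in> C" "p \<oplus> a \<otimes> c \<in> M" "p' \<in> Q" "c' \<in> C" "p' \<oplus> b \<otimes> c' \<in> M"
        using meet[of a] meet[of b] ab(1,2) by blast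
      have cc: "p \<in> carrier R" "c \<in> carrier R" "p' \<in> carrier R" "c' \<in> carrier R" "a \<in> carrier R" "b \<in> carrier R"
        using m ab car q(1) by blast+
      have e: "(p \<oplus> a \<otimes> c) \<otimes> (p' \<oplus> b \<otimes> c') = (p' \<oplus> b \<otimes> c') \<otimes> p \<oplus> ((a \<otimes> c) \<otimes> p' \<oplus> (c \<otimes> c') \<otimes> (a \<otimes> b))"
        using cc by algebra
      have i: "p' \<oplus> b \<otimes> c' \<in> C" "a \<otimes> c \<in> C" "c \<otimes> c' \<in> C"
        using s(7)[OF subsetD[OF q(1) m(4)] s(6)[OF ab(2) m(5)]] s(6)[OF ab(1) m(2)] s(6)[OF m(2) m(5)] .
      have "(p \<oplus> a \<otimes> c) \<otimes> (p' \<oplus> b \<otimes> c') \<in> Q" unfolding e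
        by (intro q(3) q(4) i m ab)
      then show False using M(2)[OF m(3,6)] Q(3) by blast
    qed
  qed
  then show ?thesis using Q by blast
qed

lemma cpoly_zero: "f \<in> cpoly {\<zero>} \<longleftrightarrow> f = \<zero>\<^bsub>P\<^esub>"
proof
  assume "f \<in> cpoly {\<zero>}"
  then have "f \<in> carrier P" "\<And>n. cf f n = \<zero>" using cpolyD by blast+
  then show "f = \<zero>\<^bsub>P\<^esub>" by (intro up_eqI) auto
qed (auto simp: cpoly_def)

text \<open>If the ideal generated by \<open>p\<close> and \<open>g(z)\<close> met \<open>B - p\<close>, then, \<open>F\<close> being a minimal relation, a constant
  outside \<open>p\<close> would be a multiple of \<open>g\<close> modulo \<open>p\<close>, which is impossible by degree.\<close>

lemma prime_over_with_root:
  assumes B: "subring B R" and p: "prime_in p B" and z: "z \<in> carrier R"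
    and F: "F \<in> cpoly B" "\<And>n. n > D \<Longrightarrow> cf F n = \<zero>" "cf F D \<notin> p" "ev z F = \<zero>"
    and min: "\<And>f. f \<in> cpoly B \<Longrightarrow> (\<And>n. n \<ge> D \<Longrightarrow> cf f n = \<zero>) \<Longrightarrow> ev z f = \<zero> \<Longrightarrow> f \<in> cpoly {\<zero>}"
    and g: "g \<in> cpoly B" "\<And>n. n > e \<Longrightarrow> cf g n = \<zero>" "1 \<le> e" "cf g e \<notin> p"
    and v: "v \<in> cpoly B" "c \<in> B" "c \<notin> p" "mon c 0 *\<^sub>P F -\<^sub>P g *\<^sub>P v \<in> cpoly p"
  shows "\<exists>Q. prime_in Q (adj B z) \<and> Q \<inter> B = p \<and> ev z g \<in> Q"
proof -
  note s = subringE[OF B] note y = prime_inD[OF p]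
  note sp = subringE[OF cpoly_subring[OF B]]
  note A = adj_subring[OF B z]
  have pB: "cpoly p \<subseteq> cpoly B" using cpoly_mono y(1) by blast
  have cP: "f \<in> carrier P" if "f \<in> cpoly B" for f using cpolyD[OF that] by blast
  \<comment> \<open>The ideal generated by \<open>p\<close> and the value of \<open>g\<close>,
    presented by polynomials so that the computation can take place before evaluation.\<close>
  define J where "J = {ev z (u +\<^sub>P g *\<^sub>P h) | u h. u \<in> cpoly p \<and> h \<in> cpoly B}"
  have J: "ideal_in J (adj B z)" unfolding ideal_in_def
  proof (intro conjI ballI)
    show "J \<subseteq> adj B z"
    proof
      fix x assume "x \<in> J"
      then obtain u h where x: "x = ev z (u +\<^sub>P g *\<^sub>P h)" "u \<in> cpoly p" "h \<in> cpoly B" unfolding J_def by blast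
      have "u +\<^sub>P g *\<^sub>P h \<in> cpoly B" using sp(7)[OF subsetD[OF pB x(2)] sp(6)[OF g(1) x(3)]] .
      then show "x \<in> adj B z" unfolding adj_def x(1) by (rule imageI)
    qed
    have "\<zero>\<^bsub>P\<^esub> \<in> cpoly p" using y(2) unfolding cpoly_def by auto
    moreover have "ev z (\<zero>\<^bsub>P\<^esub> +\<^sub>P g *\<^sub>P \<zero>\<^bsub>P\<^esub>) = \<zero>"
    proof -
      interpret E: ring_hom_cring P R "ev z" using ev_hom[OF z] .
      show ?thesis using cP[OF g(1)] by simp
    qed
    ultimately show "\<zero> \<in> J" unfolding J_def using sp(2) by force
    fix b assume "b \<in> J"
    then obtain u h where b: "b = ev z (u +\<^sub>P g *\<^sub>P h)" "u \<in> cpoly p" "h \<in> cpoly B" unfolding J_def by blast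
    have c1: "u \<in> carrier P" "h \<in> carrier P" "g \<in> carrier P" using b pB cP g(1) by blast+
    show "a \<otimes> b \<in> J" if "a \<in> adj B z" for a
    proof -
      obtain f where f: "f \<in> cpoly B" "a = ev z f" using \<open>a \<in> adj B z\<close> unfolding adj_def by blast
      have fP: "f \<in> carrier P" using cP f by blast
      have "a \<otimes> b = ev z (f *\<^sub>P (u +\<^sub>P g *\<^sub>P h))" unfolding f(2) b(1) using ev_simps(2)[OF z fP] c1 by simp
      also have "f *\<^sub>P (u +\<^sub>P g *\<^sub>P h) = f *\<^sub>P u +\<^sub>P g *\<^sub>P (f *\<^sub>P h)" using fP c1 by algebra
      finally have e: "a \<otimes> b = ev z (f *\<^sub>P u +\<^sub>P g *\<^sub>P (f *\<^sub>P h))" .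
      show ?thesis unfolding J_def using e cpoly_mult_ideal[OF p B f(1) b(2)] sp(6)[OF f(1) b(3)] by blast
    qed
    show "b \<oplus> a \<in> J" if "a \<in> J" for a
    proof -
      obtain u' h' where a: "a = ev z (u' +\<^sub>P g *\<^sub>P h')" "u' \<in> cpoly p" "h' \<in> cpoly B" using \<open>a \<in> J\<close> unfolding J_def by blast
      have c2: "u' \<in> carrier P" "h' \<in> carrier P" using a pB cP by blast+
      have "b \<oplus> a = ev z ((u +\<^sub>P g *\<^sub>P h) +\<^sub>P (u' +\<^sub>P g *\<^sub>P h'))"
        unfolding a(1) b(1) using ev_simps(1)[OF z] c1 c2 by simp
      also have "(u +\<^sub>P g *\<^sub>P h) +\<^sub>P (u' +\<^sub>P g *\<^sub>P h') = (u +\<^sub>P u') +\<^sub>P g *\<^sub>P (h +\<^sub>P h')" using c1 c2 by algebra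
      finally have e: "b \<oplus> a = ev z ((u +\<^sub>P u') +\<^sub>P g *\<^sub>P (h +\<^sub>P h'))" .
      have "u +\<^sub>P u' \<in> cpoly p" "h +\<^sub>P h' \<in> cpoly B" using cpoly_add[OF b(2) a(2) y(4)] sp(7)[OF b(3) a(3)] by simp_all
      then show ?thesis unfolding J_def using e by blast
    qed
  qed
  have disj: "J \<inter> (B - p) = {}"
  proof (rule ccontr)
    assume "\<not> ?thesis"
    then obtain m where m: "m \<in> J" "m \<in> B" "m \<notin> p" by blast
    obtain u h where uh: "m = ev z (u +\<^sub>P g *\<^sub>P h)" "u \<in> cpoly p" "h \<in> cpoly B" using m(1) unfolding J_def by blast
    have uB: "u \<in> cpoly B" using uh(2) pB by blast
    have mc: "m \<in> carrier R" "c \<in> carrier R" using m(2) v(2) s(1) by blast+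
    have mm: "mon b 0 \<in> cpoly B" if "b \<in> B" for b using cpoly_monom[OF that s(2,1)] .
    \<comment> \<open>This polynomial vanishes at \<open>z\<close>, so by minimality of
      \<open>F\<close> its pseudo-division by \<open>F\<close> has remainder zero; since
      \<open>c\<close> times \<open>F\<close> is a multiple of \<open>g\<close> modulo
      \<open>p\<close>, so is a constant multiple of \<open>?f\<close>.\<close>
    let ?f = "mon m 0 -\<^sub>P (u +\<^sub>P g *\<^sub>P h)"
    have fB: "?f \<in> cpoly B" unfolding a_minus_def
      by (intro sp(7) sp(5) sp(6) mm m uB uh g(1))
    have ugh: "u +\<^sub>P g *\<^sub>P h \<in> carrier P" using cP uB uh g by simp
    have f0: "ev z ?f = \<zero>"
      using ev_simps(3)[OF z cP[OF mm[OF m(2)]] ugh] ev_const[OF z mc(1)] uh(1) mc(1) by (simp add: a_minus_def R.r_neg)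
    let ?c = "cf F D"
    obtain k w r where kh: "w \<in> cpoly B" "r \<in> cpoly B" "\<forall>n\<ge>D. cf r n = \<zero>"
      "mon (?c [^] (k::nat)) 0 *\<^sub>P ?f = F *\<^sub>P w +\<^sub>P r"
      using pseudo_division[OF B F(1,2) fB] by blast
    have ck: "?c [^] k \<in> B" "?c [^] k \<notin> p" using prime_in_pow[OF p B cpolyD(2)[OF F(1)] F(3)] by blast+
    have ckc: "?c [^] k \<in> carrier R" using ck s(1) by blast
    have "ev z (mon (?c [^] k) 0 *\<^sub>P ?f) = ev z (F *\<^sub>P w +\<^sub>P r)" using kh(4) by simp
    then have "ev z r = \<zero>"
      using ev_simps[OF z] cP kh(1,2) F(1) mm[OF ck(1)] fB f0 F(4) ev_closed[OF z] by simp
    then have "r \<in> cpoly {\<zero>}" using min[OF kh(2)] kh(3) by blast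
    then have r0: "r = \<zero>\<^bsub>P\<^esub>" using cpoly_zero by blast
    let ?K = "mon (?c [^] k) 0" let ?M = "mon m 0" let ?C = "mon c 0"
    let ?W = "?C *\<^sub>P ?K *\<^sub>P h +\<^sub>P v *\<^sub>P w"
    have KB: "?K \<in> cpoly B" "?M \<in> cpoly B" "?C \<in> cpoly B" using mm ck m v by blast+
    have WB: "?W \<in> cpoly B" by (intro sp(7) sp(6) KB uh v kh(1))
    define b where "b = c \<otimes> ?c [^] k \<otimes> m"
    have b: "b \<in> B" "b \<notin> p" unfolding b_def
    proof -
      have "c \<otimes> ?c [^] k \<in> B" "c \<otimes> ?c [^] k \<notin> p" using s(6) v(2,3) ck y(6) by blast+
      then show "c \<otimes> ?c [^] k \<otimes> m \<in> B" "c \<otimes> ?c [^] k \<otimes> m \<notin> p" using s(6) m y(6) by blast+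
    qed
    have bm: "mon b 0 = ?C *\<^sub>P ?K *\<^sub>P ?M" unfolding b_def
      using monom_mult[of c "?c [^] k" 0 0] monom_mult[of "c \<otimes> ?c [^] k" m 0 0] mc ckc by simp
    \<comment> \<open>A formal identity isolating three terms: one with the factor \<open>u\<close>
      in \<open>cpoly p\<close>, one with the factor in \<open>cpoly p\<close> supplied by
      \<open>v\<close>, and one that vanishes by the exact division.\<close>
    have id: "C *\<^sub>P K *\<^sub>P M -\<^sub>P G *\<^sub>P (C *\<^sub>P K *\<^sub>P H +\<^sub>P V *\<^sub>P W)
       = C *\<^sub>P (K *\<^sub>P U) +\<^sub>P W *\<^sub>P (C *\<^sub>P F -\<^sub>P G *\<^sub>P V)
         +\<^sub>P C *\<^sub>P (K *\<^sub>P (M -\<^sub>P (U +\<^sub>P G *\<^sub>P H)) -\<^sub>P F *\<^sub>P W)"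
      if "C \<in> carrier P" "K \<in> carrier P" "M \<in> carrier P" "G \<in> carrier P" "H \<in> carrier P" "V \<in> carrier P" "W \<in> carrier P" "U \<in> carrier P" "F \<in> carrier P"
      for C K M G H V W U F using that by algebra
    have E0: "?K *\<^sub>P ?f -\<^sub>P F *\<^sub>P w = \<zero>\<^bsub>P\<^esub>"
      unfolding kh(4) r0 using cP F(1) kh(1) by (simp add: a_minus_def P.r_neg)
    have "mon b 0 -\<^sub>P g *\<^sub>P ?W = ?C *\<^sub>P (?K *\<^sub>P u) +\<^sub>P w *\<^sub>P (?C *\<^sub>P F -\<^sub>P g *\<^sub>P v)"
      unfolding bm id[OF cP[OF KB(3)] cP[OF KB(1)] cP[OF KB(2)] cP[OF g(1)] cP[OF uh(3)] cP[OF v(1)] cP[OF kh(1)] cP[OF uB] cP[OF F(1)]] E0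
      using cP KB g(1) v(1) kh(1) uB F(1) by simp
    also have "\<dots> \<in> cpoly p"
      by (intro cpoly_add[OF _ _ y(4)] cpoly_mult_ideal[OF p B] KB uh(2) kh(1) v(4))
    finally have dp: "mon b 0 -\<^sub>P g *\<^sub>P ?W \<in> cpoly p" .
    have bc: "b \<in> carrier R" using b s(1) by blast
    have gW: "g *\<^sub>P ?W \<in> carrier P" using cP[OF sp(6)[OF g(1) WB]] .
    have dcf: "cf (mon b 0 -\<^sub>P g *\<^sub>P ?W) n = (if n = 0 then b else \<zero>) \<ominus> cf (g *\<^sub>P ?W) n" for n
      using coeff_minus[OF monom_closed[OF bc] gW] bc by simp
    have gWB: "cf (g *\<^sub>P ?W) n \<in> B" for n using cpolyD(2)[OF sp(6)[OF g(1) WB]] .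
    show False
    proof (cases "?W \<in> cpoly p")
      case True
      then have "g *\<^sub>P ?W \<in> cpoly p" using cpoly_mult_ideal[OF p B g(1)] by blast
      then have "cf (g *\<^sub>P ?W) 0 \<in> p" using cpolyD by blast
      moreover have "b \<ominus> cf (g *\<^sub>P ?W) 0 \<in> p" using cpolyD(2)[OF dp, of 0] unfolding dcf by simp
      ultimately show False using prime_in_cancel[OF p B _ b(1) gWB] b(2) by blast
    next
      case False
      then obtain a where a: "cf ?W a \<notin> p" "\<forall>n>a. cf ?W n \<in> p"
        using last_coefficient_exists[OF cP[OF WB] y(2)] by blast
      have "cf (g *\<^sub>P ?W) (e + a) \<notin> p"
        by (rule last_coefficient_mult[OF p B g(1) WB g(4) _ a(1)]) (use g(2) y(2) a(2) in auto)
      moreover have "\<zero> \<ominus> cf (g *\<^sub>P ?W) (e + a) \<in> p" using cpolyD(2)[OF dp, of "e + a"] g(3) unfolding dcf by simp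
      ultimately show False using prime_in_cancel[OF p B _ s(2) gWB] y(2) by blast
    qed
  qed
  have "\<exists>Q. prime_in Q (adj B z) \<and> J \<subseteq> Q \<and> Q \<inter> (B - p) = {}"
  proof (rule prime_avoiding_exists[OF A J _ _ disj])
    show "\<one> \<in> B - p" using s y by blast
    show "a \<otimes> b \<in> B - p" if "a \<in> B - p" "b \<in> B - p" for a b using that s(6) y(6) by blast
  qed
  then obtain Q where Q: "prime_in Q (adj B z)" "J \<subseteq> Q" "Q \<inter> (B - p) = {}" by blast
  have "p \<subseteq> J"
  proof
    fix a assume a: "a \<in> p"
    have ac: "a \<in> carrier R" using a y(1) s(1) by blast
    have "mon a 0 \<in> cpoly p" using cpoly_monom[OF a y(2)] y(1) s(1) by blast
    moreover have "ev z (mon a 0 +\<^sub>P g *\<^sub>P \<zero>\<^bsub>P\<^esub>) = a" using ev_const[OF z ac] cP g(1) ac by simp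
    ultimately show "a \<in> J" unfolding J_def using sp(2) by force
  qed
  moreover have "ev z g \<in> J"
  proof -
    have "\<zero>\<^bsub>P\<^esub> \<in> cpoly p" using y(2) unfolding cpoly_def by auto
    moreover have "\<zero>\<^bsub>P\<^esub> +\<^sub>P g *\<^sub>P \<one>\<^bsub>P\<^esub> = g" using cP g(1) by simp
    ultimately show ?thesis unfolding J_def using sp(3) by force
  qed
  ultimately have "Q \<inter> B = p" "ev z g \<in> Q" using Q y(1) by blast+
  then show ?thesis using Q by blast
qed

text \<open>Minimality is by degree over the domain \<open>B\<close> itself, without passing to
  fractions. \<open>F\<close> need not be monic, so the primes at which its leading coefficient
  vanishes have to be avoided.\<close>

definition minrel :: "'a set \<Rightarrow> 'a \<Rightarrow> (nat \<Rightarrow> 'a) \<Rightarrow> nat \<Rightarrow> bool" where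
  "minrel B z F D \<longleftrightarrow> F \<in> cpoly B \<and> (\<forall>n>D. cf F n = \<zero>) \<and> cf F D \<noteq> \<zero> \<and> ev z F = \<zero> \<and> 1 \<le> D \<and>
     (\<forall>f\<in>cpoly B. (\<forall>n\<ge>D. cf f n = \<zero>) \<and> ev z f = \<zero> \<longrightarrow> f \<in> cpoly {\<zero>})"

lemma minrel_exists:
  assumes B: "subring B R" and z: "z \<in> carrier R" and al: "alg {\<zero>} B z"
  shows "\<exists>F D. minrel B z F D"
  using min_poly[OF zero_prime[OF R.carrier_is_subring] R.carrier_is_subring B subringE(1)[OF B] z al]
  unfolding minrel_def by simp

text \<open>The case \<open>g = F\<close> of \<open>prime_over_with_root\<close>, with trivial
  cofactors: the value of \<open>F\<close> is zero, so only the condition on the contraction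
  remains.\<close>

lemma lying_over:
  assumes B: "subring B R" and p: "prime_in p B" and z: "z \<in> carrier R"
    and m: "minrel B z F D" and F: "cf F D \<notin> p"
  shows "\<exists>Q. prime_in Q (adj B z) \<and> Q \<inter> B = p"
proof -
  have f: "F \<in> cpoly B" "\<And>n. n > D \<Longrightarrow> cf F n = \<zero>" "ev z F = \<zero>" "1 \<le> D"
    "\<And>f. f \<in> cpoly B \<Longrightarrow> (\<And>n. n \<ge> D \<Longrightarrow> cf f n = \<zero>) \<Longrightarrow> ev z f = \<zero> \<Longrightarrow> f \<in> cpoly {\<zero>}"
    using m unfolding minrel_def by auto
  have "mon \<one> 0 *\<^sub>P F -\<^sub>P F *\<^sub>P \<one>\<^bsub>P\<^esub> = \<zero>\<^bsub>P\<^esub>"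
    using cpolyD(1)[OF f(1)] by (simp add: a_minus_def P.r_neg)
  moreover have "\<zero>\<^bsub>P\<^esub> \<in> cpoly p" using prime_inD(2)[OF p] unfolding cpoly_def by auto
  ultimately have v: "mon \<one> 0 *\<^sub>P F -\<^sub>P F *\<^sub>P \<one>\<^bsub>P\<^esub> \<in> cpoly p" by simp
  show ?thesis
    using prime_over_with_root[OF B p z f(1,2) F f(3,5) f(1,2,4) F subringE(3)[OF cpoly_subring[OF B]] subringE(3)[OF B] prime_inD(3)[OF p] v]
    by blast
qed

text \<open>Geometrically, the two primes define a point of the fibre product over \<open>B\<^sub>0\<close>; the minimal
  relation being defined over \<open>B\<^sub>0\<close> guarantees that \<open>B[z]\<close> is generically this fibre product.\<close>

lemma amalgamate:
  assumes B: "subring B R" and B0: "subring B0 R" "B0 \<subseteq> B" and z: "z \<in> carrier R"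
    and p: "prime_in p B" and p0: "prime_in p0 (adj B0 z)" and eq: "p0 \<inter> B0 = p \<inter> B0"
    and m: "minrel B z F D" and F: "F \<in> cpoly B0" "cf F D \<notin> p"
  shows "\<exists>Q. prime_in Q (adj B z) \<and> Q \<inter> B = p \<and> Q \<inter> adj B0 z = p0"
proof -
  have f: "F \<in> cpoly B" "\<And>n. n > D \<Longrightarrow> cf F n = \<zero>" "ev z F = \<zero>" "1 \<le> D"
    "\<And>f. f \<in> cpoly B \<Longrightarrow> (\<And>n. n \<ge> D \<Longrightarrow> cf f n = \<zero>) \<Longrightarrow> ev z f = \<zero> \<Longrightarrow> f \<in> cpoly {\<zero>}"
    using m unfolding minrel_def by auto
  note s0 = subringE[OF B0(1)] and s = subringE[OF B] and y = prime_inD[OF p] and y0 = prime_inD[OF p0]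
  note A = adj_subring[OF B z] and A0 = adj_subring[OF B0(1) z]
  note sA = subringE[OF A] and sA0 = subringE[OF A0]
  have inc0: "B0 \<subseteq> adj B0 z" "z \<in> adj B0 z" using adj_incl[OF B0(1) z] by auto
  have inc: "B \<subseteq> adj B z" "z \<in> adj B z" using adj_incl[OF B z] by auto
  have A0A: "adj B0 z \<subseteq> adj B z" by (rule adj_mono[OF B0(2)])
  have FD: "cf F D \<in> B0" "cf F D \<notin> p0" using cpolyD(2)[OF F(1)] F(2) eq by blast+
  have ev0: "ev z F \<in> p0" using f(3) y0(2) by simp
  have fm: "finmod p0 B0 (adj B0 z) (cf F D) {..<D}"
    by (rule finmod_simple[OF p0 A0 B0(1) inc0 F(1) f(2) FD(2) ev0])
  have al: "alg p0 B0 t" if "t \<in> adj B0 z" for t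
    by (rule finmod_alg[OF p0 A0 B0(1) inc0(1) subset_refl A0 fm that])
  \<comment> \<open>The minimal relation of \<open>z\<close> over \<open>B0\<close> modulo
    \<open>p0\<close>. A prime over \<open>p\<close> containing its value will be shown to contain
    all of \<open>p0\<close>.\<close>
  obtain g e where g: "g \<in> cpoly B0" "\<forall>n>e. cf g n = \<zero>" "cf g e \<notin> p0" "ev z g \<in> p0" "1 \<le> e"
     "\<forall>f\<in>cpoly B0. (\<forall>n\<ge>e. cf f n = \<zero>) \<and> ev z f \<in> p0 \<longrightarrow> f \<in> cpoly p0"
    using min_poly[OF p0 A0 B0(1) inc0 al[OF inc0(2)]] by blast
  let ?c = "cf g e"
  have c: "?c \<in> B0" using cpolyD(2)[OF g(1)] .
  have ck: "?c [^] k \<in> B0" "?c [^] k \<notin> p" "?c [^] k \<in> carrier R" for k :: nat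
  proof -
    show b: "?c [^] k \<in> B0" using subring_pow[OF B0(1) c] .
    have "?c [^] k \<notin> p0" using prime_in_pow(2)[OF p0 A0 _ g(3)] c inc0(1) by blast
    then show "?c [^] k \<notin> p" using b eq by blast
    show "?c [^] k \<in> carrier R" using b s0(1) by blast
  qed
  have cong: "f' \<in> cpoly p" if "f' \<in> cpoly B0" "f' \<in> cpoly p0" for f'
    using that eq unfolding cpoly_def by blast
  \<comment> \<open>As \<open>F\<close> has coefficients in \<open>B0\<close>, it can be divided
    there by \<open>g\<close>. The remainder has degree below \<open>e\<close> and value in
    \<open>p0\<close>, so its coefficients lie in \<open>p0\<close>, hence in \<open>p\<close>:
    modulo \<open>p\<close>, a power of \<open>?c\<close> times \<open>F\<close> is a multiple of
    \<open>g\<close>.\<close>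
  obtain k v r where kv: "v \<in> cpoly B0" "r \<in> cpoly B0" "\<forall>n\<ge>e. cf r n = \<zero>"
      "mon (?c [^] (k::nat)) 0 *\<^sub>P F = g *\<^sub>P v +\<^sub>P r"
    using pseudo_division[OF B0(1) g(1) _ F(1)] g(2) by blast
  have cP: "F \<in> carrier P" "g \<in> carrier P" "v \<in> carrier P" "r \<in> carrier P" using F(1) g(1) kv cpolyD by blast+
  have "ev z (mon (?c [^] k) 0 *\<^sub>P F) = ev z (g *\<^sub>P v +\<^sub>P r)" using kv(4) by simp
  then have "ev z g \<otimes> ev z v \<oplus> ev z r = \<zero>"
    using ev_simps[OF z] cP f(3) ck(3)[of k] ev_closed[OF z] by simp
  moreover have evA: "ev z v \<in> adj B0 z" "ev z r \<in> adj B0 z" "ev z g \<in> adj B0 z" using kv(1,2) g(1) unfolding adj_def by auto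
  moreover have "ev z v \<otimes> ev z g \<in> p0" using y0(5)[OF evA(1) g(4)] .
  moreover have cc: "ev z v \<in> carrier R" "ev z r \<in> carrier R" "ev z g \<in> carrier R" using evA sA0(1) by blast+
  ultimately have "ev z r = \<ominus> (ev z v \<otimes> ev z g)" by (metis R.add.m_comm R.m_comm R.m_closed R.minus_equality)
  then have "ev z r \<in> p0" using prime_in_neg[OF p0 A0 \<open>ev z v \<otimes> ev z g \<in> p0\<close>] by simp
  then have "r \<in> cpoly p" using cong[OF kv(2)] g(6) kv(2,3) by blast
  moreover have "mon (?c [^] k) 0 *\<^sub>P F -\<^sub>P g *\<^sub>P v = r"
  proof -
    have "(x +\<^sub>P r) -\<^sub>P x = r" if "x \<in> carrier P" for x using that cP by algebra
    then show ?thesis unfolding kv(4) using cP by simp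
  qed
  ultimately have v: "mon (?c [^] k) 0 *\<^sub>P F -\<^sub>P g *\<^sub>P v \<in> cpoly p" by simp
  have up: "cpoly B0 \<subseteq> cpoly B" using cpoly_mono[OF B0(2)] .
  have gp: "cf g e \<notin> p" using g(3) c eq by blast
  have g2: "\<And>n. n > e \<Longrightarrow> cf g n = \<zero>" using g(2) by blast
  obtain Q where Q: "prime_in Q (adj B z)" "Q \<inter> B = p" "ev z g \<in> Q"
    using prime_over_with_root[OF B p z f(1,2) F(2) f(3,5) subsetD[OF up g(1)] g2 g(5) gp subsetD[OF up kv(1)] subsetD[OF B0(2) ck(1)] ck(2) v]
    by blast
  note q = prime_inD[OF Q(1)]
  \<comment> \<open>Dividing by \<open>g\<close> leaves a remainder with coefficients in
    \<open>p\<close>, so a power of \<open>?c\<close> times the given element lies in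
    \<open>Q\<close>; that power itself does not.\<close>
  have sub: "p0 \<subseteq> Q"
  proof
    fix t assume t: "t \<in> p0"
    then have "t \<in> adj B0 z" using y0(1) by blast
    then obtain f' where f': "f' \<in> cpoly B0" "t = ev z f'" unfolding adj_def by blast
    obtain j h r' where kh: "h \<in> cpoly B0" "r' \<in> cpoly B0" "\<forall>n\<ge>e. cf r' n = \<zero>"
      "?c [^] (j::nat) \<otimes> ev z f' = ev z g \<otimes> ev z h \<oplus> ev z r'"
      using ev_pseudo_division[OF B0(1) g(1) g2 f'(1) z] by blast
    have hA: "ev z h \<in> adj B0 z" "ev z r' \<in> adj B0 z" using kh unfolding adj_def by auto
    have hc: "ev z h \<in> carrier R" "ev z r' \<in> carrier R" "t \<in> carrier R" using hA sA0(1) t y0(1) by blast+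
    have gh: "ev z g \<otimes> ev z h \<in> p0" using y0(5)[OF hA(1) g(4)] R.m_comm[OF cc(3) hc(1)] by simp
    have "?c [^] j \<otimes> t \<in> p0" using y0(5) t ck(1) inc0(1) by blast
    moreover have "(x \<oplus> w) \<ominus> x = w" if "x \<in> carrier R" "w \<in> carrier R" for x w using that by algebra
    then have "ev z r' = ?c [^] j \<otimes> t \<ominus> ev z g \<otimes> ev z h" unfolding f'(2) kh(4) using hc cc by simp
    ultimately have "ev z r' \<in> p0" using prime_in_minus[OF p0 A0 _ gh] by simp
    then have "r' \<in> cpoly p" using cong[OF kh(2)] g(6) kh(2,3) by blast
    then have "r' \<in> cpoly Q" using cpoly_mono[of p Q] Q(2) by blast
    then have "ev z r' \<in> Q" using ev_prime[OF Q(1) A _ inc(2)] by blast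
    moreover have "ev z g \<otimes> ev z h \<in> Q" using q(5)[OF _ Q(3), of "ev z h"] hA(1) A0A R.m_comm[OF cc(3) hc(1)] by auto
    ultimately have "?c [^] j \<otimes> t \<in> Q" unfolding f'(2) kh(4) using q(4) by blast
    moreover have "?c [^] j \<in> adj B z" "?c [^] j \<notin> Q" using ck(1,2)[of j] B0(2) inc(1) Q(2) by blast+
    moreover have "t \<in> adj B z" using t y0(1) A0A by blast
    ultimately show "t \<in> Q" using q(6) by blast
  qed
  \<comment> \<open>Both primes have the same contraction to \<open>B0\<close>, over which
    everything is algebraic modulo \<open>p0\<close>.\<close>
  have "p0 = Q \<inter> adj B0 z"
  proof (rule incomparable[OF p0 prime_in_restrict[OF Q(1) A0 A0A] _ A0 B0(1) inc0(1)])
    show "p0 \<subseteq> Q \<inter> adj B0 z" using sub y0(1) by blast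
    have "Q \<inter> B0 = p \<inter> B0" using Q(2) B0(2) by blast
    then show "Q \<inter> adj B0 z \<inter> B0 \<subseteq> p0" using eq by blast
    show "\<And>t. t \<in> adj B0 z \<Longrightarrow> alg p0 B0 t" using al .
  qed
  then show ?thesis using Q by blast
qed

text \<open>When \<open>z\<close> is transcendental modulo \<open>Q\<close>, the value of a
  polynomial over \<open>B\<close> lies in \<open>Q\<close> only if all its coefficients do. Hence
  \<open>Q\<close> is determined by its contraction to \<open>B\<close>.\<close>

lemma generic_unique:
  assumes B: "subring B R" and z: "z \<in> carrier R" and Y: "prime_in Q (adj B z)" and na: "\<not> alg Q B z"
  shows "Q = ev z ` cpoly (Q \<inter> B)"
proof
  note A = adj_subring[OF B z]
  show "ev z ` cpoly (Q \<inter> B) \<subseteq> Q"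
    using ev_prime[OF Y A _ adj_incl(2)[OF B z]] cpoly_mono[of "Q \<inter> B" Q] by blast
  show "Q \<subseteq> ev z ` cpoly (Q \<inter> B)"
  proof
    fix t assume t: "t \<in> Q"
    then obtain f where f: "f \<in> cpoly B" "t = ev z f" using prime_inD(1)[OF Y] unfolding adj_def by blast
    then have "f \<in> cpoly Q" using na t unfolding alg_def by blast
    then have "f \<in> cpoly (Q \<inter> B)" using f(1) unfolding cpoly_def by blast
    then show "t \<in> ev z ` cpoly (Q \<inter> B)" using f by blast
  qed
qed

text \<open>Transcendence of \<open>z\<close> makes evaluation injective on polynomials over
  \<open>B\<close>, so the prime \<open>cpoly p\<close> of the polynomial ring can be carried over
  to \<open>adj B z\<close>.\<close>

lemma generic_extension:
  assumes B: "subring B R" and z: "z \<in> carrier R" and na: "\<not> alg {\<zero>} B z" and p: "prime_in p B"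
  shows "\<exists>Q. prime_in Q (adj B z) \<and> Q \<inter> B = p \<and> \<not> alg Q B z"
proof -
  note s = subringE[OF B] and y = prime_inD[OF p] and sp = subringE[OF cpoly_subring[OF B]]
  define Q where "Q = ev z ` cpoly p"
  have pB: "cpoly p \<subseteq> cpoly B" using cpoly_mono[OF y(1)] .
  have inj: "f = g" if "f \<in> cpoly B" "g \<in> cpoly B" "ev z f = ev z g" for f g
  proof -
    have c: "f \<in> carrier P" "g \<in> carrier P" using that cpolyD by blast+
    have "f -\<^sub>P g \<in> cpoly B" unfolding a_minus_def using sp(5,7) that by blast
    moreover have "ev z (f -\<^sub>P g) = \<zero>" using ev_simps(3)[OF z c] that(3) ev_closed[OF z c(2)] by (simp add: a_minus_def R.r_neg)
    ultimately have "f -\<^sub>P g \<in> cpoly {\<zero>}" using na unfolding alg_def by blast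
    then show ?thesis using cpoly_zero c by simp
  qed
  have iff: "ev z f \<in> Q \<longleftrightarrow> f \<in> cpoly p" if "f \<in> cpoly B" for f
    unfolding Q_def using inj[OF that] pB by blast
  have const: "ev z (mon b 0) = b" "mon b 0 \<in> cpoly B" if "b \<in> B" for b
    using ev_const[OF z] cpoly_monom[OF that s(2,1)] s(1) that by blast+
  have QB: "b \<in> Q \<longleftrightarrow> b \<in> p" if "b \<in> B" for b
  proof -
    have bc: "b \<in> carrier R" using that s(1) by blast
    have "mon b 0 \<in> cpoly p \<longleftrightarrow> b \<in> p"
    proof
      assume "mon b 0 \<in> cpoly p"
      from cpolyD(2)[OF this, of 0] show "b \<in> p" using bc by simp
    next
      assume "b \<in> p" then show "mon b 0 \<in> cpoly p" using cpoly_monom y(1,2) s(1) by blast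
    qed
    then show ?thesis using iff[OF const(2)[OF that]] const(1)[OF that] by simp
  qed
  have "prime_in Q (adj B z)" unfolding prime_in_def
  proof (intro conjI ballI impI)
    show "Q \<subseteq> adj B z" unfolding Q_def adj_def using pB by blast
    show "\<zero> \<in> Q" "\<one> \<notin> Q" using QB s(2,3) y(2,3) by blast+
    show "a \<oplus> b \<in> Q" if "a \<in> Q" "b \<in> Q" for a b
    proof -
      obtain f g where fg: "f \<in> cpoly p" "g \<in> cpoly p" "a = ev z f" "b = ev z g" using \<open>a \<in> Q\<close> \<open>b \<in> Q\<close> unfolding Q_def by blast
      then have "a \<oplus> b = ev z (f +\<^sub>P g)" using ev_simps(1)[OF z] cpolyD(1) by metis
      then show ?thesis unfolding Q_def using cpoly_add[OF fg(1,2) y(4)] by blast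
    qed
    show "a \<otimes> b \<in> Q" if "a \<in> adj B z" "b \<in> Q" for a b
    proof -
      obtain f g where fg: "f \<in> cpoly B" "g \<in> cpoly p" "a = ev z f" "b = ev z g" using \<open>a \<in> adj B z\<close> \<open>b \<in> Q\<close> unfolding Q_def adj_def by blast
      then have "a \<otimes> b = ev z (f *\<^sub>P g)" using ev_simps(2)[OF z] cpolyD(1) by metis
      then show ?thesis unfolding Q_def using cpoly_mult_ideal[OF p B fg(1,2)] by blast
    qed
    show "a \<in> Q \<or> b \<in> Q" if "a \<in> adj B z" "b \<in> adj B z" "a \<otimes> b \<in> Q" for a b
    proof -
      obtain f g where fg: "f \<in> cpoly B" "g \<in> cpoly B" "a = ev z f" "b = ev z g" using \<open>a \<in> adj B z\<close> \<open>b \<in> adj B z\<close> unfolding adj_def by blast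
      then have "a \<otimes> b = ev z (f *\<^sub>P g)" using ev_simps(2)[OF z] cpolyD(1) by metis
      then have "f *\<^sub>P g \<in> cpoly p" using iff[OF sp(6)[OF fg(1,2)]] that(3) by simp
      then show ?thesis using cpoly_prime[OF p B fg(1,2)] iff fg by blast
    qed
  qed
  moreover have "Q \<inter> B = p" using QB y(1) by blast
  moreover have "\<not> alg Q B z"
  proof
    assume "alg Q B z"
    then obtain f where f: "f \<in> cpoly B" "f \<notin> cpoly Q" "ev z f \<in> Q" unfolding alg_def by blast
    then have "f \<in> cpoly p" using iff by blast
    then show False using f(2) cpoly_mono[of p Q] \<open>Q \<inter> B = p\<close> by blast
  qed
  ultimately show ?thesis by blast
qed

section \<open>Comparison of \<open>prime_in\<close> with \<open>primeideal\<close>\<close>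

lemma prime_in_iff:
  assumes B: "subring B R"
  shows "primeideal q (R\<lparr>carrier := B\<rparr>) \<longleftrightarrow> prime_in q B"
proof
  note s = subringE[OF B]
  interpret B: cring "R\<lparr>carrier := B\<rparr>"
    using R.subcringI'[OF B] R.subcring_iff[OF s(1)] by simp
  show "prime_in q B" if "primeideal q (R\<lparr>carrier := B\<rparr>)"
  proof -
    interpret q: primeideal q "R\<lparr>carrier := B\<rparr>" by fact
    have qB: "q \<subseteq> B" using q.a_subset by simp
    have "\<one> \<notin> q"
    proof
      assume "\<one> \<in> q"
      then have "q = B" using q.I_l_closed[of \<one>] qB subringE(1)[OF B] by force
      then show False using q.I_notcarr by simp
    qed
    then show ?thesis unfolding prime_in_def
      using qB q.zero_closed q.a_closed q.I_l_closed q.I_prime by simp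
  qed
  show "primeideal q (R\<lparr>carrier := B\<rparr>)" if q: "prime_in q B"
  proof -
    note y = prime_inD[OF q]
    have m: "\<ominus>\<^bsub>R\<lparr>carrier := B\<rparr>\<^esub> x \<in> q" if x: "x \<in> q" for x
    proof -
      have xB: "x \<in> B" using x y(1) by blast
      have "\<ominus>\<^bsub>R\<lparr>carrier := B\<rparr>\<^esub> \<one> \<in> B" using B.a_inv_closed[OF B.one_closed] by simp
      then have "(\<ominus>\<^bsub>R\<lparr>carrier := B\<rparr>\<^esub> \<one>) \<otimes> x \<in> q" using y(5) x by blast
      then show ?thesis using B.l_minus[of \<one> x] xB s(1,3) by (simp add: subset_iff)
    qed
    have "subgroup q (add_monoid (R\<lparr>carrier := B\<rparr>))"
      using y m unfolding a_inv_def by (intro subgroup.intro) auto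
    moreover have "b \<otimes> a \<in> q" if "a \<in> q" "b \<in> B" for a b
      using y(5)[OF that(2,1)] .
    moreover have "a \<otimes> b \<in> q" if "a \<in> q" "b \<in> B" for a b
    proof -
      have "a \<in> carrier R" "b \<in> carrier R" using that y(1) s(1) by blast+
      then show ?thesis using y(5)[OF that(2,1)] R.m_comm by simp
    qed
    ultimately have "ideal q (R\<lparr>carrier := B\<rparr>)" by (intro idealI B.ring_axioms) auto
    then show ?thesis
    proof (rule primeidealI[OF _ B.cring_axioms])
      show "carrier (R\<lparr>carrier := B\<rparr>) \<noteq> q" using y(3) s(3) by auto
    qed (use y(6) in auto)
  qed
qed

end

section \<open>Towers of prolongations\<close>

locale sigma_domain = UP_domain +
  fixes \<sigma> :: "'a \<Rightarrow> 'a"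
  assumes sigma_hom: "\<sigma> \<in> ring_hom R R" and sigma_inj: "inj_on \<sigma> (carrier R)"
begin

lemma sigma_simps:
  "\<sigma> \<zero> = \<zero>" "\<sigma> \<one> = \<one>" "a \<in> carrier R \<Longrightarrow> \<sigma> a \<in> carrier R"
  "a \<in> carrier R \<Longrightarrow> b \<in> carrier R \<Longrightarrow> \<sigma> (a \<oplus> b) = \<sigma> a \<oplus> \<sigma> b"
  "a \<in> carrier R \<Longrightarrow> b \<in> carrier R \<Longrightarrow> \<sigma> (a \<otimes> b) = \<sigma> a \<otimes> \<sigma> b"
proof -
  interpret H: ring_hom_cring R R \<sigma> by unfold_locales (rule sigma_hom)
  show "\<sigma> \<zero> = \<zero>" "\<sigma> \<one> = \<one>" "a \<in> carrier R \<Longrightarrow> \<sigma> a \<in> carrier R"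
  "a \<in> carrier R \<Longrightarrow> b \<in> carrier R \<Longrightarrow> \<sigma> (a \<oplus> b) = \<sigma> a \<oplus> \<sigma> b"
  "a \<in> carrier R \<Longrightarrow> b \<in> carrier R \<Longrightarrow> \<sigma> (a \<otimes> b) = \<sigma> a \<otimes> \<sigma> b" by auto
qed

lemma sigma_zero_iff: "a \<in> carrier R \<Longrightarrow> \<sigma> a = \<zero> \<longleftrightarrow> a = \<zero>"
  using inj_onD[OF sigma_inj, of a \<zero>] sigma_simps(1) by auto

lemma sigma_subring:
  assumes "subring B R"
  shows "subring (\<sigma> ` B) R"
proof -
  interpret H: ring_hom_cring R R \<sigma> by unfold_locales (rule sigma_hom)
  show ?thesis by (rule H.ring.img_is_subring[OF assms])
qed

lemma sigma_poly:
  assumes B: "subring B R" and f: "f \<in> cpoly B" and z: "z \<in> carrier R"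
  shows "\<exists>f'\<in>cpoly (\<sigma> ` B). (\<forall>n. cf f' n = \<sigma> (cf f n)) \<and> ev (\<sigma> z) f' = \<sigma> (ev z f)"
proof -
  interpret H: ring_hom_cring R R \<sigma> by unfold_locales (rule sigma_hom)
  have fP: "f \<in> carrier P" using f cpolyD by blast
  obtain k where k: "\<forall>n>k. cf f n = \<zero>" using poly_bound[OF fP] by blast
  define f' where "f' = (\<lambda>n. \<sigma> (cf f n))"
  have f': "f' \<in> carrier P" "cf f' n = f' n" for n
    by (rule poly_fun[of f' k]; use fP k in \<open>simp add: f'_def\<close>)+
  have "f' \<in> cpoly (\<sigma> ` B)" unfolding cpoly_def using f' cpolyD(2)[OF f] by (auto simp: f'_def)
  moreover have "ev (\<sigma> z) f' = (\<Oplus>i\<in>{..<Suc k}. cf f' i \<otimes> \<sigma> z [^] i)"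
    by (rule ev_sum_bound[OF f'(1)]) (use k f'(2) z in \<open>auto simp: f'_def\<close>)
  moreover have "ev z f = (\<Oplus>i\<in>{..<Suc k}. cf f i \<otimes> z [^] i)"
    by (rule ev_sum_bound[OF fP]) (use k z in auto)
  moreover have "\<sigma> (\<Oplus>i\<in>{..<Suc k}. cf f i \<otimes> z [^] i) = (\<Oplus>i\<in>{..<Suc k}. \<sigma> (cf f i \<otimes> z [^] i))"
    using H.hom_finsum[of "\<lambda>i. cf f i \<otimes> z [^] i" "{..<Suc k}"] fP z by (auto simp: comp_def)
  moreover have "\<dots> = (\<Oplus>i\<in>{..<Suc k}. cf f' i \<otimes> \<sigma> z [^] i)"
    by (rule R.finsum_cong'[OF refl]) (use fP z f' in \<open>auto simp: f'_def\<close>)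
  ultimately show ?thesis using f' by (intro bexI[of _ f']) (auto simp: f'_def)
qed

lemma sigma_adj:
  assumes B: "subring B R" and z: "z \<in> carrier R"
  shows "\<sigma> ` adj B z = adj (\<sigma> ` B) (\<sigma> z)"
proof
  show "\<sigma> ` adj B z \<subseteq> adj (\<sigma> ` B) (\<sigma> z)"
  proof
    fix t assume "t \<in> \<sigma> ` adj B z"
    then obtain f where f: "f \<in> cpoly B" "t = \<sigma> (ev z f)" unfolding adj_def by blast
    obtain f' where "f' \<in> cpoly (\<sigma> ` B)" "ev (\<sigma> z) f' = \<sigma> (ev z f)" using sigma_poly[OF B f(1) z] by blast
    then show "t \<in> adj (\<sigma> ` B) (\<sigma> z)" unfolding adj_def f(2) by (metis imageI)
  qed
  show "adj (\<sigma> ` B) (\<sigma> z) \<subseteq> \<sigma> ` adj B z"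
    by (rule adj_least[OF sigma_subring[OF adj_subring[OF B z]]]) (use adj_incl[OF B z] in blast)+
qed

lemma prime_pull:
  assumes Y: "prime_in Y C" and D: "subring D R" and DC: "\<sigma> ` D \<subseteq> C"
  shows "prime_in {t \<in> D. \<sigma> t \<in> Y} D"
proof -
  note s = subringE[OF D] and y = prime_inD[OF Y]
  have c: "a \<in> carrier R" "\<sigma> a \<in> C" if "a \<in> D" for a using that s(1) DC by blast+
  show ?thesis unfolding prime_in_def
    using s y c sigma_simps by auto
qed

text \<open>By injectivity \<open>\<sigma>\<close> is an isomorphism of \<open>D\<close> onto its
  image; primality is asserted only inside that image.\<close>

lemma prime_push:
  assumes Y: "prime_in Y D" and D: "subring D R"
  shows "prime_in (\<sigma> ` Y) (\<sigma> ` D)"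
proof -
  note s = subringE[OF D] and y = prime_inD[OF Y]
  have c: "a \<in> carrier R" if "a \<in> D" for a using that s(1) by blast
  have mem: "\<sigma> a \<in> \<sigma> ` Y \<longleftrightarrow> a \<in> Y" if "a \<in> D" for a
    using inj_on_image_mem_iff[OF sigma_inj, of a Y] c[OF that] y(1) s(1) by blast
  show ?thesis unfolding prime_in_def
  proof (intro conjI ballI impI)
    show "\<sigma> ` Y \<subseteq> \<sigma> ` D" using y(1) by blast
    show "\<zero> \<in> \<sigma> ` Y" using y(2) sigma_simps(1) by force
    show "\<one> \<notin> \<sigma> ` Y" using y(3) mem[OF s(3)] sigma_simps(2) by simp
    show "a \<oplus> b \<in> \<sigma> ` Y" if ab: "a \<in> \<sigma> ` Y" "b \<in> \<sigma> ` Y" for a b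
    proof -
      obtain x x' where x: "x \<in> Y" "x' \<in> Y" "a = \<sigma> x" "b = \<sigma> x'" using ab by blast
      then have "x \<in> carrier R" "x' \<in> carrier R" using c y(1) by blast+
      then have "a \<oplus> b = \<sigma> (x \<oplus> x')" using x sigma_simps(4) by simp
      then show ?thesis using y(4) x by blast
    qed
    show "a \<otimes> b \<in> \<sigma> ` Y" if ab: "a \<in> \<sigma> ` D" "b \<in> \<sigma> ` Y" for a b
    proof -
      obtain x x' where x: "x \<in> D" "x' \<in> Y" "a = \<sigma> x" "b = \<sigma> x'" using ab by blast
      then have "x \<in> carrier R" "x' \<in> carrier R" using c y(1) by blast+
      then have "a \<otimes> b = \<sigma> (x \<otimes> x')" using x sigma_simps(5) by simp
      then show ?thesis using y(5) x by blast
    qed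
    show "a \<in> \<sigma> ` Y \<or> b \<in> \<sigma> ` Y" if ab: "a \<in> \<sigma> ` D" "b \<in> \<sigma> ` D" "a \<otimes> b \<in> \<sigma> ` Y" for a b
    proof -
      obtain x x' where x: "x \<in> D" "x' \<in> D" "a = \<sigma> x" "b = \<sigma> x'" using ab by blast
      then have "\<sigma> (x \<otimes> x') \<in> \<sigma> ` Y" using ab(3) c sigma_simps(5) by auto
      then have "x \<otimes> x' \<in> Y" using mem s(6) x by blast
      then show ?thesis using y(6) x by blast
    qed
  qed
qed

text \<open>Some coefficient of the relation lies in \<open>D\<close> but not in the pullback, so
  its image is outside \<open>Y\<close>, and the relation stays nontrivial when
  \<open>\<sigma>\<close> is applied to its coefficients.\<close>

lemma alg_sigma:
  assumes B: "subring B R" and BD: "B \<subseteq> D" and z: "z \<in> carrier R" and al: "alg {t \<in> D. \<sigma> t \<in> Y} B z"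
  shows "alg Y (\<sigma> ` B) (\<sigma> z)"
proof -
  obtain f where f: "f \<in> cpoly B" "f \<notin> cpoly {t \<in> D. \<sigma> t \<in> Y}" "ev z f \<in> {t \<in> D. \<sigma> t \<in> Y}" using al unfolding alg_def by blast
  obtain f' where f': "f' \<in> cpoly (\<sigma> ` B)" "\<forall>n. cf f' n = \<sigma> (cf f n)" "ev (\<sigma> z) f' = \<sigma> (ev z f)"
    using sigma_poly[OF B f(1) z] by blast
  have "f' \<notin> cpoly Y"
  proof
    assume a: "f' \<in> cpoly Y"
    have "cf f n \<in> {t \<in> D. \<sigma> t \<in> Y}" for n using cpolyD(2)[OF a, of n] f'(2) cpolyD(2)[OF f(1), of n] BD by auto
    then show False using f(2) cpolyD(1)[OF f(1)] unfolding cpoly_def by blast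
  qed
  then show ?thesis unfolding alg_def using f f' by auto
qed

definition pull :: "'a set \<Rightarrow> 'a set \<Rightarrow> 'a set" where
  "pull D Y = {t \<in> D. \<sigma> t \<in> Y}"

text \<open>The counterpart of \<open>sigma_pow_primeideal\<close> for subsets of the ambient
  carrier.\<close>

definition pow_prime :: "nat \<Rightarrow> 'a set \<Rightarrow> 'a set \<Rightarrow> bool" where
  "pow_prime d q B \<longleftrightarrow> prime_in q B \<and> {b \<in> B. (\<sigma> ^^ d) b \<in> q} = q"

lemma sigma_pow_closed: "z \<in> carrier R \<Longrightarrow> (\<sigma> ^^ n) z \<in> carrier R"
  by (induction n) (auto simp: sigma_simps)

lemma alg_zero_sigma:
  assumes B: "subring B R" and z: "z \<in> carrier R" and al: "alg {\<zero>} B z"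
  shows "alg {\<zero>} (\<sigma> ` B) (\<sigma> z)"
proof -
  have "{t \<in> carrier R. \<sigma> t \<in> {\<zero>}} = {\<zero>}" using sigma_zero_iff by auto
  then show ?thesis using alg_sigma[OF B subringE(1)[OF B] z, of "{\<zero>}"] al by simp
qed

end

text \<open>The ambient \<open>\<sigma>\<close>-ring, \<open>S\<close> in the theorem, is called \<open>R\<close> in the locales; the base ring, \<open>R\<close> in the
  theorem, is \<open>A\<close>. Thus \<open>W k j = A[\<sigma>\<^sup>k(a), \<dots>, \<sigma>\<^sup>k\<^sup>+\<^sup>j\<^sup>-\<^sup>1(a)]\<close>.\<close>

locale sigma_tower = sigma_domain +
  fixes A :: "'a set" and a :: 'a
  assumes A: "subring A R" and sA: "\<sigma> ` A \<subseteq> A" and a: "a \<in> carrier R"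
begin

definition v :: "nat \<Rightarrow> 'a" where
  "v n = (\<sigma> ^^ n) a"

primrec W :: "nat \<Rightarrow> nat \<Rightarrow> 'a set" where
  "W k 0 = A"
| "W k (Suc j) = adj (W k j) (v (k + j))"

text \<open>This is the ring \<open>A{a}\<close>.\<close>

definition U :: "'a set" where
  "U = (\<Union>n. W 0 n)"

text \<open>Algebraic independence of the first \<open>n\<close> conjugates of \<open>a\<close>
  modulo \<open>y\<close> over the image of \<open>A\<close>, phrased one conjugate at a
  time.\<close>

definition generic :: "'a set \<Rightarrow> nat \<Rightarrow> bool" where
  "generic y n \<longleftrightarrow> (\<forall>j<n. \<not> alg y (W 0 j) (v j))"

lemma v_closed: "v n \<in> carrier R"
  unfolding v_def using sigma_pow_closed[OF a] .

lemma sigma_v: "\<sigma> (v n) = v (Suc n)"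
  unfolding v_def by simp

lemma W_subring: "subring (W k j) R"
  by (induction j) (auto simp: A adj_subring v_closed)

lemma W_Suc: "W k j \<subseteq> W k (Suc j)" "v (k + j) \<in> W k (Suc j)"
  using adj_incl[OF W_subring v_closed] by auto

lemma W_mono: "i \<le> j \<Longrightarrow> W k i \<subseteq> W k j"
  by (rule lift_Suc_mono_le[of "W k"]) (use W_Suc in auto)

lemma A_W: "A \<subseteq> W k j"
  using W_mono[of 0 j k] by simp

lemma v_W: "i < j \<Longrightarrow> v (k + i) \<in> W k j"
  using W_Suc(2)[of k i] W_mono[of "Suc i" j k] by auto

lemma W_least:
  assumes "subring C R" "A \<subseteq> C" "\<And>i. i < j \<Longrightarrow> v (k + i) \<in> C"
  shows "W k j \<subseteq> C"
  using assms(3) by (induction j) (auto simp: assms(2) intro: adj_least[OF assms(1), THEN subsetD])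

lemma W_shift: "W (Suc k) j \<subseteq> W k (Suc j)"
  using v_W[of "Suc i" "Suc j" k for i] by (intro W_least W_subring A_W) auto

lemma W_shifts: "W i j \<subseteq> W 0 (i + j)"
  using v_W[of "i + i'" "i + j" 0 for i'] by (intro W_least W_subring A_W) auto

lemma sigma_W: "\<sigma> ` W k j \<subseteq> W (Suc k) j"
proof (induction j)
  case 0
  then show ?case using sA by simp
next
  case (Suc j)
  have "\<sigma> ` W k (Suc j) = adj (\<sigma> ` W k j) (v (Suc k + j))"
    using sigma_adj[OF W_subring v_closed] by (simp add: sigma_v)
  also have "\<dots> \<subseteq> W (Suc k) (Suc j)" using adj_mono[OF Suc] by simp
  finally show ?case .
qed

lemma sigma_W0: "\<sigma> ` W 0 j \<subseteq> W 0 (Suc j)"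
  using sigma_W[of 0 j] W_shift[of 0 j] by blast

lemma sigma_pow_W0: "t \<in> W 0 j \<Longrightarrow> (\<sigma> ^^ i) t \<in> W 0 (j + i)"
  by (induction i) (use sigma_W0 in auto)

lemma W_carrier: "t \<in> W k j \<Longrightarrow> t \<in> carrier R"
  using subring_carrier[OF W_subring] .

lemma U_subring: "subring U R"
proof (rule R.subringI)
  have dir: "\<exists>n. x \<in> W 0 n \<and> y \<in> W 0 n" if "x \<in> U" "y \<in> U" for x y
  proof -
    obtain k k' where k: "x \<in> W 0 k" "y \<in> W 0 k'" using \<open>x \<in> U\<close> \<open>y \<in> U\<close> unfolding U_def by blast
    have "x \<in> W 0 (max k k')" "y \<in> W 0 (max k k')"
      by (rule subsetD[OF W_mono k(1)], simp) (rule subsetD[OF W_mono k(2)], simp)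
    then show ?thesis by blast
  qed
  note s = subringE[OF W_subring]
  show "U \<subseteq> carrier R" "\<one> \<in> U" unfolding U_def using s(1,3) by blast+
  show "\<ominus> h \<in> U" if "h \<in> U" for h using that s(5) unfolding U_def by blast
  show "h \<otimes> h' \<in> U" if "h \<in> U" "h' \<in> U" for h h' using dir[OF that] s(6) unfolding U_def by blast
  show "h \<oplus> h' \<in> U" if "h \<in> U" "h' \<in> U" for h h' using dir[OF that] s(7) unfolding U_def by blast
qed

lemma U_sigma: "\<sigma> ` U \<subseteq> U"
  unfolding U_def using sigma_W0 by blast

lemma A_U: "A \<subseteq> U"
  unfolding U_def using A_W by blast

lemma a_U: "a \<in> U"
  unfolding U_def using v_W[of 0 1 0] by (auto simp: v_def simp del: W.simps)

section \<open>Generic primes\<close>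

lemma generic_restrict:
  assumes "m \<le> n"
  shows "generic (y \<inter> W 0 n) m \<longleftrightarrow> generic y m"
proof -
  have "alg (y \<inter> W 0 n) (W 0 j) (v j) \<longleftrightarrow> alg y (W 0 j) (v j)" if "j < m" for j
    using v_W[of j n 0] that assms by (intro alg_cong[OF W_subring W_mono]) auto
  then show ?thesis unfolding generic_def by blast
qed

lemma generic_mono: "generic y n \<Longrightarrow> m \<le> n \<Longrightarrow> generic y m"
  unfolding generic_def by auto

text \<open>By \<open>generic_unique\<close> each level determines the next, so only the contraction
  to \<open>A\<close> matters.\<close>

lemma generic_eq:
  assumes "prime_in y (W 0 n)" "prime_in y' (W 0 n)" "generic y n" "generic y' n" "y \<inter> A = y' \<inter> A"
  shows "y = y'"
  using assms
proof (induction n arbitrary: y y')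
  case 0
  then show ?case using prime_inD(1) by (metis W.simps(1) inf.absorb1)
next
  case (Suc n)
  have *: "prime_in (z \<inter> W 0 n) (W 0 n)" "generic (z \<inter> W 0 n) n" "z = ev (v n) ` cpoly (z \<inter> W 0 n)"
    if "prime_in z (W 0 (Suc n))" "generic z (Suc n)" for z
  proof -
    show "prime_in (z \<inter> W 0 n) (W 0 n)" using prime_in_restrict[OF that(1) W_subring W_Suc(1)] .
    show "generic (z \<inter> W 0 n) n" using generic_restrict[of n n z] generic_mono[OF that(2), of n] by simp
    have "\<not> alg z (W 0 n) (v n)" using that(2) unfolding generic_def by blast
    then show "z = ev (v n) ` cpoly (z \<inter> W 0 n)"
      using generic_unique[OF W_subring v_closed, of z 0 n n] that(1) by simp
  qed
  have "y \<inter> W 0 n = y' \<inter> W 0 n"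
  proof (rule Suc.IH[OF *(1)[OF Suc.prems(1,3)] *(1)[OF Suc.prems(2,4)] *(2)[OF Suc.prems(1,3)] *(2)[OF Suc.prems(2,4)]])
    show "y \<inter> W 0 n \<inter> A = y' \<inter> W 0 n \<inter> A" using Suc.prems(5) by blast
  qed
  then show ?case using *(3)[OF Suc.prems(1,3)] *(3)[OF Suc.prems(2,4)] by simp
qed

lemma generic_exists:
  assumes na: "\<And>j. j < n \<Longrightarrow> \<not> alg {\<zero>} (W 0 j) (v j)" and q: "prime_in q A"
  shows "\<exists>y. prime_in y (W 0 n) \<and> generic y n \<and> y \<inter> A = q"
  using na
proof (induction n)
  case 0
  have "generic q 0" "q \<inter> A = q" using prime_inD(1)[OF q] unfolding generic_def by auto
  then show ?case using q unfolding W.simps(1) by blast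
next
  case (Suc n)
  then obtain y where y: "prime_in y (W 0 n)" "generic y n" "y \<inter> A = q" using less_SucI by blast
  obtain Q where Q: "prime_in Q (adj (W 0 n) (v n))" "Q \<inter> W 0 n = y" "\<not> alg Q (W 0 n) (v n)"
    using generic_extension[OF W_subring v_closed Suc.prems[of n] y(1)] by auto
  have "generic Q (Suc n)"
    using generic_restrict[of n n Q] Q y(2) unfolding generic_def by (auto simp: less_Suc_eq)
  moreover have "Q \<inter> A = q" using Q(2) y(3) A_W[of 0 n] by blast
  ultimately show ?case using Q(1) by auto
qed

text \<open>Write \<open>b\<close> as a polynomial in the last conjugate, pass to a nonzero
  coefficient, and continue down to \<open>A\<close>. If a generic prime contained \<open>b\<close>,
  independence would put all these coefficients into it.\<close>

lemma generic_coefficient: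
  assumes "b \<in> W 0 n" "b \<noteq> \<zero>"
  shows "\<exists>r\<in>A. r \<noteq> \<zero> \<and> (\<forall>y. generic y n \<and> r \<notin> y \<longrightarrow> b \<notin> y)"
  using assms
proof (induction n arbitrary: b)
  case 0
  then show ?case by auto
next
  case (Suc n)
  obtain f where f: "f \<in> cpoly (W 0 n)" "b = ev (v n) f" using Suc.prems(1) unfolding W.simps adj_def by auto
  have "\<exists>k. cf f k \<noteq> \<zero>"
  proof (rule ccontr)
    assume "\<not> ?thesis"
    then have "f \<in> cpoly {\<zero>}" using cpolyD(1)[OF f(1)] unfolding cpoly_def by auto
    then have "ev (v n) f \<in> {\<zero>}" using ev_prime[OF zero_prime[OF R.carrier_is_subring] R.carrier_is_subring _ v_closed] by blast
    then show False using f Suc.prems(2) by simp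
  qed
  then obtain k where k: "cf f k \<noteq> \<zero>" by blast
  obtain r where r: "r \<in> A" "r \<noteq> \<zero>" "\<forall>y. generic y n \<and> r \<notin> y \<longrightarrow> cf f k \<notin> y"
    using Suc.IH[OF cpolyD(2)[OF f(1)] k] by blast
  have "b \<notin> y" if "generic y (Suc n)" "r \<notin> y" for y
  proof
    assume "b \<in> y"
    moreover have "\<not> alg y (W 0 n) (v n)" "generic y n" using that generic_mono[of y "Suc n" n] unfolding generic_def by auto
    ultimately have "f \<in> cpoly y" using f unfolding alg_def by blast
    then show False using r(3) that(2) \<open>generic y n\<close> cpolyD(2) by blast
  qed
  then show ?case using r by blast
qed

text \<open>\<open>Q i\<close> is the union of the \<open>p n i\<close> over \<open>n\<close>, and
  each property is checked at a level containing the elements concerned. The last clause passes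
  periodicity in \<open>i\<close> on to the limit.\<close>

lemma limit_prime:
  assumes p: "\<And>n i. n \<ge> n0 \<Longrightarrow> prime_in (p n i) (W 0 n)"
    and restr: "\<And>n i. n \<ge> n0 \<Longrightarrow> p (Suc n) i \<inter> W 0 n = p n i"
    and shift: "\<And>n i. n \<ge> n0 \<Longrightarrow> pull (W 0 n) (p (Suc n) i) = p n (Suc i)"
  shows "\<exists>Q. (\<forall>i. prime_in (Q i) U) \<and> (\<forall>i n. n \<ge> n0 \<longrightarrow> Q i \<inter> W 0 n = p n i) \<and> (\<forall>i. pull U (Q i) = Q (Suc i))
     \<and> (\<forall>i j. (\<forall>n. p n i = p n j) \<longrightarrow> Q i = Q j)"
proof -
  define Q where "Q = (\<lambda>i. \<Union>n\<in>{n0..}. p n i)"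
  have pm: "p n' i \<inter> W 0 n = p n i" if "n0 \<le> n" "n \<le> n'" for n n' i
    using that(2,1)
  proof (induction rule: dec_induct)
    case base
    then show ?case using prime_inD(1)[OF p] by blast
  next
    case (step k)
    have "p (Suc k) i \<inter> W 0 n = (p (Suc k) i \<inter> W 0 k) \<inter> W 0 n" using W_mono[OF step.hyps(1), of 0] by blast
    then show ?case using restr[of k i] step by simp
  qed
  have QW: "Q i \<inter> W 0 n = p n i" if n: "n \<ge> n0" for i n
  proof
    show "p n i \<subseteq> Q i \<inter> W 0 n" using n prime_inD(1)[OF p[OF n]] unfolding Q_def by blast
    show "Q i \<inter> W 0 n \<subseteq> p n i"
    proof
      fix t assume "t \<in> Q i \<inter> W 0 n"
      then obtain n' where n': "n' \<ge> n0" "t \<in> p n' i" "t \<in> W 0 n" unfolding Q_def by auto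
      show "t \<in> p n i"
      proof (cases "n \<le> n'")
        case True
        then show ?thesis using pm[OF n True, of i] n' by blast
      next
        case False
        then show ?thesis using pm[OF n'(1), of n i] n' by auto
      qed
    qed
  qed
  have dir: "\<exists>n\<ge>n0. x \<in> W 0 n \<and> y \<in> W 0 n" if xy: "x \<in> U" "y \<in> U" for x y
  proof -
    obtain k k' where k: "x \<in> W 0 k" "y \<in> W 0 k'" using xy unfolding U_def by blast
    have "x \<in> W 0 (max n0 (max k k'))" "y \<in> W 0 (max n0 (max k k'))"
      by (rule subsetD[OF W_mono k(1)], simp) (rule subsetD[OF W_mono k(2)], simp)
    then show ?thesis by (meson max.cobounded1)
  qed
  have mem: "t \<in> Q i \<longleftrightarrow> t \<in> p n i" if "t \<in> W 0 n" "n \<ge> n0" for t i n using QW[OF that(2)] that(1) by blast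
  have QU: "Q i \<subseteq> U" for i unfolding Q_def U_def using prime_inD(1)[OF p] by blast
  note s = subringE[OF W_subring[of 0]]
  have "prime_in (Q i) U" for i unfolding prime_in_def
  proof (intro conjI ballI impI)
    show "Q i \<subseteq> U" by (rule QU)
    show "\<zero> \<in> Q i" "\<one> \<notin> Q i" using mem[OF s(2)[of n0]] mem[OF s(3)[of n0]] prime_inD(2,3)[OF p[of n0]] by auto
    show "x \<oplus> y \<in> Q i" if "x \<in> Q i" "y \<in> Q i" for x y
    proof -
      obtain n where n: "n \<ge> n0" "x \<in> W 0 n" "y \<in> W 0 n" using dir \<open>x \<in> Q i\<close> \<open>y \<in> Q i\<close> QU by blast
      then show ?thesis using mem[OF n(2,1)] mem[OF n(3,1)] mem[OF s(7)[OF n(2,3)] n(1)] prime_inD(4)[OF p[OF n(1)]] that by blast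
    qed
    show "x \<otimes> y \<in> Q i" if "x \<in> U" "y \<in> Q i" for x y
    proof -
      obtain n where n: "n \<ge> n0" "x \<in> W 0 n" "y \<in> W 0 n" using dir \<open>x \<in> U\<close> \<open>y \<in> Q i\<close> QU by blast
      then show ?thesis using mem[OF n(3,1)] mem[OF s(6)[OF n(2,3)] n(1)] prime_inD(5)[OF p[OF n(1)]] that by blast
    qed
    show "x \<in> Q i \<or> y \<in> Q i" if "x \<in> U" "y \<in> U" "x \<otimes> y \<in> Q i" for x y
    proof -
      obtain n where n: "n \<ge> n0" "x \<in> W 0 n" "y \<in> W 0 n" using dir \<open>x \<in> U\<close> \<open>y \<in> U\<close> by blast
      then show ?thesis using mem[OF n(2,1)] mem[OF n(3,1)] mem[OF s(6)[OF n(2,3)] n(1)] prime_inD(6)[OF p[OF n(1)]] that by blast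
    qed
  qed
  moreover have "pull U (Q i) = Q (Suc i)" for i
  proof -
    have "\<sigma> t \<in> Q i \<longleftrightarrow> t \<in> Q (Suc i)" if t: "t \<in> U" for t
    proof -
      obtain n where n: "n \<ge> n0" "t \<in> W 0 n" using dir[OF t t] by blast
      then have "\<sigma> t \<in> W 0 (Suc n)" using sigma_W0 by blast
      then have "\<sigma> t \<in> Q i \<longleftrightarrow> \<sigma> t \<in> p (Suc n) i" using mem n(1) by simp
      also have "\<dots> \<longleftrightarrow> t \<in> p n (Suc i)" using shift[OF n(1), of i] n(2) unfolding pull_def by blast
      also have "\<dots> \<longleftrightarrow> t \<in> Q (Suc i)" using mem[OF n(2,1)] by simp
      finally show ?thesis .
    qed
    then show ?thesis using QU unfolding pull_def by blast
  qed
  moreover have "Q i = Q j" if "\<forall>n. p n i = p n j" for i j using that unfolding Q_def by simp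
  ultimately show ?thesis using QW by blast
qed

lemma pull_pow:
  assumes "\<And>i. pull U (Q i) = Q (Suc i)"
  shows "t \<in> U \<Longrightarrow> (\<sigma> ^^ j) t \<in> Q i \<longleftrightarrow> t \<in> Q (i + j)"
proof (induction j arbitrary: t)
  case 0
  then show ?case by simp
next
  case (Suc j)
  have "(\<sigma> ^^ Suc j) t = (\<sigma> ^^ j) (\<sigma> t)" by (simp add: funpow_swap1)
  moreover have "\<sigma> t \<in> U" using U_sigma Suc.prems by blast
  ultimately show ?case using Suc.IH[of "\<sigma> t"] assms[of "i + j"] Suc.prems unfolding pull_def by auto
qed

text \<open>One conjugate is lost: a relation of \<open>v j\<close> over the earlier conjugates
  modulo the pullback is carried by \<open>\<sigma>\<close> to a relation of
  \<open>v (Suc j)\<close> modulo \<open>y\<close>.\<close>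

lemma pull_generic:
  assumes "generic y (Suc n)"
  shows "generic (pull (W 0 n) y) n"
  unfolding generic_def
proof (intro allI impI notI)
  fix j assume j: "j < n" and al: "alg (pull (W 0 n) y) (W 0 j) (v j)"
  have "alg y (\<sigma> ` W 0 j) (v (Suc j))"
    using alg_sigma[OF W_subring W_mono[of j n 0] v_closed] j al unfolding pull_def sigma_v by auto
  then have "alg y (W 0 (Suc j)) (v (Suc j))" using alg_mono sigma_W0 by blast
  then show False using assms j unfolding generic_def by blast
qed

text \<open>The \<open>i\<close>-fold preimage of \<open>q\<close> in \<open>A\<close>; in the
  sequences of primes below, the entry of index \<open>i\<close> is to lie over it.\<close>

definition orbit :: "nat \<Rightarrow> 'a set \<Rightarrow> 'a set" where
  "orbit i q = {b \<in> A. (\<sigma> ^^ i) b \<in> q}"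

lemma sigma_pow_A: "b \<in> A \<Longrightarrow> (\<sigma> ^^ i) b \<in> A"
  by (induction i) (use sA in auto)

lemma orbit_Suc: "orbit (Suc i) q = pull A (orbit i q)"
  unfolding orbit_def pull_def using sA sigma_pow_A by (auto simp: funpow_swap1)

lemma orbit_prime:
  assumes "prime_in q A"
  shows "prime_in (orbit i q) A"
proof (induction i)
  case 0
  have "orbit 0 q = q" using prime_inD(1)[OF assms] unfolding orbit_def by auto
  then show ?case using assms by simp
next
  case (Suc i)
  then show ?case unfolding orbit_Suc pull_def by (rule prime_pull[OF _ A sA])
qed

lemma orbit_period:
  assumes "pow_prime d q A"
  shows "orbit (i + d) q = orbit i q" "orbit (i + k * d) q = orbit i q"
proof -
  have *: "orbit (i + d) q = orbit i q" for i
  proof -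
    have "(\<sigma> ^^ (i + d)) b \<in> q \<longleftrightarrow> (\<sigma> ^^ i) b \<in> q" if "b \<in> A" for b
    proof -
      have "(\<sigma> ^^ (i + d)) b = (\<sigma> ^^ d) ((\<sigma> ^^ i) b)" by (simp add: add.commute[of i d] funpow_add)
      moreover have "{b \<in> A. (\<sigma> ^^ d) b \<in> q} = q" using assms unfolding pow_prime_def by blast
      then have "(\<sigma> ^^ d) x \<in> q \<longleftrightarrow> x \<in> q" if "x \<in> A" for x using that by blast
      ultimately show ?thesis using sigma_pow_A[OF that, of i] by simp
    qed
    then show ?thesis unfolding orbit_def by blast
  qed
  then show "orbit (i + d) q = orbit i q" .
  show "orbit (i + k * d) q = orbit i q"
  proof (induction k)
    case (Suc k)
    have e: "i + Suc k * d = (i + k * d) + d" by simp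
    show ?case unfolding e * by (rule Suc)
  qed simp
qed

text \<open>For the primes \<open>q\<close> in question and \<open>r\<close> in \<open>A\<close>,
  avoidance of all iterates of \<open>r\<close> is equivalent to the product condition. It has the
  same shape as the condition on \<open>s\<close> in the conclusion, so that lifts can be
  composed.\<close>

definition lifts :: "nat \<Rightarrow> 'a \<Rightarrow> 'a \<Rightarrow> bool" where
  "lifts l r s \<longleftrightarrow> (\<forall>d\<ge>1. \<forall>q. pow_prime d q A \<and> (\<forall>i. (\<sigma> ^^ i) r \<notin> q) \<longrightarrow>
     (\<exists>q'. pow_prime (l * d) q' U \<and> q' \<inter> A = q \<and> (\<forall>i. (\<sigma> ^^ i) s \<notin> q')))"

text \<open>No change of period occurs: there is exactly one generic prime over each preimage of
  \<open>q\<close>, and uniqueness gives compatibility with restriction and with the shift.\<close>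

lemma lifts_transcendental:
  assumes na: "\<And>j. \<not> alg {\<zero>} (W 0 j) (v j)" and s: "s \<in> U" "s \<noteq> \<zero>"
  shows "\<exists>r\<in>A. r \<noteq> \<zero> \<and> lifts 1 r s"
proof -
  obtain n1 where n1: "s \<in> W 0 n1" using s(1) unfolding U_def by blast
  obtain r where r: "r \<in> A" "r \<noteq> \<zero>" "\<forall>y. generic y n1 \<and> r \<notin> y \<longrightarrow> s \<notin> y"
    using generic_coefficient[OF n1 s(2)] by blast
  have "lifts 1 r s" unfolding lifts_def
  proof (intro allI impI)
    fix d q assume d: "(1::nat) \<le> d" and q: "pow_prime d q A \<and> (\<forall>i. (\<sigma> ^^ i) r \<notin> q)"
    have qp: "prime_in q A" using q unfolding pow_prime_def by blast
    define p where "p = (\<lambda>n i. SOME y. prime_in y (W 0 n) \<and> generic y n \<and> y \<inter> A = orbit i q)"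
    have p: "prime_in (p n i) (W 0 n) \<and> generic (p n i) n \<and> p n i \<inter> A = orbit i q" for n i
      unfolding p_def by (rule someI_ex, rule generic_exists[OF na orbit_prime[OF qp]])
    have restr: "p (Suc n) i \<inter> W 0 n = p n i" for n i
    proof (rule generic_eq)
      show "prime_in (p (Suc n) i \<inter> W 0 n) (W 0 n)"
        using prime_in_restrict[OF _ W_subring W_Suc(1)] p by blast
      show "generic (p (Suc n) i \<inter> W 0 n) n"
        using generic_restrict[of n n "p (Suc n) i"] generic_mono[of "p (Suc n) i" "Suc n" n] p by simp
      show "p (Suc n) i \<inter> W 0 n \<inter> A = p n i \<inter> A" using p A_W[of 0 n] by blast
    qed (use p in blast)+
    have shift: "pull (W 0 n) (p (Suc n) i) = p n (Suc i)" for n i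
    proof (rule generic_eq)
      show "prime_in (pull (W 0 n) (p (Suc n) i)) (W 0 n)"
        unfolding pull_def using prime_pull[OF _ W_subring sigma_W0] p by blast
      show "generic (pull (W 0 n) (p (Suc n) i)) n" using pull_generic p by blast
      have "pull (W 0 n) (p (Suc n) i) \<inter> A = pull A (p (Suc n) i \<inter> A)"
        unfolding pull_def using A_W[of 0 n] sA by blast
      then show "pull (W 0 n) (p (Suc n) i) \<inter> A = p n (Suc i) \<inter> A" using p orbit_Suc by auto
    qed (use p in blast)+
    have "\<exists>Q. (\<forall>i. prime_in (Q i) U) \<and> (\<forall>i n. n \<ge> 0 \<longrightarrow> Q i \<inter> W 0 n = p n i) \<and> (\<forall>i. pull U (Q i) = Q (Suc i))
       \<and> (\<forall>i j. (\<forall>n. p n i = p n j) \<longrightarrow> Q i = Q j)"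
      by (rule limit_prime) (simp_all add: p restr shift)
    then obtain Q where Q1: "\<forall>i. prime_in (Q i) U" "\<forall>i n. n \<ge> 0 \<longrightarrow> Q i \<inter> W 0 n = p n i" "\<forall>i. pull U (Q i) = Q (Suc i)"
      "\<forall>i j. (\<forall>n. p n i = p n j) \<longrightarrow> Q i = Q j"
      by (elim exE conjE) (rule that)
    have Q: "\<And>i. prime_in (Q i) U" "\<And>i n. Q i \<inter> W 0 n = p n i" "\<And>i. pull U (Q i) = Q (Suc i)"
      "\<And>i j. (\<forall>n. p n i = p n j) \<Longrightarrow> Q i = Q j"
      by (rule Q1[rule_format]; simp)+
    \<comment> \<open>The choice defining \<open>p\<close> depends on \<open>i\<close> only through
      \<open>orbit i q\<close>, which has period \<open>d\<close>.\<close>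
    have per: "Q (0 + d) = Q 0"
    proof (rule Q(4), intro allI)
      show "p n (0 + d) = p n 0" for n unfolding p_def using orbit_period(1)[of d q 0] q by simp
    qed
    have pw: "(\<sigma> ^^ j) t \<in> Q 0 \<longleftrightarrow> t \<in> Q j" if "t \<in> U" for t j using pull_pow[of Q, OF Q(3) that, of j 0] by simp
    have "pow_prime (1 * d) (Q 0) U" unfolding pow_prime_def
      using Q(1) pw[of _ d] per prime_inD(1)[OF Q(1)[of 0]] by auto
    moreover have "Q 0 \<inter> A = q"
    proof -
      have "Q 0 \<inter> A = p 0 0" using Q(2)[of 0 0] by simp
      also have "\<dots> = orbit 0 q" using p[of 0 0] prime_inD(1)[of "p 0 0" "W 0 0"] by auto
      also have "\<dots> = q" using prime_inD(1)[OF qp] unfolding orbit_def by auto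
      finally show ?thesis .
    qed
    moreover have "(\<sigma> ^^ i) s \<notin> Q 0" for i
    proof -
      have "r \<notin> p n1 i" using p[of n1 i] q r(1) unfolding orbit_def by blast
      then have "s \<notin> p n1 i" using r(3) p by blast
      then have "s \<notin> Q i" using Q(2)[of i n1] n1 by blast
      then show ?thesis using pw[OF s(1)] by simp
    qed
    ultimately show "\<exists>q'. pow_prime (1 * d) q' U \<and> q' \<inter> A = q \<and> (\<forall>i. (\<sigma> ^^ i) s \<notin> q')" by blast
  qed
  then show ?thesis using r by blast
qed

end

section \<open>The algebraic case\<close>

text \<open>Applying \<open>\<sigma>\<close> preserves dependence, but not independence over
  \<open>A\<close>, since \<open>\<sigma>\<close> need not map \<open>A\<close> onto
  \<open>A\<close>. Hence \<open>indep\<close> is demanded for windows starting anywhere and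
  \<open>dep\<close> only for the first.\<close>

locale sigma_algebraic = sigma_tower +
  fixes m :: nat
  assumes indep: "\<And>k j. j < m \<Longrightarrow> \<not> alg {\<zero>} (W k j) (v (k + j))"
    and dep: "alg {\<zero>} (W 0 m) (v m)"
begin

lemma dep_shift: "alg {\<zero>} (W k m) (v (k + m))"
proof (induction k)
  case 0
  then show ?case using dep by simp
next
  case (Suc k)
  then show ?case using alg_mono[OF alg_zero_sigma[OF W_subring v_closed Suc] sigma_W] by (simp add: sigma_v)
qed

lemma dep_W0:
  assumes "m \<le> n"
  shows "alg {\<zero>} (W 0 n) (v n)"
  using alg_mono[OF dep_shift W_shifts, of "n - m"] assms by simp

lemma adj_W_v: "adj (W (Suc k) j) (v k) \<subseteq> W k (Suc j)"
proof (rule adj_least[OF W_subring W_shift])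
  show "v k \<in> W k (Suc j)" using v_W[of 0 "Suc j" k] by simp
qed

lemma W_adj_v: "W k (Suc j) \<subseteq> adj (W (Suc k) j) (v k)"
proof (rule W_least[OF adj_subring[OF W_subring v_closed]])
  note i = adj_incl[OF W_subring[of "Suc k" j] v_closed[of k]]
  show "A \<subseteq> adj (W (Suc k) j) (v k)" using i(1) A_W by blast
  show "v (k + n) \<in> adj (W (Suc k) j) (v k)" if "n < Suc j" for n
    using i v_W[of "n - 1" j "Suc k"] that by (cases n) auto
qed

text \<open>For \<open>m = Suc j\<close>, the element \<open>v m\<close> is algebraic over
  \<open>v 0\<close>, ..., \<open>v j\<close> but not over \<open>v 1\<close>, ...,
  \<open>v j\<close>, because the window starting at 1 is independent. So \<open>v 0\<close> can be
  exchanged for \<open>v m\<close>.\<close>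

lemma dep_back: "alg {\<zero>} (W 1 m) (v 0)"
proof (cases m)
  case 0
  then show ?thesis using dep by simp
next
  case (Suc j)
  have "alg {\<zero>} (adj (W 1 j) (v 0)) (v m)"
    using alg_mono[OF dep] W_adj_v[of 0 j] Suc by simp
  moreover have "\<not> alg {\<zero>} (W 1 j) (v m)" using indep[of j 1] Suc by simp
  ultimately have "alg {\<zero>} (adj (W 1 j) (v m)) (v 0)"
    using alg_exchange[OF zero_prime[OF R.carrier_is_subring] R.carrier_is_subring W_subring subringE(1)[OF W_subring] v_closed v_closed] by blast
  then show ?thesis using Suc by simp
qed

text \<open>A dependence among \<open>a, \<dots>, \<sigma>\<^sup>m\<^sup>-\<^sup>1(a)\<close> modulo the pullback makes \<open>\<sigma>\<^sup>m(a)\<close>, hence also \<open>a\<close>, algebraic over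
  \<open>\<sigma>(a), \<dots>, \<sigma>\<^sup>m\<^sup>-\<^sup>1(a)\<close> modulo \<open>y\<close>; by exchange this contradicts the independence of \<open>a, \<dots>, \<sigma>\<^sup>m\<^sup>-\<^sup>1(a)\<close>.\<close>

lemma pull_generic_algebraic:
  assumes n: "m \<le> n" and y: "prime_in y (W 0 (Suc n))" "generic y m" and al: "alg y (W 1 m) (v 0)"
  shows "generic (pull (W 0 n) y) m"
  unfolding generic_def
proof (intro allI impI notI)
  fix j assume j: "j < m" and alj: "alg (pull (W 0 n) y) (W 0 j) (v j)"
  have "alg y (\<sigma> ` W 0 j) (v (Suc j))"
    using alg_sigma[OF W_subring W_mono[of j n 0] v_closed] j n alj unfolding pull_def sigma_v by auto
  then have al1: "alg y (W 1 j) (v (Suc j))" using alg_mono sigma_W[of 0 j] by auto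
  then have "alg y (W 0 (Suc j)) (v (Suc j))" using alg_mono W_shift[of 0 j] by auto
  \<comment> \<open>If \<open>Suc j < m\<close>, the relation just found contradicts genericity of
    \<open>y\<close> at once; only the last index needs the exchange argument.\<close>
  then have mj: "m = Suc j" using y(2) j unfolding generic_def by (metis Suc_lessI)
  have VE: "v i \<in> W 0 (Suc n)" if "i \<le> n" for i using v_W[of i "Suc n" 0] that by simp
  have WE: "W 1 i \<subseteq> W 0 (Suc n)" if "i \<le> n" for i
    using W_shift[of 0 i] W_mono[of "Suc i" "Suc n" 0] that by auto
  have "alg y (adj (W 1 j) (v (Suc j))) (v 0)" using al mj by simp
  then have "alg y (W 1 j) (v 0)"
    using alg_trans[OF y(1) W_subring W_subring WE VE al1 VE] mj n by simp
  then have ex: "\<exists>i. i \<le> j \<and> alg y (W 1 i) (v 0)" by blast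
  \<comment> \<open>The least window length at which \<open>v 0\<close> becomes algebraic: there the
    last conjugate of the window can be exchanged for \<open>v 0\<close>.\<close>
  define i where "i = (LEAST i. i \<le> j \<and> alg y (W 1 i) (v 0))"
  have i: "i \<le> j" "alg y (W 1 i) (v 0)" using LeastI_ex[OF ex] unfolding i_def by auto
  have least: "\<not> alg y (W 1 k) (v 0)" if "k < i" for k
    using not_less_Least[of k "\<lambda>i. i \<le> j \<and> alg y (W 1 i) (v 0)"] that i(1) unfolding i_def by auto
  show False
  proof (cases i)
    case 0
    then show ?thesis using i(2) y(2) j unfolding generic_def by auto
  next
    case (Suc k)
    have "alg y (adj (W 1 k) (v (Suc k))) (v 0)" using i(2) Suc by simp
    then have "alg y (adj (W 1 k) (v 0)) (v (Suc k))"
      using alg_exchange[OF y(1) W_subring W_subring WE VE VE _ least[of k]] Suc i(1) mj n by simp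
    then have "alg y (W 0 (Suc k)) (v (Suc k))" using alg_mono adj_W_v[of 0 k] by auto
    moreover have "Suc k < m" using Suc i(1) j by simp
    ultimately show ?thesis using y(2) unfolding generic_def by blast
  qed
qed

text \<open>From level \<open>m\<close> on every new conjugate is algebraic over the ring before it,
  and \<open>finmod_trans\<close> composes the steps.\<close>

lemma finmod_W:
  assumes "m \<le> n"
  shows "\<exists>c I. finmod {\<zero>} (W 0 m) (W 0 n) c I"
  using assms
proof (induction rule: dec_induct)
  case base
  note s = subringE[OF W_subring[of 0 m]]
  have "finmod {\<zero>} (W 0 m) (W 0 m) \<one> {0}" unfolding finmod_def
  proof (intro conjI exI[of _ "\<lambda>_. \<one>"] ballI)
    fix u assume u: "u \<in> W 0 m"
    then have "u \<in> carrier R" by (rule W_carrier)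
    then show "\<exists>(N::nat) f. (\<forall>i\<in>{0}. f i \<in> W 0 m) \<and> \<one> [^] N \<otimes> u \<ominus> (\<Oplus>i\<in>{0}. f i \<otimes> \<one>) \<in> {\<zero>}"
      using u by (intro exI[of _ 0] exI[of _ "\<lambda>_. u"]) (auto simp: a_minus_def R.r_neg)
  qed (use s in auto)
  then show ?case by blast
next
  case (step n)
  then obtain c I where f1: "finmod {\<zero>} (W 0 m) (W 0 n) c I" by blast
  note Z = zero_prime[OF R.carrier_is_subring] and S = R.carrier_is_subring
  obtain d J where f2: "finmod {\<zero>} (W 0 n) (W 0 (Suc n)) d J"
    using alg_finmod[OF Z S W_subring subringE(1)[OF W_subring] v_closed dep_W0[OF step.hyps(1)]] by auto
  show ?case
    using finmod_trans[OF Z S W_subring W_subring W_mono[OF step.hyps(1)] W_subring W_Suc(1) subringE(1)[OF W_subring] f1 f2] by blast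
qed

text \<open>\<open>b\<close> is algebraic over \<open>W 0 m\<close>, so it divides a nonzero element
  of \<open>W 0 m\<close>, and \<open>generic_coefficient\<close> leads from there to
  \<open>A\<close>. The resulting \<open>r\<close> does not depend on the level \<open>n'\<close> of
  the prime.\<close>

lemma avoid_element:
  assumes n: "m \<le> n" and b: "b \<in> W 0 n" "b \<noteq> \<zero>"
  shows "\<exists>r\<in>A. r \<noteq> \<zero> \<and> (\<forall>n' y. n \<le> n' \<and> prime_in y (W 0 n') \<and> generic y m \<and> r \<notin> y \<longrightarrow> b \<notin> y)"
proof -
  note Z = zero_prime[OF W_subring[of 0 n]]
  obtain c I where f: "finmod {\<zero>} (W 0 m) (W 0 n) c I" using finmod_W[OF n] by blast
  have al: "alg {\<zero>} (W 0 m) b"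
    by (rule finmod_alg[OF Z W_subring W_subring W_mono[OF n] subset_refl W_subring f b(1)])
  obtain w b' where w: "w \<in> adj (W 0 m) b" "b' \<in> W 0 m" "b' \<notin> {\<zero>}" "b \<otimes> w \<ominus> b' \<in> {\<zero>}"
    using alg_inverse[OF Z W_subring W_subring W_mono[OF n] b(1) _ al] b(2) by blast
  have wW: "w \<in> W 0 n" using adj_least[OF W_subring W_mono[OF n] b(1)] w(1) by blast
  have c: "b \<in> carrier R" "w \<in> carrier R" "b' \<in> carrier R" using b(1) wW w(2) W_carrier by blast+
  have "b \<otimes> w \<ominus> b' = \<zero>" using w(4) by simp
  moreover have "b' = b \<otimes> w \<ominus> (b \<otimes> w \<ominus> b')" using c by algebra
  ultimately have "b' = b \<otimes> w" using c by (simp add: a_minus_def)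
  then have eq: "b' = w \<otimes> b" using R.m_comm[OF c(1,2)] by simp
  obtain r where r: "r \<in> A" "r \<noteq> \<zero>" "\<forall>y. generic y m \<and> r \<notin> y \<longrightarrow> b' \<notin> y"
    using generic_coefficient[OF w(2)] w(3) by blast
  have "b \<notin> y" if "n \<le> n'" "prime_in y (W 0 n')" "generic y m" "r \<notin> y" for n' y
  proof
    assume "b \<in> y"
    moreover have "w \<in> W 0 n'" using wW W_mono[OF that(1), of 0] by blast
    ultimately have "b' \<in> y" using prime_inD(5)[OF that(2)] eq by simp
    then show False using r(3) that by blast
  qed
  then show ?thesis using r by blast
qed

text \<open>Starting from the generic prime of \<open>W 0 m\<close>, each level is reached by
  \<open>lying_over\<close>; avoiding the leading coefficient of the minimal relation costs one more
  factor of \<open>r\<close>.\<close>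

lemma prime_extension_exists:
  assumes "m \<le> n"
  shows "\<exists>r\<in>A. r \<noteq> \<zero> \<and> (\<forall>q. prime_in q A \<and> r \<notin> q \<longrightarrow> (\<exists>y. prime_in y (W 0 n) \<and> generic y m \<and> y \<inter> A = q))"
  using assms
proof (induction rule: dec_induct)
  case base
  have "\<exists>y. prime_in y (W 0 m) \<and> generic y m \<and> y \<inter> A = q" if "prime_in q A" for q
    by (rule generic_exists[OF _ that]) (use indep[of _ 0] in auto)
  then show ?case using subringE(3)[OF A] R.one_not_zero by blast
next
  case (step n)
  then obtain r where r: "r \<in> A" "r \<noteq> \<zero>"
    "\<forall>q. prime_in q A \<and> r \<notin> q \<longrightarrow> (\<exists>y. prime_in y (W 0 n) \<and> generic y m \<and> y \<inter> A = q)" by blast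
  obtain F D where F: "minrel (W 0 n) (v n) F D"
    using minrel_exists[OF W_subring v_closed dep_W0[OF step.hyps(1)]] by blast
  have p: "cf F D \<in> W 0 n" "cf F D \<noteq> \<zero>" using F cpolyD(2) unfolding minrel_def by blast+
  obtain r' where r': "r' \<in> A" "r' \<noteq> \<zero>"
    "\<forall>n' y. n \<le> n' \<and> prime_in y (W 0 n') \<and> generic y m \<and> r' \<notin> y \<longrightarrow> cf F D \<notin> y"
    using avoid_element[OF step.hyps(1) p] by blast
  have rA: "r \<otimes> r' \<in> A" "r \<otimes> r' \<noteq> \<zero>" using r r' subringE(6)[OF A] R.integral_iff subring_carrier[OF A] by auto
  have "\<exists>y. prime_in y (W 0 (Suc n)) \<and> generic y m \<and> y \<inter> A = q" if q: "prime_in q A" "r \<otimes> r' \<notin> q" for q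
  proof -
    have rq: "r \<notin> q" "r' \<notin> q"
      using prime_inD(5)[OF q(1) r(1), of r'] prime_inD(5)[OF q(1) r'(1), of r] q(2) R.m_comm subring_carrier[OF A] r(1) r'(1) by metis+
    then obtain y where y: "prime_in y (W 0 n)" "generic y m" "y \<inter> A = q" using r(3) q(1) by blast
    then have "r' \<notin> y" using rq r'(1) by blast
    then have "cf F D \<notin> y" using r'(3) y by blast
    then obtain Q where Q: "prime_in Q (adj (W 0 n) (v n))" "Q \<inter> W 0 n = y"
      using lying_over[OF W_subring y(1) v_closed F] by blast
    have "generic Q m" using generic_restrict[OF step.hyps(1), of Q] Q(2) y(2) by simp
    moreover have "Q \<inter> A = q" using Q(2) y(3) A_W[of 0 n] by blast
    ultimately show ?thesis using Q(1) by auto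
  qed
  then show ?case using rA by blast
qed

section \<open>Degrees of minimal relations along the tower\<close>

definition rel :: "nat \<Rightarrow> (nat \<Rightarrow> 'a) \<Rightarrow> nat \<Rightarrow> bool" where
  "rel n F D \<longleftrightarrow> F \<in> cpoly (W 0 n) \<and> (\<forall>k>D. cf F k = \<zero>) \<and> cf F D \<noteq> \<zero> \<and> ev (v n) F = \<zero>"

definition deg_at :: "nat \<Rightarrow> nat" where
  "deg_at n = (LEAST D. \<exists>F. rel n F D)"

lemma rel_minrel:
  assumes "rel n F (deg_at n)"
  shows "minrel (W 0 n) (v n) F (deg_at n)"
proof -
  have "f \<in> cpoly {\<zero>}" if f: "f \<in> cpoly (W 0 n)" "\<forall>k\<ge>deg_at n. cf f k = \<zero>" "ev (v n) f = \<zero>" for f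
  proof (rule ccontr)
    assume "f \<notin> cpoly {\<zero>}"
    then obtain e where e: "cf f e \<notin> {\<zero>} \<and> (\<forall>k>e. cf f k \<in> {\<zero>})" using last_coefficient_exists[OF cpolyD(1)[OF f(1)], of "{\<zero>}"] by blast
    then have "rel n f e" using f unfolding rel_def by auto
    then have "deg_at n \<le> e" unfolding deg_at_def by (intro Least_le) blast
    then show False using f(2) e by blast
  qed
  moreover have "1 \<le> deg_at n"
  proof (rule ccontr)
    assume "\<not> ?thesis"
    then have z: "deg_at n = 0" by simp
    have FP: "F \<in> carrier P" using assms cpolyD unfolding rel_def by blast
    have "F = mon (cf F 0) 0"
    proof (rule up_eqI)
      show "cf F k = cf (mon (cf F 0) 0) k" for k using assms z FP unfolding rel_def by (cases k) auto
    qed (use FP in auto)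
    then have "ev (v n) F = cf F 0" using ev_const[OF v_closed, of "cf F 0"] FP by simp
    then show False using assms z unfolding rel_def by simp
  qed
  ultimately show ?thesis using assms unfolding minrel_def rel_def by blast
qed

lemma rel_exists: "m \<le> n \<Longrightarrow> \<exists>F. rel n F (deg_at n)"
proof -
  assume "m \<le> n"
  then obtain F D where "minrel (W 0 n) (v n) F D" using minrel_exists[OF W_subring v_closed dep_W0] by blast
  then have "\<exists>D F. rel n F D" unfolding minrel_def rel_def by blast
  then show ?thesis unfolding deg_at_def by (rule LeastI_ex)
qed

lemma rel_shift:
  assumes "rel n F D"
  shows "\<exists>F'. rel (Suc n) F' D \<and> F' \<in> cpoly (\<sigma> ` W 0 n) \<and> cf F' D = \<sigma> (cf F D)"
proof -
  have F: "F \<in> cpoly (W 0 n)" using assms unfolding rel_def by blast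
  obtain F' where F': "F' \<in> cpoly (\<sigma> ` W 0 n)" "\<forall>k. cf F' k = \<sigma> (cf F k)" "ev (\<sigma> (v n)) F' = \<sigma> (ev (v n) F)"
    using sigma_poly[OF W_subring F v_closed] by blast
  have "F' \<in> cpoly (W 0 (Suc n))" using F'(1) cpoly_mono[OF sigma_W0] by blast
  moreover have "cf F D \<in> carrier R" using cpolyD(2)[OF F] W_carrier by blast
  ultimately have "rel (Suc n) F' D" using assms F' sigma_simps(1) sigma_zero_iff[of "cf F D"] unfolding rel_def sigma_v by simp
  then show ?thesis using F' by blast
qed

text \<open>By \<open>rel_shift\<close> the degree cannot grow from level \<open>m\<close> on. Once
  it is constant, a shifted minimal relation is again minimal, and its coefficients lie in the image
  under \<open>\<sigma>\<close> of the ring one level below, as \<open>amalgamate\<close>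
  requires.\<close>

lemma deg_stable: "\<exists>n0\<ge>N. \<forall>n\<ge>n0. deg_at n = deg_at n0"
proof -
  have dec: "deg_at (Suc n) \<le> deg_at n" if "m \<le> n" for n
  proof -
    obtain F where "rel n F (deg_at n)" using rel_exists[OF \<open>m \<le> n\<close>] by blast
    then have "\<exists>F. rel (Suc n) F (deg_at n)" using rel_shift by blast
    then show ?thesis unfolding deg_at_def[of "Suc n"] by (rule Least_le)
  qed
  have dec': "deg_at n' \<le> deg_at n" if "n \<le> n'" "m \<le> n" for n n'
    using that by (induction rule: dec_induct) (use dec in \<open>auto intro: order_trans\<close>)
  define M where "M = max N m"
  obtain n0 where n0: "M \<le> n0" "\<forall>n. M \<le> n \<longrightarrow> deg_at n0 \<le> deg_at n"
    using ex_has_least_nat[of "\<lambda>n. M \<le> n" M deg_at] by blast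
  have "deg_at n = deg_at n0" if "n \<ge> n0" for n
    using dec'[OF that] n0 that unfolding M_def by (simp add: eq_iff)
  then show ?thesis using n0(1) unfolding M_def by auto
qed

text \<open>To climb from level \<open>n0 + k + 1\<close>, the prime with index \<open>i\<close> is
  amalgamated with the image under \<open>\<sigma>\<close> of the prime with index
  \<open>i + 1\<close>, over the image of level \<open>n0 + k\<close>. Agreement over that image is
  exactly the hypothesis on pullbacks, and it is reproduced one level higher.\<close>

lemma periodic_limit:
  assumes st: "\<forall>n\<ge>n0. deg_at n = deg_at n0" and F: "rel n0 F (deg_at n0)"
    and Y: "\<And>i. prime_in (Y i) (W 0 (Suc n0))" and Xp: "\<And>i. cf F (deg_at n0) \<notin> Y i"
    and pl: "\<And>i. pull (W 0 n0) (Y i) = Y (Suc i) \<inter> W 0 n0"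
    and per: "\<And>i. Y (i + T) = Y i"
  shows "\<exists>Q. prime_in (Q 0) U \<and> (\<forall>i. Q i \<inter> W 0 (Suc n0) = Y i) \<and> (\<forall>i. pull U (Q i) = Q (Suc i)) \<and> (\<forall>i. Q (i + T) = Q i)"
proof -
  let ?D = "deg_at n0"
  define p where "p = cf F ?D"
  have pW: "p \<in> W 0 n0" using F cpolyD unfolding p_def rel_def by blast
  have rels: "\<exists>G. rel (Suc (n0 + k)) G ?D \<and> G \<in> cpoly (\<sigma> ` W 0 (n0 + k)) \<and> cf G ?D = (\<sigma> ^^ Suc k) p" for k
  proof (induction k)
    case 0
    then show ?case using rel_shift[OF F] unfolding p_def by simp
  next
    case (Suc k)
    then obtain G where G: "rel (Suc (n0 + k)) G ?D" "cf G ?D = (\<sigma> ^^ Suc k) p" by blast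
    show ?case using rel_shift[OF G(1)] G(2) by simp
  qed
  \<comment> \<open>The choice depends on \<open>i\<close> only through \<open>Z i\<close> and
    \<open>Z (Suc i)\<close>, so a period in \<open>i\<close> persists at all levels.\<close>
  define step where "step = (\<lambda>k Z i. SOME Q. prime_in Q (W 0 (Suc (Suc (n0 + k)))) \<and> Q \<inter> W 0 (Suc (n0 + k)) = Z i \<and>
     pull (W 0 (Suc (n0 + k))) Q = Z (Suc i))"
  define pp where "pp = rec_nat Y step"
  have pp0: "pp 0 = Y" and ppS: "\<And>k. pp (Suc k) = step k (pp k)" unfolding pp_def by simp_all
  have glue: "\<exists>Q. prime_in Q (W 0 (Suc (Suc (n0 + k)))) \<and> Q \<inter> W 0 (Suc (n0 + k)) = Z i \<and>
     pull (W 0 (Suc (n0 + k))) Q = Z (Suc i)"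
    if Z: "\<And>i. prime_in (Z i) (W 0 (Suc (n0 + k)))" "\<And>i. pull (W 0 (n0 + k)) (Z i) = Z (Suc i) \<inter> W 0 (n0 + k)"
      "\<And>i. (\<sigma> ^^ Suc k) p \<notin> Z i" for k Z i
  proof -
    let ?B = "W 0 (Suc (n0 + k))" let ?BB = "\<sigma> ` W 0 (n0 + k)" let ?z = "v (Suc (n0 + k))"
    obtain G where G: "rel (Suc (n0 + k)) G ?D" "G \<in> cpoly ?BB" "cf G ?D = (\<sigma> ^^ Suc k) p" using rels by blast
    \<comment> \<open>Stability of the degree is what makes the transported relation
      \<open>G\<close> minimal here.\<close>
    have deq: "deg_at (Suc (n0 + k)) = ?D" by (rule st[rule_format]) simp
    have mr: "minrel ?B ?z G ?D" using rel_minrel[of "Suc (n0 + k)" G] G(1) unfolding deq by blast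
    have sB: "\<sigma> ` ?B = adj ?BB ?z" using sigma_adj[OF W_subring v_closed] by (simp add: sigma_v)
    have p0: "prime_in (\<sigma> ` Z (Suc i)) (adj ?BB ?z)" using prime_push[OF Z(1) W_subring, of "Suc i"] unfolding sB .
    have Zc: "Z (Suc i) \<subseteq> carrier R" using prime_inD(1)[OF Z(1)] subringE(1)[OF W_subring] by (rule subset_trans)
    have mem: "\<sigma> t \<in> \<sigma> ` Z (Suc i) \<longleftrightarrow> t \<in> Z (Suc i)" if "t \<in> ?B" for t
      by (rule inj_on_image_mem_iff[OF sigma_inj W_carrier[OF that] Zc])
    have cp: "\<sigma> ` Z (Suc i) \<inter> ?BB = Z i \<inter> ?BB"
    proof -
      have "\<sigma> t \<in> \<sigma> ` Z (Suc i) \<longleftrightarrow> \<sigma> t \<in> Z i" if t: "t \<in> W 0 (n0 + k)" for t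
      proof -
        have "t \<in> ?B" using t W_Suc(1) by blast
        then have "\<sigma> t \<in> \<sigma> ` Z (Suc i) \<longleftrightarrow> t \<in> Z (Suc i)" by (rule mem)
        also have "\<dots> \<longleftrightarrow> t \<in> pull (W 0 (n0 + k)) (Z i)" using Z(2)[of i] t by blast
        also have "\<dots> \<longleftrightarrow> \<sigma> t \<in> Z i" using t unfolding pull_def by blast
        finally show ?thesis .
      qed
      then have iff: "y \<in> \<sigma> ` Z (Suc i) \<longleftrightarrow> y \<in> Z i" if "y \<in> ?BB" for y using that by (elim imageE) simp
      show ?thesis
      proof (rule Set.set_eqI)
        show "y \<in> \<sigma> ` Z (Suc i) \<inter> ?BB \<longleftrightarrow> y \<in> Z i \<inter> ?BB" for y
          using iff[of y] unfolding Int_iff by metis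
      qed
    qed
    have "cf G ?D \<notin> Z i" using G(3) Z(3) by simp
    then have "\<exists>Q. prime_in Q (adj ?B ?z) \<and> Q \<inter> ?B = Z i \<and> Q \<inter> adj ?BB ?z = \<sigma> ` Z (Suc i)"
      by (rule amalgamate[OF W_subring sigma_subring[OF W_subring] sigma_W0 v_closed Z(1) p0 cp mr G(2)])
    then obtain Q where Q: "prime_in Q (adj ?B ?z)" "Q \<inter> ?B = Z i" "Q \<inter> adj ?BB ?z = \<sigma> ` Z (Suc i)" by blast
    have "pull ?B Q = Z (Suc i)"
    proof -
      have "\<sigma> t \<in> Q \<longleftrightarrow> t \<in> Z (Suc i)" if t: "t \<in> ?B" for t
      proof -
        have "\<sigma> t \<in> adj ?BB ?z" using t sB by blast
        then have "\<sigma> t \<in> Q \<longleftrightarrow> \<sigma> t \<in> \<sigma> ` Z (Suc i)" using Q(3) by blast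
        then show ?thesis using mem[OF t] by simp
      qed
      then show ?thesis using prime_inD(1)[OF Z(1)] unfolding pull_def by blast
    qed
    then show ?thesis using Q(1,2) by auto
  qed
  have inv: "(\<forall>i. prime_in (pp k i) (W 0 (Suc (n0 + k)))) \<and> (\<forall>i. pull (W 0 (n0 + k)) (pp k i) = pp k (Suc i) \<inter> W 0 (n0 + k)) \<and>
      (\<forall>i. (\<sigma> ^^ Suc k) p \<notin> pp k i)" for k
  proof (induction k)
    case 0
    have "\<sigma> p \<notin> Y i" for i
    proof
      assume "\<sigma> p \<in> Y i"
      then have "p \<in> pull (W 0 n0) (Y i)" using pW unfolding pull_def by blast
      then show False using pl[of i] Xp[of "Suc i"] unfolding p_def by blast
    qed
    then show ?case using Y pl unfolding pp0 by simp
  next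
    case (Suc k)
    have s: "prime_in (pp (Suc k) i) (W 0 (Suc (Suc (n0 + k)))) \<and> pp (Suc k) i \<inter> W 0 (Suc (n0 + k)) = pp k i \<and>
        pull (W 0 (Suc (n0 + k))) (pp (Suc k) i) = pp k (Suc i)" for i
      unfolding ppS step_def by (rule someI_ex, rule glue) (use Suc in blast)+
    \<comment> \<open>Pulling back by \<open>\<sigma>\<close> reduces this to the same statement for
      \<open>k\<close> and index \<open>Suc i\<close>.\<close>
    have "(\<sigma> ^^ Suc (Suc k)) p \<notin> pp (Suc k) i" for i
    proof
      assume a: "(\<sigma> ^^ Suc (Suc k)) p \<in> pp (Suc k) i"
      have "(\<sigma> ^^ Suc k) p \<in> W 0 (Suc (n0 + k))" using sigma_pow_W0[OF pW, of "Suc k"] by simp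
      then have "(\<sigma> ^^ Suc k) p \<in> pull (W 0 (Suc (n0 + k))) (pp (Suc k) i)" using a unfolding pull_def by simp
      then show False using s[of i] Suc by blast
    qed
    then show ?case using s by simp
  qed
  have s: "prime_in (pp (Suc k) i) (W 0 (Suc (Suc (n0 + k)))) \<and> pp (Suc k) i \<inter> W 0 (Suc (n0 + k)) = pp k i \<and>
      pull (W 0 (Suc (n0 + k))) (pp (Suc k) i) = pp k (Suc i)" for k i
    unfolding ppS step_def by (rule someI_ex, rule glue) (use inv in blast)+
  have pper: "pp k (i + T) = pp k i" for k i
  proof (induction k arbitrary: i)
    case 0
    then show ?case using per pp0 by simp
  next
    case (Suc k)
    then show ?case using Suc[of "Suc i"] unfolding ppS step_def by simp
  qed
  \<comment> \<open>Level \<open>Suc n0\<close> corresponds to \<open>pp 0\<close>. Truncated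
    subtraction assigns \<open>pp 0\<close> to the lower levels too, where nothing but periodicity
    is asserted.\<close>
  let ?p = "\<lambda>n. pp (n - Suc n0)"
  have idx: "\<exists>k. n = Suc (n0 + k)" if "n \<ge> Suc n0" for n using that by (metis add_Suc le_Suc_ex)
  have "\<exists>Q. (\<forall>i. prime_in (Q i) U) \<and> (\<forall>i n. n \<ge> Suc n0 \<longrightarrow> Q i \<inter> W 0 n = ?p n i) \<and> (\<forall>i. pull U (Q i) = Q (Suc i))
     \<and> (\<forall>i j. (\<forall>n. ?p n i = ?p n j) \<longrightarrow> Q i = Q j)"
  proof (rule limit_prime)
    fix n i assume "Suc n0 \<le> n"
    then obtain k where k: "n = Suc (n0 + k)" using idx by blast
    have d: "n - Suc n0 = k" "Suc n - Suc n0 = Suc k" using k by simp_all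
    show "prime_in (?p n i) (W 0 n)" unfolding d using inv k by blast
    show "?p (Suc n) i \<inter> W 0 n = ?p n i" "pull (W 0 n) (?p (Suc n) i) = ?p n (Suc i)" unfolding d using s k by blast+
  qed
  then obtain Q where Q: "\<forall>i. prime_in (Q i) U" "\<forall>i n. n \<ge> Suc n0 \<longrightarrow> Q i \<inter> W 0 n = ?p n i" "\<forall>i. pull U (Q i) = Q (Suc i)"
     "\<forall>i j. (\<forall>n. ?p n i = ?p n j) \<longrightarrow> Q i = Q j" by (elim exE conjE) (rule that)
  have "Q i \<inter> W 0 (Suc n0) = Y i" for i using Q(2)[rule_format, of "Suc n0" i] pp0 by simp
  moreover have "Q (i + T) = Q i" for i by (rule Q(4)[rule_format]) (rule pper)
  ultimately show ?thesis using Q by blast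
qed

text \<open>A prime at level \<open>n0\<close> is extended by one level and pulled back, which moves
  it from one preimage of \<open>q\<close> to the next. The resulting sequence repeats an entry
  lying over \<open>q\<close>; the loop between the repetitions is the periodic sequence needed by
  \<open>periodic_limit\<close>.\<close>

lemma lifts_algebraic:
  assumes s: "s \<in> U" "s \<noteq> \<zero>"
  shows "\<exists>l\<ge>1. \<exists>r\<in>A. r \<noteq> \<zero> \<and> lifts l r s"
proof -
  obtain n1 where n1: "s \<in> W 0 n1" using s(1) unfolding U_def by blast
  \<comment> \<open>The bound \<open>Suc m\<close> makes room for \<open>W 1 m\<close>, where the
    relation of \<open>v 0\<close> over its successors has its coefficients.\<close>
  obtain n0 where n0: "n0 \<ge> max n1 (Suc m)" "\<forall>n\<ge>n0. deg_at n = deg_at n0" using deg_stable by blast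
  have mn: "m \<le> n0" "Suc m \<le> n0" "n1 \<le> n0" using n0(1) by auto
  have sW: "s \<in> W 0 n0" using n1 W_mono[OF mn(3), of 0] by blast
  obtain F where F: "rel n0 F (deg_at n0)" using rel_exists[OF mn(1)] by blast
  define p where "p = cf F (deg_at n0)"
  have pW: "p \<in> W 0 n0" "p \<noteq> \<zero>" using F cpolyD(2) unfolding p_def rel_def by blast+
  obtain c I where cI: "finmod {\<zero>} (W 0 m) (W 0 n0) c I" using finmod_W[OF mn(1)] by blast
  have c0: "c \<in> W 0 m" "c \<noteq> \<zero>" using cI unfolding finmod_def by auto
  have cW: "c \<in> W 0 n0" using c0 W_mono[OF mn(1), of 0] by blast
  obtain g where g: "g \<in> cpoly (W 1 m)" "g \<notin> cpoly {\<zero>}" "ev (v 0) g \<in> {\<zero>}" using dep_back unfolding alg_def by blast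
  obtain e where e: "cf g e \<noteq> \<zero>" using g(1,2) cpolyD unfolding cpoly_def by blast
  have eW: "cf g e \<in> W 0 n0"
  proof -
    have "cf g e \<in> W (Suc 0) m" using cpolyD(2)[OF g(1), of e] by (simp only: One_nat_def)
    then show ?thesis using W_shift[of 0 m] W_mono[OF mn(2), of 0] by blast
  qed
  have al: "alg y (W 1 m) (v 0)" if ye: "cf g e \<notin> y" "\<zero> \<in> y" for y
  proof -
    have "g \<notin> cpoly y" using ye(1) cpolyD(2)[of g y e] by auto
    moreover have "ev (v 0) g \<in> y" using g(3) ye(2) by simp
    ultimately show ?thesis using g(1) unfolding alg_def by auto
  qed
  \<comment> \<open>Four elements must be avoided: \<open>s\<close> by demand, \<open>p\<close> for
    extending and amalgamating, \<open>c\<close> for the fibre bound, and \<open>cf g e\<close> so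
    that \<open>v 0\<close> stays algebraic over its successors and pullbacks stay generic.\<close>
  define b where "b = s \<otimes> (p \<otimes> (c \<otimes> cf g e))"
  have sc: "s \<in> carrier R" "p \<in> carrier R" "c \<in> carrier R" "cf g e \<in> carrier R" using sW pW cW eW W_carrier by blast+
  note sub = subringE[OF W_subring[of 0 n0]]
  have bW: "b \<in> W 0 n0" "b \<noteq> \<zero>" unfolding b_def using sW pW cW eW sub(6) sc s(2) c0(2) e R.integral_iff by simp_all
  obtain r1 where r1: "r1 \<in> A" "r1 \<noteq> \<zero>"
    "\<forall>n' y. n0 \<le> n' \<and> prime_in y (W 0 n') \<and> generic y m \<and> r1 \<notin> y \<longrightarrow> b \<notin> y"
    using avoid_element[OF mn(1) bW] by blast
  obtain r2 where r2: "r2 \<in> A" "r2 \<noteq> \<zero>"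
    "\<forall>q. prime_in q A \<and> r2 \<notin> q \<longrightarrow> (\<exists>y. prime_in y (W 0 n0) \<and> generic y m \<and> y \<inter> A = q)"
    using prime_extension_exists[OF mn(1)] by blast
  \<comment> \<open>\<open>r1\<close> keeps generic primes away from \<open>b\<close>;
    \<open>r2\<close> provides the first prime \<open>x0\<close>.\<close>
  define r where "r = r1 \<otimes> r2"
  have r: "r \<in> A" "r \<noteq> \<zero>" unfolding r_def using r1 r2 subringE(6)[OF A] R.integral_iff subring_carrier[OF A] by auto
  have rq: "r1 \<notin> q \<and> r2 \<notin> q" if "prime_in q A" "r \<notin> q" for q
    using prime_inD(5)[OF that(1) r1(1), of r2] prime_inD(5)[OF that(1) r2(1), of r1] that(2)
      R.m_comm subring_carrier[OF A] r1(1) r2(1) unfolding r_def by metis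
  have avoids: "s \<notin> y \<and> p \<notin> y \<and> c \<notin> y \<and> cf g e \<notin> y"
    if y: "n0 \<le> n'" "prime_in y (W 0 n')" "generic y m" "prime_in (y \<inter> A) A" "r \<notin> y" for n' y
  proof -
    have "b \<notin> y" using r1 y rq[OF y(4)] by blast
    have WW: "W 0 n0 \<subseteq> W 0 n'" using W_mono[OF y(1)] .
    note py = prime_inD(5)[OF y(2)] and s' = subringE(6)[OF W_subring[of 0 n']]
    have i: "s \<in> W 0 n'" "p \<in> W 0 n'" "c \<in> W 0 n'" "cf g e \<in> W 0 n'" using WW sW pW cW eW by blast+
    have "p \<otimes> (c \<otimes> cf g e) \<notin> y" using py[OF i(1)] \<open>b \<notin> y\<close> unfolding b_def by blast
    then have "c \<otimes> cf g e \<notin> y" using py[OF i(2)] by blast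
    then have "cf g e \<notin> y" using py[OF i(3)] by blast
    have pm: "x \<in> y \<Longrightarrow> x \<in> W 0 n' \<Longrightarrow> u \<in> W 0 n' \<Longrightarrow> x \<otimes> u \<in> y" for x u
      using py[of u x] R.m_comm[of x u] W_carrier by simp
    have "s \<notin> y" using pm[OF _ i(1), of "p \<otimes> (c \<otimes> cf g e)"] \<open>b \<notin> y\<close> s' i unfolding b_def by blast
    moreover have "p \<notin> y" using pm[OF _ i(2), of "c \<otimes> cf g e"] \<open>p \<otimes> (c \<otimes> cf g e) \<notin> y\<close> s' i by blast
    moreover have "c \<notin> y" using pm[OF _ i(3,4)] \<open>c \<otimes> cf g e \<notin> y\<close> by blast
    ultimately show ?thesis using \<open>cf g e \<notin> y\<close> by blast
  qed
  have mr: "minrel (W 0 n0) (v n0) F (deg_at n0)" using rel_minrel[OF F] .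
  \<comment> \<open>The period will be \<open>(k - j) * d\<close> with
    \<open>0 < k - j \<le> card I\<close>, so it divides \<open>l * d\<close> for every
    \<open>q\<close> and \<open>d\<close>.\<close>
  define l :: nat where "l = fact (card I)"
  have "lifts l r s" unfolding lifts_def
  proof (intro allI impI)
    fix d q assume d: "(1::nat) \<le> d" and q: "pow_prime d q A \<and> (\<forall>i. (\<sigma> ^^ i) r \<notin> q)"
    have qp: "prime_in q A" using q unfolding pow_prime_def by blast
    have op: "prime_in (orbit i q) A" for i using orbit_prime[OF qp] .
    have ro: "r \<notin> orbit i q" for i using q unfolding orbit_def by blast
    have yex: "\<exists>y. prime_in y (W 0 (Suc n0)) \<and> y \<inter> W 0 n0 = x" if x: "prime_in x (W 0 n0)" "p \<notin> x" for x
      using lying_over[OF W_subring x(1) v_closed mr] x(2) unfolding p_def by simp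
    \<comment> \<open>A fixed extension by one level; its pullback is the next prime of the
      sequence.\<close>
    define Yc where "Yc = (\<lambda>x. SOME y. prime_in y (W 0 (Suc n0)) \<and> y \<inter> W 0 n0 = x)"
    obtain x0 where x0: "prime_in x0 (W 0 n0)" "generic x0 m" "x0 \<inter> A = orbit 0 q"
      using r2(3) op[of 0] rq[OF op ro] by blast
    define x where "x = rec_nat x0 (\<lambda>_ x. pull (W 0 n0) (Yc x))"
    have xS: "x (Suc i) = pull (W 0 n0) (Yc (x i))" "x 0 = x0" for i unfolding x_def by simp_all
    have Yx: "prime_in (Yc (x i)) (W 0 (Suc n0)) \<and> Yc (x i) \<inter> W 0 n0 = x i \<and> generic (Yc (x i)) m"
      if xi: "prime_in (x i) (W 0 n0)" "generic (x i) m" "x i \<inter> A = orbit i q" for i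
    proof -
      have "p \<notin> x i" using avoids[OF _ xi(1,2)] op[of i] ro[of i] r(1) xi(3) by auto
      then have *: "prime_in (Yc (x i)) (W 0 (Suc n0)) \<and> Yc (x i) \<inter> W 0 n0 = x i"
        unfolding Yc_def by (rule someI_ex[OF yex[OF xi(1)]])
      then have "generic (Yc (x i)) m" using generic_restrict[OF mn(1), of "Yc (x i)"] xi(2) by simp
      then show ?thesis using * by blast
    qed
    have x: "prime_in (x i) (W 0 n0) \<and> generic (x i) m \<and> x i \<inter> A = orbit i q" for i
    proof (induction i)
      case 0
      then show ?case using x0 xS(2) by simp
    next
      case (Suc i)
      note Y = Yx[of i]
      have Y': "prime_in (Yc (x i)) (W 0 (Suc n0))" "Yc (x i) \<inter> W 0 n0 = x i" "generic (Yc (x i)) m" using Y Suc by blast+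
      have YA: "Yc (x i) \<inter> A = orbit i q" using Y'(2) Suc A_W[of 0 n0] by blast
      have "cf g e \<notin> Yc (x i)" using avoids[OF _ Y'(1,3)] op[of i] ro[of i] r(1) YA by auto
      then have "alg (Yc (x i)) (W 1 m) (v 0)" using al prime_inD(2)[OF Y'(1)] by blast
      then have "generic (x (Suc i)) m" unfolding xS by (rule pull_generic_algebraic[OF mn(1) Y'(1,3)])
      moreover have "prime_in (x (Suc i)) (W 0 n0)" unfolding xS pull_def by (rule prime_pull[OF Y'(1) W_subring sigma_W0])
      moreover have "x (Suc i) \<inter> A = orbit (Suc i) q"
      proof -
        have "x (Suc i) \<inter> A = pull A (Yc (x i) \<inter> A)" unfolding xS pull_def using A_W[of 0 n0] sA by blast
        then show ?thesis unfolding YA orbit_Suc .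
      qed
      ultimately show ?case by blast
    qed
    have Y: "prime_in (Yc (x i)) (W 0 (Suc n0))" "Yc (x i) \<inter> W 0 n0 = x i" "generic (Yc (x i)) m" for i
      using Yx[of i] x[of i] by blast+
    have xc: "s \<notin> x i \<and> p \<notin> x i \<and> c \<notin> x i" for i
      using avoids[of n0 "x i"] x[of i] op[of i] ro[of i] r(1) by auto
    have per: "orbit (j * d) q = orbit 0 q" for j using orbit_period(2)[of d q 0 j] q by simp
    \<comment> \<open>At multiples of \<open>d\<close> all entries lie over \<open>q\<close>; being
      generic they agree on \<open>W 0 m\<close>, hence lie in one fibre, which has at most
      \<open>card I\<close> elements.\<close>
    have "\<not> inj_on (\<lambda>j. x (j * d)) {..card I}"
    proof
      assume inj: "inj_on (\<lambda>j. x (j * d)) {..card I}"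
      let ?X = "(\<lambda>j. x (j * d)) ` {..card I}"
      have base: "x (j * d) \<inter> W 0 m = x 0 \<inter> W 0 m" for j
      proof (rule generic_eq[OF prime_in_restrict[OF _ W_subring W_mono[OF mn(1)]] prime_in_restrict[OF _ W_subring W_mono[OF mn(1)]]])
        show "x (j * d) \<inter> W 0 m \<inter> A = x 0 \<inter> W 0 m \<inter> A" using x[of "j * d"] x[of 0] per[of j] A_W[of 0 m] by blast
      qed (use x generic_restrict[of m m] in auto)
      have "card ?X \<le> card I"
      proof (rule card_bound[OF W_subring W_subring W_mono[OF mn(1)] cI])
        show "c \<notin> x 0 \<inter> W 0 m" using xc by blast
      qed (use x base in auto)
      moreover have "card ?X = Suc (card I)" using card_image[OF inj] by simp
      ultimately show False by simp
    qed
    then obtain j0 k0 where jk0: "j0 \<le> card I" "k0 \<le> card I" "j0 \<noteq> k0" "x (j0 * d) = x (k0 * d)" unfolding inj_on_def by auto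
    have "\<exists>j k. j < k \<and> k \<le> card I \<and> x (j * d) = x (k * d)"
      using jk0 by (cases "j0 < k0") (auto simp: not_less, metis le_neq_implies_less)
    then obtain j k where jk: "j < k" "k \<le> card I" "x (j * d) = x (k * d)" by blast
    define T where "T = (k - j) * d"
    have T: "0 < T" using jk(1) d unfolding T_def by simp
    have Tl: "T dvd l * d"
      unfolding T_def l_def using jk by (intro mult_dvd_mono dvd_fact) auto
    \<comment> \<open>The segment from \<open>j * d\<close> to \<open>k * d\<close> is repeated
      forever. The sequence need not be periodic from its start, but entry \<open>j * d\<close> lies
      over \<open>q\<close> just as entry 0 does.\<close>
    define idx where "idx = (\<lambda>i. j * d + i mod T)"
    have idxS: "x (Suc (idx i)) = x (idx (Suc i))" for i
    proof (cases "Suc (i mod T) = T")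
      case True
      have "Suc (idx i) = j * d + T" using True unfolding idx_def by simp
      also have "\<dots> = k * d" unfolding T_def using jk(1) by (simp add: diff_mult_distrib)
      finally have "x (Suc (idx i)) = x (j * d)" using jk(3) by simp
      moreover have "Suc i mod T = 0" using True by (metis mod_Suc)
      ultimately show ?thesis unfolding idx_def by simp
    next
      case False
      then have "Suc i mod T = Suc (i mod T)" by (metis mod_Suc)
      then show ?thesis unfolding idx_def by simp
    qed
    have "\<exists>Q. prime_in (Q 0) U \<and> (\<forall>i. Q i \<inter> W 0 (Suc n0) = Yc (x (idx i))) \<and> (\<forall>i. pull U (Q i) = Q (Suc i)) \<and> (\<forall>i. Q (i + T) = Q i)"
    proof (rule periodic_limit[OF n0(2) F Y(1)])
      show "cf F (deg_at n0) \<notin> Yc (x (idx i))" for i using xc[of "idx i"] Y(2)[of "idx i"] pW(1) unfolding p_def by blast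
      show "pull (W 0 n0) (Yc (x (idx i))) = Yc (x (idx (Suc i))) \<inter> W 0 n0" for i
        using xS(1)[of "idx i"] idxS[of i] Y(2)[of "idx (Suc i)"] by simp
      show "Yc (x (idx (i + T))) = Yc (x (idx i))" for i unfolding idx_def by simp
    qed
    then obtain Q where Q: "prime_in (Q 0) U" "\<forall>i. Q i \<inter> W 0 (Suc n0) = Yc (x (idx i))" "\<forall>i. pull U (Q i) = Q (Suc i)" "\<forall>i. Q (i + T) = Q i"
      by (elim exE conjE) (rule that)
    have pw: "(\<sigma> ^^ i) t \<in> Q 0 \<longleftrightarrow> t \<in> Q i" if "t \<in> U" for t i
      using pull_pow[of Q, OF _ that, of i 0] Q(3) by simp
    have QX: "Q i \<inter> W 0 n0 = x (idx i)" for i using Q(2) Y(2)[of "idx i"] W_Suc(1)[of 0 n0] by blast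
    have Qper: "Q (a * T) = Q 0" for a
    proof (induction a)
      case (Suc a)
      have e: "Suc a * T = a * T + T" by simp
      show ?case unfolding e using Q(4) Suc by simp
    qed simp
    have "pow_prime (l * d) (Q 0) U"
    proof -
      obtain a where "l * d = a * T" using Tl by (metis dvd_def mult.commute)
      then have "Q (l * d) = Q 0" using Qper by simp
      then show ?thesis unfolding pow_prime_def using Q(1) pw[of _ "l * d"] prime_inD(1)[OF Q(1)] by auto
    qed
    moreover have "Q 0 \<inter> A = q"
    proof -
      have "Q 0 \<inter> A = x (idx 0) \<inter> A" using QX[of 0] A_W[of 0 n0] by blast
      also have "\<dots> = orbit 0 q" using x[of "idx 0"] per[of j] unfolding idx_def by simp
      also have "\<dots> = q" using prime_inD(1)[OF qp] unfolding orbit_def by auto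
      finally show ?thesis .
    qed
    moreover have "(\<sigma> ^^ i) s \<notin> Q 0" for i
      using pw[OF s(1)] QX[of i] xc[of "idx i"] sW by blast
    ultimately show "\<exists>q'. pow_prime (l * d) q' U \<and> q' \<inter> A = q \<and> (\<forall>i. (\<sigma> ^^ i) s \<notin> q')" by blast
  qed
  moreover have "l \<ge> 1" unfolding l_def by (simp add: fact_ge_1)
  ultimately show ?thesis using r by blast
qed

end

section \<open>Reduction to simple extensions\<close>

context sigma_domain
begin

definition lifting :: "'a set \<Rightarrow> 'a set \<Rightarrow> bool" where
  "lifting A B \<longleftrightarrow> (\<forall>s\<in>B. s \<noteq> \<zero> \<longrightarrow> (\<exists>l\<ge>1. \<exists>r\<in>A. r \<noteq> \<zero> \<and>
     (\<forall>d\<ge>1. \<forall>q. pow_prime d q A \<and> (\<forall>i. (\<sigma> ^^ i) r \<notin> q) \<longrightarrow>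
        (\<exists>q'. pow_prime (l * d) q' B \<and> q' \<inter> A = q \<and> (\<forall>i. (\<sigma> ^^ i) s \<notin> q')))))"

lemma lifting_refl: "lifting A A"
proof -
  have "q \<inter> A = q" if "pow_prime d q A" for q d using that prime_inD(1) unfolding pow_prime_def by blast
  then show ?thesis unfolding lifting_def by (metis le_refl mult_1)
qed

text \<open>The element \<open>r\<close> that the upper extension needs outside the prime is handed
  to the lower extension as the element to be avoided; the factors \<open>l\<close>
  multiply.\<close>

lemma lifting_trans:
  assumes AB: "lifting A B" and BC: "lifting B C" and sub: "A \<subseteq> B"
  shows "lifting A C"
  unfolding lifting_def
proof (intro ballI impI)
  fix s assume s: "s \<in> C" "s \<noteq> \<zero>"
  obtain l r where r: "l \<ge> 1" "r \<in> B" "r \<noteq> \<zero>"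
    "\<forall>d\<ge>1. \<forall>q. pow_prime d q B \<and> (\<forall>i. (\<sigma> ^^ i) r \<notin> q) \<longrightarrow>
        (\<exists>q'. pow_prime (l * d) q' C \<and> q' \<inter> B = q \<and> (\<forall>i. (\<sigma> ^^ i) s \<notin> q'))"
    using BC s unfolding lifting_def by blast
  obtain l' r' where r': "l' \<ge> 1" "r' \<in> A" "r' \<noteq> \<zero>"
    "\<forall>d\<ge>1. \<forall>q. pow_prime d q A \<and> (\<forall>i. (\<sigma> ^^ i) r' \<notin> q) \<longrightarrow>
        (\<exists>q'. pow_prime (l' * d) q' B \<and> q' \<inter> A = q \<and> (\<forall>i. (\<sigma> ^^ i) r \<notin> q'))"
    using AB r(2,3) unfolding lifting_def by blast
  have "\<exists>q'. pow_prime (l * l' * d) q' C \<and> q' \<inter> A = q \<and> (\<forall>i. (\<sigma> ^^ i) s \<notin> q')"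
    if d: "d \<ge> 1" and q: "pow_prime d q A \<and> (\<forall>i. (\<sigma> ^^ i) r' \<notin> q)" for d q
  proof -
    obtain q1 where q1: "pow_prime (l' * d) q1 B" "q1 \<inter> A = q" "\<forall>i. (\<sigma> ^^ i) r \<notin> q1" using r'(4) d q by blast
    moreover have "l' * d \<ge> 1" using d r'(1) by simp
    ultimately obtain q2 where q2: "pow_prime (l * (l' * d)) q2 C" "q2 \<inter> B = q1" "\<forall>i. (\<sigma> ^^ i) s \<notin> q2" using r(4) by blast
    have "q2 \<inter> A = q" using q2(2) q1(2) sub by blast
    then show ?thesis using q2 by (metis mult.assoc)
  qed
  moreover have "l * l' \<ge> 1" using r(1) r'(1) by simp
  ultimately show "\<exists>l\<ge>1. \<exists>r\<in>A. r \<noteq> \<zero> \<and> (\<forall>d\<ge>1. \<forall>q. pow_prime d q A \<and> (\<forall>i. (\<sigma> ^^ i) r \<notin> q) \<longrightarrow>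
        (\<exists>q'. pow_prime (l * d) q' C \<and> q' \<inter> A = q \<and> (\<forall>i. (\<sigma> ^^ i) s \<notin> q')))"
    using r'(2,3) by blast
qed

lemma sigma_pow_domain: "sigma_domain R (\<sigma> ^^ n)"
proof
  show "\<sigma> ^^ n \<in> ring_hom R R"
  proof (induction n)
    case 0
    show ?case by (rule ring_hom_memI) simp_all
  next
    case (Suc n)
    show ?case using ring_hom_trans[OF Suc sigma_hom] unfolding funpow.simps .
  qed
  show "inj_on (\<sigma> ^^ n) (carrier R)"
  proof (induction n)
    case (Suc n)
    have "inj_on \<sigma> ((\<sigma> ^^ n) ` carrier R)" using inj_on_subset[OF sigma_inj] sigma_pow_closed by blast
    then show ?case using comp_inj_on[OF Suc] unfolding funpow.simps by blast
  qed simp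
qed

lemma prime_pull_pow:
  assumes "prime_in Y C" "subring D R" "(\<sigma> ^^ n) ` D \<subseteq> C"
  shows "prime_in {t \<in> D. (\<sigma> ^^ n) t \<in> Y} D"
  using sigma_domain.prime_pull[OF sigma_pow_domain] assms unfolding P_def by blast

lemma sigma_pow_zero: "t \<in> carrier R \<Longrightarrow> (\<sigma> ^^ n) t = \<zero> \<longleftrightarrow> t = \<zero>"
  by (induction n) (auto simp: sigma_zero_iff sigma_pow_closed)

text \<open>The pullback of a prime along a high power of \<open>\<sigma>\<close> extends a lift to \<open>A{\<sigma>\<^sup>N(a)}\<close> to
  a lift to \<open>A{a}\<close>.\<close>

lemma lifting_shift:
  assumes A: "subring A R" "\<sigma> ` A \<subseteq> A"
    and B: "subring B R" "\<sigma> ` B \<subseteq> B" "A \<subseteq> B" and C: "\<sigma> ` C \<subseteq> C" "A \<subseteq> C" "(\<sigma> ^^ N) ` B \<subseteq> C"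
    and AC: "lifting A C"
  shows "lifting A B"
  unfolding lifting_def
proof (intro ballI impI)
  \<comment> \<open>The tower generated by zero is used only for its facts about preimages of primes
    in \<open>A\<close>.\<close>
  interpret T: sigma_tower R P \<sigma> A \<zero>
    by (intro sigma_tower.intro sigma_domain_axioms sigma_tower_axioms.intro A R.zero_closed) (rule P_def)
  fix s assume s: "s \<in> B" "s \<noteq> \<zero>"
  let ?s = "(\<sigma> ^^ N) s"
  have "?s \<in> C" "?s \<noteq> \<zero>" using C(3) s(1) sigma_pow_zero[OF subring_carrier[OF B(1) s(1)], of N] s(2) by blast+
  then obtain l r where r: "l \<ge> 1" "r \<in> A" "r \<noteq> \<zero>"
    "\<forall>d\<ge>1. \<forall>q. pow_prime d q A \<and> (\<forall>i. (\<sigma> ^^ i) r \<notin> q) \<longrightarrow>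
        (\<exists>q'. pow_prime (l * d) q' C \<and> q' \<inter> A = q \<and> (\<forall>i. (\<sigma> ^^ i) ?s \<notin> q'))"
    using AC unfolding lifting_def by blast
  have Cp: "(\<sigma> ^^ n) t \<in> C" if "t \<in> C" for t n using that by (induction n) (use C(1) in auto)
  have Bp: "(\<sigma> ^^ n) t \<in> B" if "t \<in> B" for t n using that by (induction n) (use B(2) in auto)
  have "\<exists>q'. pow_prime (l * d) q' B \<and> q' \<inter> A = q \<and> (\<forall>i. (\<sigma> ^^ i) s \<notin> q')"
    if d: "d \<ge> 1" and q: "pow_prime d q A \<and> (\<forall>i. (\<sigma> ^^ i) r \<notin> q)" for d q
  proof -
    obtain p where p: "pow_prime (l * d) p C" "p \<inter> A = q" "\<forall>i. (\<sigma> ^^ i) ?s \<notin> p" using r(4) d q by blast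
    \<comment> \<open>\<open>M\<close> is at least \<open>N\<close>, so that \<open>B\<close> is
      mapped into \<open>C\<close>, and a multiple of \<open>d\<close>, so that the preimage of
      \<open>q\<close> in \<open>A\<close> is \<open>q\<close> again.\<close>
    define M where "M = (l * N) * d"
    have MN: "M \<ge> N" using r(1) d
    proof -
      have "N * 1 \<le> N * (l * d)" by (intro mult_le_mono2) (use r(1) d in simp)
      then show ?thesis unfolding M_def by (simp add: ac_simps)
    qed
    have BC: "(\<sigma> ^^ M) t \<in> C" if "t \<in> B" for t
    proof -
      have "(\<sigma> ^^ M) t = (\<sigma> ^^ (M - N)) ((\<sigma> ^^ N) t)" using MN by (metis comp_apply funpow_add le_add_diff_inverse2)
      then show ?thesis using Cp C(3) that by auto
    qed
    define q' where "q' = {t \<in> B. (\<sigma> ^^ M) t \<in> p}"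
    have pp: "prime_in p C" "\<And>t. t \<in> C \<Longrightarrow> (\<sigma> ^^ (l * d)) t \<in> p \<longleftrightarrow> t \<in> p" using p(1) unfolding pow_prime_def by blast+
    have "prime_in q' B" unfolding q'_def by (rule prime_pull_pow[OF pp(1) B(1)]) (use BC in blast)
    moreover have "(\<sigma> ^^ (l * d)) t \<in> q' \<longleftrightarrow> t \<in> q'" if t: "t \<in> B" for t
    proof -
      have "(\<sigma> ^^ M) ((\<sigma> ^^ (l * d)) t) = (\<sigma> ^^ (l * d)) ((\<sigma> ^^ M) t)" by (metis add.commute comp_apply funpow_add)
      then show ?thesis unfolding q'_def using pp(2)[OF BC[OF t]] Bp[OF t] t by simp
    qed
    moreover have "q' \<subseteq> B" unfolding q'_def by blast
    ultimately have "pow_prime (l * d) q' B" unfolding pow_prime_def by blast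
    moreover have "q' \<inter> A = q"
    proof -
      have "T.orbit (0 + (l * N) * d) q = T.orbit 0 q" using T.orbit_period(2) q by blast
      moreover have "q \<subseteq> A" using q prime_inD(1) unfolding pow_prime_def by blast
      ultimately have "{b \<in> A. (\<sigma> ^^ M) b \<in> q} = q" unfolding T.orbit_def M_def by auto
      moreover have "(\<sigma> ^^ M) b \<in> p \<longleftrightarrow> (\<sigma> ^^ M) b \<in> q" if "b \<in> A" for b using p(2) T.sigma_pow_A[OF that] by blast
      ultimately show ?thesis unfolding q'_def using B(3) by blast
    qed
    moreover have "(\<sigma> ^^ i) s \<notin> q'" for i
    proof -
      have "(\<sigma> ^^ M) ((\<sigma> ^^ i) s) = (\<sigma> ^^ (M - N + i)) ?s"
      proof -
        have "M + i = (M - N + i) + N" using MN by simp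
        then show ?thesis by (metis comp_apply funpow_add)
      qed
      then show ?thesis unfolding q'_def using p(3) by auto
    qed
    ultimately show ?thesis by blast
  qed
  then show "\<exists>l\<ge>1. \<exists>r\<in>A. r \<noteq> \<zero> \<and> (\<forall>d\<ge>1. \<forall>q. pow_prime d q A \<and> (\<forall>i. (\<sigma> ^^ i) r \<notin> q) \<longrightarrow>
        (\<exists>q'. pow_prime (l * d) q' B \<and> q' \<inter> A = q \<and> (\<forall>i. (\<sigma> ^^ i) s \<notin> q')))"
    using r(1-3) by blast
qed

lemma lifting_simple:
  assumes A: "subring A R" "\<sigma> ` A \<subseteq> A" and a: "a \<in> carrier R"
  shows "\<exists>B. subring B R \<and> \<sigma> ` B \<subseteq> B \<and> A \<subseteq> B \<and> a \<in> B \<and> lifting A B"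
proof -
  interpret T: sigma_tower R P \<sigma> A a
    by (intro sigma_tower.intro sigma_domain_axioms sigma_tower_axioms.intro A a) (rule P_def)
  have "lifting A T.U"
  proof (cases "\<exists>m N. alg {\<zero>} (T.W N m) (T.v (N + m))")
    case False
    then have "\<not> alg {\<zero>} (T.W 0 j) (T.v j)" for j by (metis add_0)
    then show ?thesis using T.lifts_transcendental unfolding lifting_def T.lifts_def by blast
  next
    case True
    \<comment> \<open>The least length of a dependent window over all starting points, attained at
      \<open>N\<close>. Replacing \<open>a\<close> by its \<open>N\<close>-th conjugate puts such a
      window first, and minimality makes all shorter windows independent.\<close>
    define m where "m = (LEAST m. \<exists>N. alg {\<zero>} (T.W N m) (T.v (N + m)))"
    have "\<exists>N. alg {\<zero>} (T.W N m) (T.v (N + m))" unfolding m_def by (rule LeastI_ex[OF True])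
    then obtain N where N: "alg {\<zero>} (T.W N m) (T.v (N + m))" by blast
    have least: "\<not> alg {\<zero>} (T.W k j) (T.v (k + j))" if "j < m" for k j
      using not_less_Least[of j "\<lambda>m. \<exists>N. alg {\<zero>} (T.W N m) (T.v (N + m))"] that unfolding m_def by blast
    interpret T': sigma_tower R P \<sigma> A "(\<sigma> ^^ N) a"
      by (intro sigma_tower.intro sigma_domain_axioms sigma_tower_axioms.intro A sigma_pow_closed a) (rule P_def)
    have v: "T'.v n = T.v (N + n)" for n unfolding T'.v_def T.v_def by (simp add: add.commute[of N n] funpow_add)
    have W: "T'.W k j = T.W (N + k) j" for k j by (induction j) (auto simp: v add.assoc)
    interpret T': sigma_algebraic R P \<sigma> A "(\<sigma> ^^ N) a" m
    proof
      show "\<not> alg {\<zero>} (T'.W k j) (T'.v (k + j))" if "j < m" for k j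
        using least[OF that, of "N + k"] unfolding v W by (simp add: add.assoc)
      show "alg {\<zero>} (T'.W 0 m) (T'.v m)" using N unfolding v W by simp
    qed
    have "lifting A T'.U" using T'.lifts_algebraic unfolding lifting_def T'.lifts_def by blast
    moreover have "(\<sigma> ^^ N) ` T.U \<subseteq> T'.U"
    proof -
      have "(\<sigma> ^^ k) ` T.W 0 n \<subseteq> T.W k n" for k n
      proof (induction k)
        case (Suc k)
        then show ?case using T.sigma_W[of k n] by (auto simp: image_subset_iff)
      qed simp
      then show ?thesis unfolding T.U_def T'.U_def W by fastforce
    qed
    ultimately show ?thesis
      using lifting_shift[OF A T.U_subring T.U_sigma T.A_U T'.U_sigma T'.A_U] by blast
  qed
  then show ?thesis using T.U_subring T.U_sigma T.A_U T.a_U by blast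
qed

lemma lifting_finite:
  assumes A: "subring A R" "\<sigma> ` A \<subseteq> A" and G: "finite G" "G \<subseteq> carrier R"
  shows "\<exists>B. subring B R \<and> \<sigma> ` B \<subseteq> B \<and> A \<subseteq> B \<and> G \<subseteq> B \<and> lifting A B"
  using G
proof (induction G)
  case empty
  then show ?case using A lifting_refl by blast
next
  case (insert g G)
  then obtain B where B: "subring B R" "\<sigma> ` B \<subseteq> B" "A \<subseteq> B" "G \<subseteq> B" "lifting A B" by auto
  obtain C where C: "subring C R" "\<sigma> ` C \<subseteq> C" "B \<subseteq> C" "g \<in> C" "lifting B C"
    using lifting_simple[OF B(1,2), of g] insert.prems by blast
  then have "lifting A C" using lifting_trans[OF B(5) C(5) B(3)] by blast
  then show ?case using B C by blast
qed

end

theorem theorem0p7: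
  fixes S :: "('a, 'm) ring_scheme" and R :: "'a set" and \<sigma> :: "'a \<Rightarrow> 'a"
  assumes "sigma_subring R S \<sigma>"
    and "domain S"
    and "inj_on \<sigma> (carrier S)"
    and "finitely_sigma_generated R S \<sigma>"
  shows "\<exists>l\<ge>1. \<exists>r\<in>R. r \<noteq> \<zero>\<^bsub>S\<^esub> \<and>
    (\<forall>d\<ge>1. \<forall>\<qq>. sigma_pow_primeideal d \<qq> (S\<lparr>carrier := R\<rparr>) \<sigma> \<and>
        (\<Otimes>\<^bsub>S\<^esub>i\<in>{..<d}. (\<sigma> ^^ i) r) \<notin> \<qq> \<longrightarrow>
        (\<exists>\<qq>'. sigma_pow_primeideal (l * d) \<qq>' S \<sigma> \<and> \<qq>' \<inter> R = \<qq>)) \<and>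
    (\<forall>\<qq>. sigma_primeideal \<qq> (S\<lparr>carrier := R\<rparr>) \<sigma> \<and> r \<notin> \<qq> \<longrightarrow>
        (\<exists>\<qq>'. sigma_pow_primeideal l \<qq>' S \<sigma> \<and> \<qq>' \<inter> R = \<qq>))"
proof -
  have R: "subring R S" "\<sigma> ` R \<subseteq> R" and hom: "\<sigma> \<in> ring_hom S S"
    using assms(1) unfolding sigma_subring_def sigma_ring_def by auto
  interpret S: domain S by fact
  interpret sigma_domain S "UP S" \<sigma>
    by (intro sigma_domain.intro UP_domain.intro assms(2) sigma_domain_axioms.intro hom assms(3)) (rule reflexive)
  \<comment> \<open>Again only the facts about preimages in \<open>R\<close> are wanted, so the
    generator is zero.\<close>
  interpret T: sigma_tower S "UP S" \<sigma> R "\<zero>\<^bsub>S\<^esub>"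
    by (intro sigma_tower.intro sigma_domain_axioms sigma_tower_axioms.intro R S.zero_closed) (rule reflexive)
  obtain G where G: "finite G" "G \<subseteq> carrier S" "carrier S = sigma_adjoin S \<sigma> R G"
    using assms(4) unfolding finitely_sigma_generated_def by blast
  obtain B where B: "subring B S" "\<sigma> ` B \<subseteq> B" "R \<subseteq> B" "G \<subseteq> B" "lifting R B"
    using lifting_finite[OF R G(1,2)] by blast
  have "R \<union> (\<Union>n. (\<sigma> ^^ n) ` G) \<subseteq> B"
  proof -
    have "(\<sigma> ^^ n) ` G \<subseteq> B" for n by (induction n) (use B(2,4) in auto)
    then show ?thesis using B(3) by blast
  qed
  then have "sigma_adjoin S \<sigma> R G \<subseteq> B"
    unfolding sigma_adjoin_def using S.generate_ring_min_subring1[OF _ B(1)] subringE(1)[OF B(1)] by blast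
  then have BS: "B = carrier S" using G(3) subringE(1)[OF B(1)] by blast
  have eqS: "S\<lparr>carrier := carrier S\<rparr> = S" by simp
  have prR: "sigma_pow_primeideal d q (S\<lparr>carrier := R\<rparr>) \<sigma> \<longleftrightarrow> pow_prime d q R" for d q
    unfolding sigma_pow_primeideal_def pow_prime_def prime_in_iff[OF R(1)] by simp
  have prS: "sigma_pow_primeideal d q S \<sigma> \<longleftrightarrow> pow_prime d q (carrier S)" for d q
    using prime_in_iff[OF S.carrier_is_subring, of q] unfolding sigma_pow_primeideal_def pow_prime_def eqS by simp
  \<comment> \<open>The element to be avoided is taken to be one.\<close>
  obtain l r where l: "l \<ge> 1" "r \<in> R" "r \<noteq> \<zero>\<^bsub>S\<^esub>"
    and lr: "\<And>d q. d \<ge> 1 \<Longrightarrow> pow_prime d q R \<Longrightarrow> (\<And>i. (\<sigma> ^^ i) r \<notin> q) \<Longrightarrow>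
        \<exists>q'. pow_prime (l * d) q' (carrier S) \<and> q' \<inter> R = q"
    using B(5) S.one_not_zero S.one_closed unfolding lifting_def BS by metis
  have main: "\<exists>q'. sigma_pow_primeideal (l * d) q' S \<sigma> \<and> q' \<inter> R = q"
    if d: "d \<ge> 1" and q: "sigma_pow_primeideal d q (S\<lparr>carrier := R\<rparr>) \<sigma>" and n: "(\<Otimes>\<^bsub>S\<^esub>i\<in>{..<d}. (\<sigma> ^^ i) r) \<notin> q" for d q
  proof -
    have qp: "pow_prime d q R" using q prR by blast
    then have pq: "prime_in q R" unfolding pow_prime_def by blast
    have rc: "(\<sigma> ^^ i) r \<in> R" "(\<sigma> ^^ i) r \<in> carrier S" for i
      using T.sigma_pow_A[OF l(2)] subringE(1)[OF R(1)] by blast+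
    have small: "(\<sigma> ^^ i) r \<notin> q" if i: "i < d" for i
    proof
      assume a: "(\<sigma> ^^ i) r \<in> q"
      have "(\<Otimes>\<^bsub>S\<^esub>i\<in>F. (\<sigma> ^^ i) r) \<in> R" if "finite F" for F
        using that by (induction F) (use rc subringE(3,6)[OF R(1)] in auto)
      then have "(\<Otimes>\<^bsub>S\<^esub>j\<in>{..<d} - {i}. (\<sigma> ^^ j) r) \<in> R" by simp
      then have "(\<Otimes>\<^bsub>S\<^esub>j\<in>{..<d} - {i}. (\<sigma> ^^ j) r) \<otimes>\<^bsub>S\<^esub> (\<sigma> ^^ i) r \<in> q" using prime_inD(5)[OF pq] a by blast
      moreover have "{..<d} = insert i ({..<d} - {i})" using i by auto
      then have "(\<Otimes>\<^bsub>S\<^esub>j\<in>{..<d}. (\<sigma> ^^ j) r) = (\<sigma> ^^ i) r \<otimes>\<^bsub>S\<^esub> (\<Otimes>\<^bsub>S\<^esub>j\<in>{..<d} - {i}. (\<sigma> ^^ j) r)"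
        using S.finprod_insert[of "{..<d} - {i}" i "\<lambda>j. (\<sigma> ^^ j) r"] rc by auto
      ultimately show False using n S.m_comm rc(2) S.finprod_closed[of "\<lambda>j. (\<sigma> ^^ j) r" "{..<d} - {i}"] by auto
    qed
    \<comment> \<open>The preimages of \<open>q\<close> in \<open>R\<close> repeat with period
      \<open>d\<close>, so the exponents below \<open>d\<close>, those of the product, decide for
      all.\<close>
    have "(\<sigma> ^^ i) r \<notin> q" for i
    proof -
      have "T.orbit (i mod d + (i div d) * d) q = T.orbit (i mod d) q" using T.orbit_period(2)[OF qp] .
      then have "T.orbit i q = T.orbit (i mod d) q" by simp
      then show ?thesis using small[of "i mod d"] d l(2) unfolding T.orbit_def by auto
    qed
    then show ?thesis using lr[OF d qp] prS by blast
  qed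
  have "\<exists>q'. sigma_pow_primeideal l q' S \<sigma> \<and> q' \<inter> R = q"
    if q: "sigma_primeideal q (S\<lparr>carrier := R\<rparr>) \<sigma>" "r \<notin> q" for q
  proof -
    have "(\<Otimes>\<^bsub>S\<^esub>i\<in>{..<1}. (\<sigma> ^^ i) r) = r" using l(2) subringE(1)[OF R(1)] by (auto simp: lessThan_Suc)
    then show ?thesis using main[of 1 q] q by simp
  qed
  then show ?thesis using l main by blast
qed

end
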